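(* Let $\varphi\in\mathcal{L-P^*}$ be not of the form $Ce^{\beta z}$ with $C,\beta\in\mathbb{R}$, and suppose that $\varphi$ has exactly $2m$ nonreal zeroes, counting multiplicities. If $\varphi$ possesses property A, then $$2m-2m_{1}\leqslant Z_\mathbb{R}(Q)\leqslant 2m-2m_{1}+Z_\mathbb{R}(Q_{1}),$$ where $2m_1$ is the number of nonreal zeroes of $\varphi'$, counting multiplicities.
   Context: The Laguerre-P\'olya class $\mathcal{L-P}$ consists of the functions $$f(z)=cz^de^{-\gamma z^{2}+q(z)}\prod_{j=1}^{\omega}\left(1-\frac{z}{\alpha_j}\right)e^{\frac{z}{\alpha_j}+\ldots+\frac{z^{l}}{l\alpha_j^{l}}},\quad 0\leqslant\omega\leqslant\infty,$$ where $\gamma\geqslant0$, $q$ is a real polynomial with $\deg q\leqslant1$, $l\leqslant1$ is a nonnegative integer (no exponential factors if $l=0$), $\alpha_j\in\mathbb{R}\setminus\{0\}$, $\sum_j|\alpha_j|^{-l-1}<\infty$, $d$ is a nonnegative integer, $c\in\mathbb{R}$, $c\neq0$. The class $\mathcal{L-P^*}$ consists of the functions $\varphi=pf$ with $f\in\mathcal{L-P}$ and $p$ a real polynomial with no real zeroes (nonzero constants allowed). $Q=\left(\varphi'/\varphi\right)'=\frac{\varphi\varphi''-(\varphi')^2}{\varphi^2}$ and $Q_1=\left(\varphi''/\varphi'\right)'=\frac{\varphi'\varphi'''-(\varphi'')^2}{(\varphi')^2}$. $Z_{\mathbb{R}}(f)$ denotes the number of real zeroes of a real meromorphic function $f$,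 counting multiplicities (with value $\infty$ if there are infinitely many). Property A: let $\alpha$ be a real zero of $\varphi$. Let $\beta_1<\alpha$ be the zero of $\varphi'$ such that $\varphi'(z)\neq0$ on $(\beta_1,\alpha)$, with $\beta_1=-\infty$ if $\varphi'$ has no zeroes in $(-\infty,\alpha)$; let $\beta_2>\alpha$ be the zero of $\varphi'$ such that $\varphi'(z)\neq0$ on $(\alpha,\beta_2)$, with $\beta_2=+\infty$ if $\varphi'$ has no zeroes in $(\alpha,+\infty)$. Then $\varphi$ possesses property A at $\alpha$ if $Q$ has no zeroes in at least one of the intervals $(\beta_1,\alpha)$ and $(\alpha,\beta_2)$. The function $\varphi$ possesses property A if it possesses property A at each of its real zeroes (in particular, any $\varphi$ without real zeroes possesses property A). *)

theory Defs
  imports "HOL-Complex_Analysis.Complex_Analysis" "HOL-Library.Extended_Nat"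
begin

abbreviation real_poly_eval :: "real poly \<Rightarrow> complex \<Rightarrow> complex" where
  "real_poly_eval p z \<equiv> poly (map_poly complex_of_real p) z"

(* The product over j = 1, ..., omega is written with indices j < omega starting at 0; for finite
   omega it is padded by factors 1 (and the sum by zeros). weierstrass_factor l w is
   (1 - w) * exp (w + ... + w^l / l), without exponential factor for l = 0. *)
definition Laguerre_Polya :: "(complex \<Rightarrow> complex) set" where
  "Laguerre_Polya = {f. \<exists>(c::real) (d::nat) (\<gamma>::real) (q::real poly) (l::nat) (\<omega>::enat) (\<alpha>::nat \<Rightarrow> real).
     c \<noteq> 0 \<and> \<gamma> \<ge> 0 \<and> degree q \<le> 1 \<and> l \<le> 1 \<and>
     (\<forall>j. enat j < \<omega> \<longrightarrow> \<alpha> j \<noteq> 0) \<and>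
     summable (\<lambda>j. if enat j < \<omega> then 1 / \<bar>\<alpha> j\<bar> ^ (l + 1) else 0) \<and>
     (\<forall>z. f z = of_real c * z ^ d * exp (- of_real \<gamma> * z ^ 2 + real_poly_eval q z) *
            (\<Prod>j. if enat j < \<omega> then weierstrass_factor l (z / of_real (\<alpha> j)) else 1))}"

definition Laguerre_Polya_star :: "(complex \<Rightarrow> complex) set" where
  "Laguerre_Polya_star = {\<phi>. \<exists>p f. f \<in> Laguerre_Polya \<and> (\<forall>x::real. poly p x \<noteq> 0) \<and>
     (\<forall>z. \<phi> z = real_poly_eval p z * f z)}"

(* A zero of a meromorphic function. The limit, unlike the value, disregards the junk values
   (such as 1 / 0 = 0) which HOL terms take at poles; at a point where f is continuous it just
   says f z = 0. The zero function vanishes everywhere. *)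
definition zero_at :: "(complex \<Rightarrow> complex) \<Rightarrow> complex \<Rightarrow> bool" where
  "zero_at f z \<longleftrightarrow> (f \<longlongrightarrow> 0) (at z)"

lemma zero_at_isCont: "isCont f z \<Longrightarrow> zero_at f z \<longleftrightarrow> f z = 0"
  unfolding zero_at_def isCont_def by (metis LIM_unique)

definition num_zeros :: "(complex \<Rightarrow> complex) \<Rightarrow> complex set \<Rightarrow> enat" where
  "num_zeros f S = (if finite {z \<in> S. zero_at f z}
     then enat (\<Sum>z | z \<in> S \<and> zero_at f z. nat (zorder f z)) else \<infinity>)"

abbreviation num_real_zeros :: "(complex \<Rightarrow> complex) \<Rightarrow> enat" where
  "num_real_zeros f \<equiv> num_zeros f \<real>"

abbreviation num_nonreal_zeros :: "(complex \<Rightarrow> complex) \<Rightarrow> enat" where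
  "num_nonreal_zeros f \<equiv> num_zeros f (- \<real>)"

(* Q is Qf phi and Q_1 is Qf (deriv phi). *)
definition Qf :: "(complex \<Rightarrow> complex) \<Rightarrow> complex \<Rightarrow> complex" where
  "Qf \<phi> = deriv (\<lambda>z. deriv \<phi> z / \<phi> z)"

lemma Qf_eq:
  assumes "\<phi> holomorphic_on UNIV" "\<phi> z \<noteq> 0"
  shows "Qf \<phi> z = (\<phi> z * deriv (deriv \<phi>) z - (deriv \<phi> z) ^ 2) / (\<phi> z) ^ 2"
proof -
  have 1: "(\<phi> has_field_derivative deriv \<phi> z) (at z)"
    using assms(1) by (intro holomorphic_derivI) auto
  have 2: "(deriv \<phi> has_field_derivative deriv (deriv \<phi>) z) (at z)"
    using assms(1) by (intro holomorphic_derivI[of _ UNIV] holomorphic_deriv) auto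
  have "((\<lambda>z. deriv \<phi> z / \<phi> z) has_field_derivative
      (deriv (deriv \<phi>) z * \<phi> z - deriv \<phi> z * deriv \<phi> z) / (\<phi> z * \<phi> z)) (at z)"
    by (rule DERIV_divide[OF 2 1 assms(2)])
  thus ?thesis
    unfolding Qf_def by (simp add: DERIV_imp_deriv power2_eq_square mult.commute)
qed

definition left_crit :: "(complex \<Rightarrow> complex) \<Rightarrow> real \<Rightarrow> ereal \<Rightarrow> bool" where
  "left_crit \<phi> \<alpha> \<beta> \<longleftrightarrow>
     (\<exists>b::real. \<beta> = ereal b \<and> b < \<alpha> \<and> deriv \<phi> (of_real b) = 0 \<and>
        (\<forall>x\<in>{b<..<\<alpha>}. deriv \<phi> (of_real x) \<noteq> 0)) \<or>
     \<beta> = -\<infinity> \<and> (\<forall>x\<in>{..<\<alpha>}. deriv \<phi> (of_real x) \<noteq> 0)"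

definition right_crit :: "(complex \<Rightarrow> complex) \<Rightarrow> real \<Rightarrow> ereal \<Rightarrow> bool" where
  "right_crit \<phi> \<alpha> \<beta> \<longleftrightarrow>
     (\<exists>b::real. \<beta> = ereal b \<and> \<alpha> < b \<and> deriv \<phi> (of_real b) = 0 \<and>
        (\<forall>x\<in>{\<alpha><..<b}. deriv \<phi> (of_real x) \<noteq> 0)) \<or>
     \<beta> = \<infinity> \<and> (\<forall>x\<in>{\<alpha><..}. deriv \<phi> (of_real x) \<noteq> 0)"

definition property_A_at :: "(complex \<Rightarrow> complex) \<Rightarrow> real \<Rightarrow> bool" where
  "property_A_at \<phi> \<alpha> \<longleftrightarrow> (\<exists>\<beta>1 \<beta>2. left_crit \<phi> \<alpha> \<beta>1 \<and> right_crit \<phi> \<alpha> \<beta>2 \<and>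
     ((\<forall>x::real. \<beta>1 < ereal x \<and> x < \<alpha> \<longrightarrow> \<not> zero_at (Qf \<phi>) (of_real x)) \<or>
      (\<forall>x::real. \<alpha> < x \<and> ereal x < \<beta>2 \<longrightarrow> \<not> zero_at (Qf \<phi>) (of_real x))))"

definition property_A :: "(complex \<Rightarrow> complex) \<Rightarrow> bool" where
  "property_A \<phi> \<longleftrightarrow> (\<forall>\<alpha>::real. \<phi> (of_real \<alpha>) = 0 \<longrightarrow> property_A_at \<phi> \<alpha>)"

end

(* Put g = \<phi>' / \<phi>, so that Q = g'. The partial fraction expansion of g shows that Im g < 0 in the upper half-plane
   outside the Jensen discs of the nonreal zeros of \<phi>. Hence all nonreal zeros of \<phi>' and all real zeros of Q lie
   in a bounded set, and the argument principle on a large circle with a real diameter expresses 2m - 2m_1 exactly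
   through the numbers of real zeros of \<phi> and \<phi>' inside and the signs of g at the two end points.

   The real line is cut at the zeros of g. A zero of g of order k is a zero of Q of order k - 1, so it remains to bound
   the number of zeros of Q in each segment, which contains at most one zero of \<phi>. The lower bound is Rolle's theorem
   for g. For the upper bound let F = \<phi> \<phi>'' - \<phi>'^2, which has the zeros of Q; because of
   (F / \<phi>')' = \<phi> Q_1, Rolle's theorem applies to F / \<phi>'. This costs one zero per segment; on an unbounded segment where |\<phi>| decreases
   towards infinity, or on a segment containing a zero of \<phi> (here property A enters), one more zero of Q_1 is found. *)
theory Submission
  imports Defs "HOL-Computational_Algebra.Fundamental_Theorem_Algebra" "HOL-Real_Asymp.Real_Asymp"
begin

subsection \<open>Logarithmic derivatives far from the origin\<close>

text \<open>\<phi> may have infinitely many real zeros and critical points, so neither can be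
  counted alone. What is summed is the order \<open>D\<close> of g over a window (lo, hi) reaching
  beyond the radius R. The argument principle gives 1 - lft lo - rgt hi + 2m - 2m_1 for this sum,
  and the charges of the segments are designed to add up to the same end terms, so nothing is lost
  at the ends of the window.

  The obstacle is a segment with a zero \<alpha> of \<phi>: (F / \<phi>')' contains the factor
  \<phi>, so Rolle's theorem yields no zero of Q_1 across \<alpha>. Property A puts the zeros of Q
  on one side of \<alpha>, and the other side has to supply the missing unit. At a multiple
  \<alpha>, F / \<phi>' tends to 0. At a simple one it equals -\<phi>'(\<alpha>), and one point of
  the other side with nonpositive numerator of Q_1 suffices. Such a point is easy to find next to a
  finite critical point; on an unbounded side it depends on the asymptotics of g. For this, and for
  strict negativity of Q far out on the axis, the bound on Im g carries the rate c Im z / |z|^2 and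
  not merely a sign.\<close>

lemma poly_logderiv_partial_fractions:
  fixes p :: "complex poly"
  assumes "p \<noteq> 0"
  obtains ws where "length ws = degree p"
    and "\<And>z. poly p z = 0 \<longleftrightarrow> z \<in> set ws"
    and "\<And>z. poly p z \<noteq> 0 \<Longrightarrow> poly (pderiv p) z / poly p z = (\<Sum>w\<leftarrow>ws. 1 / (z - w))"
proof -
  have "\<exists>ws. length ws = degree p \<and> (\<forall>z. poly p z = 0 \<longleftrightarrow> z \<in> set ws) \<and>
     (\<forall>z. poly p z \<noteq> 0 \<longrightarrow> poly (pderiv p) z / poly p z = (\<Sum>w\<leftarrow>ws. 1 / (z - w)))"
    using assms
  proof (induction "degree p" arbitrary: p)
    case 0
    then obtain c where "p = [:c:]" by (metis degree_eq_zeroE)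
    with 0 show ?case by (intro exI[of _ "[]"]) auto
  next
    case (Suc n)
    then have "\<not> constant (poly p)" using Suc.hyps(2) by (simp add: constant_degree)
    then obtain w where w: "poly p w = 0" using Fundamental_Theorem_Algebra.fundamental_theorem_of_algebra by blast
    then obtain q where q: "p = [:- w, 1:] * q" by (metis poly_eq_0_iff_dvd dvdE)
    have q0: "q \<noteq> 0" using q Suc.prems by auto
    have "degree p = 1 + degree q" unfolding q by (subst degree_mult_eq) (use q0 in auto)
    then have n: "n = degree q" using Suc.hyps by simp
    then obtain ws where ws: "length ws = degree q" "\<forall>z. poly q z = 0 \<longleftrightarrow> z \<in> set ws"
      "\<forall>z. poly q z \<noteq> 0 \<longrightarrow> poly (pderiv q) z / poly q z = (\<Sum>w\<leftarrow>ws. 1 / (z - w))"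
      using Suc.hyps(1)[OF n q0] by auto
    have "poly (pderiv p) z / poly p z = (\<Sum>w\<leftarrow>w # ws. 1 / (z - w))" if "poly p z \<noteq> 0" for z
    proof -
      have nz: "z \<noteq> w" "poly q z \<noteq> 0" using that unfolding q by auto
      then have "(\<Sum>w\<leftarrow>w # ws. 1 / (z - w)) = 1 / (z - w) + poly (pderiv q) z / poly q z" using ws by simp
      moreover have "poly (pderiv p) z = poly q z + (z - w) * poly (pderiv q) z"
        unfolding q pderiv_mult poly_add poly_mult by (simp add: pderiv_pCons algebra_simps)
      moreover have "poly p z = (z - w) * poly q z" unfolding q by (simp add: algebra_simps)
      ultimately show ?thesis using nz by (simp add: divide_simps)
    qed
    moreover have "poly p z = 0 \<longleftrightarrow> z \<in> set (w # ws)" for z unfolding q using ws by auto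
    ultimately show ?case using ws n Suc.hyps by (intro exI[of _ "w # ws"]) auto
  qed
  then show ?thesis using that by blast
qed

lemma cnj_real_poly_eval: "cnj (real_poly_eval p z) = real_poly_eval p (cnj z)"
  by (induction p) (auto simp: map_poly_pCons)

lemma map_poly_pderiv_of_real: "map_poly complex_of_real (pderiv p) = pderiv (map_poly of_real p)"
  by (rule poly_eqI) (simp add: coeff_map_poly coeff_pderiv)

(* Jensen: outside the disc with diameter [w, cnj w] a pair of conjugate poles still has a negative contribution. *)
lemma Im_conjugate_pair_le:
  fixes z w :: complex
  assumes z: "norm z \<ge> 4 * norm w" "Im z > 0"
  shows "Im (1 / (z - w) + 1 / (z - cnj w)) \<le> - (1 / 32) * Im z / (norm z)^2"
proof -
  define u v where "u = Re w" and "v = Im w"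
  define t where "t = z - of_real u"
  have uv: "\<bar>u\<bar> \<le> norm w" "\<bar>v\<bar> \<le> norm w" unfolding u_def v_def by (auto simp: abs_Re_le_cmod abs_Im_le_cmod)
  have nz: "norm z > 0" using z by (auto)
  have zw: "z \<noteq> w" "z \<noteq> cnj w"
  proof -
    have "norm z > norm w" using z nz by (smt (verit) norm_ge_zero)
    then show "z \<noteq> w" "z \<noteq> cnj w" by auto
  qed
  have w: "w = Complex u v" unfolding u_def v_def by simp
  have prod: "(z - w) * (z - cnj w) = t^2 + of_real (v^2)"
    unfolding t_def w by (simp add: complex_eq_iff power2_eq_square algebra_simps)
  have sum: "(z - w) + (z - cnj w) = 2 * t" unfolding t_def w by (simp add: complex_eq_iff)
  have D: "t^2 + of_real (v^2) \<noteq> 0" using prod zw by (metis mult_eq_0_iff right_minus_eq)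
  have "1 / (z - w) + 1 / (z - cnj w) = (2 * t) / (t^2 + of_real (v^2))"
    using zw unfolding prod[symmetric] sum[symmetric] by (simp add: divide_simps)
  also have "Im \<dots> = - 2 * Im t * ((norm t)^2 - v^2) / (norm (t^2 + of_real (v^2)))^2"
    unfolding Im_divide cmod_power2[symmetric]
    unfolding cmod_power2[of t] by (simp add: power2_eq_square algebra_simps)
  finally have eq: "Im (1 / (z - w) + 1 / (z - cnj w)) = - 2 * Im t * ((norm t)^2 - v^2) / (norm (t^2 + of_real (v^2)))^2" .
  have Imt: "Im t = Im z" unfolding t_def by simp
  have t1: "norm t \<ge> norm z - \<bar>u\<bar>" unfolding t_def
    by (metis norm_of_real norm_triangle_ineq2)
  \<comment> \<open>Factored as (|t| - |v|) (|t| + |v|): since |u| and |v| are at most |z| / 4,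
    either factor is at least |z| / 2.\<close>
  have lo: "(norm t)^2 - v^2 \<ge> (norm z)^2 / 4"
  proof -
    have "norm t - \<bar>v\<bar> \<ge> norm z / 2" using t1 uv z by linarith
    moreover have "norm t + \<bar>v\<bar> \<ge> norm z / 2" using t1 uv z by linarith
    ultimately have "(norm t - \<bar>v\<bar>) * (norm t + \<bar>v\<bar>) \<ge> (norm z / 2) * (norm z / 2)"
      using nz by (intro mult_mono) linarith+
    then show ?thesis by (simp add: power2_eq_square algebra_simps abs_mult_self_eq) 
  qed
  have hi: "norm (t^2 + of_real (v^2)) \<le> 4 * (norm z)^2"
  proof -
    have "norm (z - w) \<le> 2 * norm z" "norm (z - cnj w) \<le> 2 * norm z"
      using norm_triangle_ineq4[of z w] norm_triangle_ineq4[of z "cnj w"] z by (auto simp: ) (smt (verit) norm_ge_zero)+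
    then have "norm (z - w) * norm (z - cnj w) \<le> (2 * norm z) * (2 * norm z)"
      by (intro mult_mono) auto
    then show ?thesis unfolding prod[symmetric] norm_mult by (simp add: power2_eq_square)
  qed
  have pos: "norm (t^2 + of_real (v^2)) > 0" using D by simp
  have "0 \<le> (norm z)^2" by simp
  with lo have nn: "0 \<le> (norm t)^2 - v^2" by linarith
  \<comment> \<open>The numerator is at least |z|^2 / 4 and the denominator at most 16 |z|^4; with
    the factor 2 this gives 2 / (4 * 16) = 1 / 32.\<close>
  have "(norm z)^2 / 4 / (4 * (norm z)^2)^2 \<le> ((norm t)^2 - v^2) / (norm (t^2 + of_real (v^2)))^2"
    by (rule frac_le[OF nn lo _ power_mono[OF hi]]) (use pos in auto)
  then have "2 * Im z * ((norm z)^2 / 4 / (4 * (norm z)^2)^2) \<le> 2 * Im z * (((norm t)^2 - v^2) / (norm (t^2 + of_real (v^2)))^2)"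
    using z by (intro mult_left_mono) auto
  moreover have "2 * Im z * ((norm z)^2 / 4 / (4 * (norm z)^2)^2) = (1/32) * Im z / (norm z)^2"
    using nz by (simp add: divide_simps power2_eq_square)
  moreover have "- 2 * Im z * ((norm t)^2 - v^2) / (norm (t^2 + of_real (v^2)))^2
      = - (2 * Im z * (((norm t)^2 - v^2) / (norm (t^2 + of_real (v^2)))^2))" by simp
  ultimately show ?thesis unfolding eq Imt by linarith
qed

text \<open>The shape of \<phi>' / \<phi> off the real axis, stated for g itself: splitting off a
  real pole then means deleting one term, and no quotient of \<phi> by a linear factor has to be
  formed. The \<open>e j\<close> stand for the convergence terms of genus one; they are real, hence
  invisible in Im g, and so may be arbitrary.\<close>

definition lp_logderiv :: "(complex \<Rightarrow> complex) \<Rightarrow> bool" where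
  "lp_logderiv g \<longleftrightarrow> (\<exists>(\<gamma>::real) (b::real) (P::real poly) (I::nat set) (a::nat \<Rightarrow> real) (e::nat \<Rightarrow> real).
     \<gamma> \<ge> 0 \<and> P \<noteq> 0 \<and>
     (\<forall>z. Im z \<noteq> 0 \<and> real_poly_eval P z \<noteq> 0 \<longrightarrow>
        (\<lambda>j. if j \<in> I then 1 / (z - of_real (a j)) + of_real (e j) else 0) sums
        (g z + 2 * of_real \<gamma> * z - of_real b - real_poly_eval (pderiv P) z / real_poly_eval P z)))"

lemma sum_list_norm_nonneg: "0 \<le> (\<Sum>w\<leftarrow>ws. norm w)"
  by (induction ws) auto

lemma norm_le_sum_list: "w \<in> set ws \<Longrightarrow> norm w \<le> (\<Sum>w\<leftarrow>ws. norm w)"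
  by (induction ws) (auto intro: add_increasing2 add_increasing simp: sum_list_norm_nonneg)

lemma Im_sum_list: "Im (\<Sum>x\<leftarrow>xs. f x) = (\<Sum>x\<leftarrow>xs. Im (f x))"
  by (induction xs) auto

text \<open>Instead of matching roots with their conjugates, P' / P is added to itself in two
  expansions, one over the roots \<open>ws\<close> and one over their conjugates. The sum consists
  of conjugate pairs, and half of the 1 / 32 of a pair is the 1 / 64 per root.\<close>

lemma Im_real_poly_logderiv_le:
  fixes P :: "real poly"
  assumes "P \<noteq> 0"
  shows "\<exists>R\<ge>1. \<forall>z. norm z \<ge> R \<and> Im z > 0 \<longrightarrow> real_poly_eval P z \<noteq> 0 \<and>
           Im (real_poly_eval (pderiv P) z / real_poly_eval P z) \<le> - (real (degree P) / 64) * Im z / (norm z)^2"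
proof -
  define p where "p = map_poly complex_of_real P"
  have "p \<noteq> 0" "degree p = degree P" unfolding p_def using assms
    by (auto simp: degree_map_poly map_poly_eq_0_iff)
  then obtain ws where ws: "length ws = degree P" "\<And>z. poly p z = 0 \<longleftrightarrow> z \<in> set ws"
    "\<And>z. poly p z \<noteq> 0 \<Longrightarrow> poly (pderiv p) z / poly p z = (\<Sum>w\<leftarrow>ws. 1 / (z - w))"
    using poly_logderiv_partial_fractions by metis
  define R where "R = 1 + 4 * (\<Sum>w\<leftarrow>ws. norm w)"
  have le: "4 * norm w \<le> R - 1" if "w \<in> set ws" for w
    unfolding R_def using norm_le_sum_list[OF that] by simp
  have R1: "R \<ge> 1" unfolding R_def by (simp add: sum_list_norm_nonneg)
  have main: "real_poly_eval P z \<noteq> 0 \<and>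
           Im (real_poly_eval (pderiv P) z / real_poly_eval P z) \<le> - (real (degree P) / 64) * Im z / (norm z)^2"
    if z: "norm z \<ge> R" "Im z > 0" for z
  proof -
    have nr: "poly p z' \<noteq> 0" if "norm z' = norm z" for z'
      using le ws(2) z that by (smt (verit) norm_ge_zero)
    have "poly (pderiv p) z / poly p z = cnj (poly (pderiv p) (cnj z) / poly p (cnj z))"
      unfolding p_def map_poly_pderiv_of_real[symmetric] by (simp add: cnj_real_poly_eval)
    also have "\<dots> = (\<Sum>w\<leftarrow>ws. cnj (1 / (cnj z - w)))"
      using ws(3)[OF nr[of "cnj z"]] by (simp add: sum_list_sum_nth)
    also have "\<dots> = (\<Sum>w\<leftarrow>ws. 1 / (z - cnj w))" by simp
    finally have "2 * (poly (pderiv p) z / poly p z) = (\<Sum>w\<leftarrow>ws. 1 / (z - w) + 1 / (z - cnj w))"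
      using ws(3)[OF nr[of z]] by (simp add: sum_list_addf)
    from arg_cong[OF this, of Im]
    have "2 * Im (poly (pderiv p) z / poly p z) = (\<Sum>w\<leftarrow>ws. Im (1 / (z - w) + 1 / (z - cnj w)))"
      unfolding Im_sum_list by (simp only: mult_2 plus_complex.sel)
    also have "\<dots> \<le> (\<Sum>w\<leftarrow>ws. - (1 / 32) * Im z / (norm z)^2)"
      by (intro sum_list_mono Im_conjugate_pair_le) (use le z in force)+
    also have "\<dots> = - (real (degree P) / 32) * Im z / (norm z)^2"
      by (simp add: sum_list_triv ws)
    finally show ?thesis using nr[of z] unfolding p_def map_poly_pderiv_of_real by simp
  qed
  show ?thesis using R1 main by blast
qed


text \<open>Far out in the upper half-plane all contributions to Im g have the same sign, so a
  single ingredient suffices for the bound: the Gaussian, a root of P or one real pole. The rate Im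
  z / |z|^2 is that of a root or a pole; the Gaussian does better. If no ingredient is present, g is
  a real constant.\<close>

lemma lp_logderiv_Im_le:
  assumes "lp_logderiv g"
  shows "(\<exists>b::real. \<forall>z. Im z \<noteq> 0 \<longrightarrow> g z = of_real b) \<or>
    (\<exists>R c. R \<ge> 1 \<and> c > 0 \<and> (\<forall>z. norm z \<ge> R \<and> Im z > 0 \<longrightarrow> Im (g z) \<le> - c * Im z / (norm z)^2))"
proof -
  obtain \<gamma> b P I a e where *: "\<gamma> \<ge> 0" "P \<noteq> 0"
    and S: "\<And>z. Im z \<noteq> 0 \<and> real_poly_eval P z \<noteq> 0 \<Longrightarrow>
        (\<lambda>j. if j \<in> I then 1 / (z - of_real (a j)) + of_real (e j) else 0) sums
        (g z + 2 * of_real \<gamma> * z - of_real b - real_poly_eval (pderiv P) z / real_poly_eval P z)"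
    using assms unfolding lp_logderiv_def by blast
  obtain R where R: "R \<ge> 1" and RP: "\<And>z. norm z \<ge> R \<Longrightarrow> Im z > 0 \<Longrightarrow> real_poly_eval P z \<noteq> 0 \<and>
           Im (real_poly_eval (pderiv P) z / real_poly_eval P z) \<le> - (real (degree P) / 64) * Im z / (norm z)^2"
    using Im_real_poly_logderiv_le[OF \<open>P \<noteq> 0\<close>] by metis
  have bound: "Im (g z) \<le> - 2 * \<gamma> * Im z - (real (degree P) / 64) * Im z / (norm z)^2 - (\<Sum>j\<in>J. Im z / (norm (z - of_real (a j)))^2)"
    if z: "norm z \<ge> R" "Im z > 0" and J: "finite J" "J \<subseteq> I" for z J
  proof -
    define T where "T = g z + 2 * of_real \<gamma> * z - of_real b - real_poly_eval (pderiv P) z / real_poly_eval P z"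
    have "(\<lambda>j. - Im (if j \<in> I then 1 / (z - of_real (a j)) + of_real (e j) else 0)) sums (- Im T)"
      using S[of z] RP[OF z] z unfolding T_def by (intro sums_minus sums_Im) auto
    also have "(\<lambda>j. - Im (if j \<in> I then 1 / (z - of_real (a j)) + of_real (e j) else 0))
       = (\<lambda>j. if j \<in> I then Im z / (norm (z - of_real (a j)))^2 else 0)"
      by (auto simp: Im_divide cmod_power2)
    finally have sm: "(\<lambda>j. if j \<in> I then Im z / (norm (z - of_real (a j)))^2 else 0) sums (- Im T)" .
    \<comment> \<open>The terms of the series are nonnegative for Im z > 0, so a finite part of it
      may be kept and the rest dropped.\<close>
    have "(\<Sum>j\<in>J. if j \<in> I then Im z / (norm (z - of_real (a j)))^2 else 0) \<le> - Im T"
      unfolding sums_unique[OF sm] by (rule sum_le_suminf) (use sm J z in \<open>auto simp: sums_iff\<close>)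
    moreover have "(\<Sum>j\<in>J. if j \<in> I then Im z / (norm (z - of_real (a j)))^2 else 0) = (\<Sum>j\<in>J. Im z / (norm (z - of_real (a j)))^2)"
      using J by (intro sum.cong) auto
    moreover have "Im T = Im (g z) + 2 * \<gamma> * Im z - Im (real_poly_eval (pderiv P) z / real_poly_eval P z)"
      unfolding T_def by simp
    ultimately show ?thesis using RP[OF z] by simp
  qed
  consider "\<gamma> > 0" | "degree P > 0" | j where "j \<in> I" | "\<gamma> = 0" "degree P = 0" "I = {}"
    using * by force
  then show ?thesis
  proof cases
    case 1
    have "Im (g z) \<le> - (2 * \<gamma>) * Im z / (norm z)^2" if z: "norm z \<ge> R" "Im z > 0" for z
    proof -
      have "Im (g z) \<le> - 2 * \<gamma> * Im z"
        using bound[OF z, of "{}"] z by (auto intro: order_trans)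
      moreover have "1 \<le> (norm z)^2" using z R by auto
      then have "2 * \<gamma> * Im z \<ge> 2 * \<gamma> * Im z / (norm z)^2"
        using z 1 frac_le[of "2 * \<gamma> * Im z" "2 * \<gamma> * Im z" 1 "(norm z)^2"] by simp
      ultimately show ?thesis by simp
    qed
    then show ?thesis using R 1 by (intro disjI2 exI[of _ R] exI[of _ "2 * \<gamma>"]) auto
  next
    case 2
    have "Im (g z) \<le> - (real (degree P) / 64) * Im z / (norm z)^2" if z: "norm z \<ge> R" "Im z > 0" for z
      using bound[OF z, of "{}"] z mult_nonneg_nonneg[OF *(1), of "Im z"] by auto
    then show ?thesis using R 2 by (intro disjI2 exI[of _ R] exI[of _ "real (degree P) / 64"]) auto
  next
    case 3
    have "Im (g z) \<le> - (1 / (1 + \<bar>a j\<bar>)^2) * Im z / (norm z)^2" if z: "norm z \<ge> R" "Im z > 0" for z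
    proof -
      have b: "Im (g z) \<le> - (Im z / (norm (z - of_real (a j)))^2)"
      proof -
        have "0 \<le> real (degree P) / 64 * Im z / (norm z)^2" "0 \<le> 2 * \<gamma> * Im z" using z *(1) by auto
        then show ?thesis using bound[OF z, of "{j}"] 3 by simp
      qed
      have "norm (z - of_real (a j)) \<le> norm z + \<bar>a j\<bar>"
        by (metis norm_of_real norm_triangle_ineq4)
      also have "\<dots> \<le> (1 + \<bar>a j\<bar>) * norm z"
        using z R mult_left_mono[of 1 "norm z" "\<bar>a j\<bar>"] by (simp add: algebra_simps)
      finally have "(norm (z - of_real (a j)))^2 \<le> ((1 + \<bar>a j\<bar>) * norm z)^2" by (intro power_mono) auto
      moreover have "z - of_real (a j) \<noteq> 0" using z by auto
      ultimately have "Im z / ((1 + \<bar>a j\<bar>) * norm z)^2 \<le> Im z / (norm (z - of_real (a j)))^2"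
        using z by (intro frac_le) auto
      then show ?thesis using b by (simp add: power_mult_distrib)
    qed
    then show ?thesis using R by (intro disjI2 exI[of _ R] exI[of _ "1 / (1 + \<bar>a j\<bar>)^2"]) (auto simp: add_nonneg_eq_0_iff)
  next
    case 4
    then obtain c where c: "P = [:c:]" "c \<noteq> 0" using *(2) by (metis degree_eq_zeroE pCons_eq_0_iff)
    have "g z = of_real b" if "Im z \<noteq> 0" for z
    proof -
      have "(\<lambda>j::nat. 0::complex) sums (g z - of_real b)" using S[of z] 4 c that by (simp add: map_poly_pCons)
      then have "g z - of_real b = 0" using sums_0 sums_unique2 by blast
      then show ?thesis by simp
    qed
    then show ?thesis by blast
  qed
qed

subsection \<open>Laguerre--Polya products\<close>

definition genus_factor :: "nat set \<Rightarrow> (nat \<Rightarrow> real) \<Rightarrow> nat \<Rightarrow> nat \<Rightarrow> complex \<Rightarrow> complex" where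
  "genus_factor I a l j z = (if j \<in> I then weierstrass_factor l (z / of_real (a j)) else 1)"

context
  fixes I :: "nat set" and a :: "nat \<Rightarrow> real" and l :: nat
  assumes a_nz: "\<And>j. j \<in> I \<Longrightarrow> a j \<noteq> 0"
    and summ: "summable (\<lambda>j. if j \<in> I then 1 / \<bar>a j\<bar> ^ (l + 1) else 0)"
begin

lemma genus_factor_near_1:
  assumes "R > 0"
  shows "\<forall>\<^sub>F j in sequentially. \<forall>z\<in>cball 0 R. norm (genus_factor I a l j z - 1) \<le> 3 * R ^ (l + 1) * (if j \<in> I then 1 / \<bar>a j\<bar> ^ (l + 1) else 0)"
proof -
  have "(\<lambda>j. if j \<in> I then 1 / \<bar>a j\<bar> ^ (l + 1) else 0) \<longlonglongrightarrow> 0" using summ by (rule summable_LIMSEQ_zero)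
  \<comment> \<open>Being below this threshold means |a j| > 2 R, so that |z / a j| \<le> 1 / 2 on
    the disc, as \<open>weierstrass_factor_bound\<close> requires.\<close>
  then have "\<forall>\<^sub>F j in sequentially. (if j \<in> I then 1 / \<bar>a j\<bar> ^ (l + 1) else 0) < 1 / (2 * R) ^ (l + 1)"
    by (rule order_tendstoD) (use assms in auto)
  then show ?thesis
  proof eventually_elim
    case (elim j)
    show ?case
    proof
      fix z :: complex assume z: "z \<in> cball 0 R"
      show "norm (genus_factor I a l j z - 1) \<le> 3 * R ^ (l + 1) * (if j \<in> I then 1 / \<bar>a j\<bar> ^ (l + 1) else 0)"
      proof (cases "j \<in> I")
        case True
        have pos: "\<bar>a j\<bar> > 0" using a_nz[OF True] by simp
        have "1 / \<bar>a j\<bar> ^ (l + 1) < 1 / (2 * R) ^ (l + 1)" using elim True by simp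
        then have "(2 * R) ^ (l + 1) < \<bar>a j\<bar> ^ (l + 1)"
          using pos assms by (metis one_less_inverse_iff divide_less_cancel frac_less2 inverse_eq_divide inverse_less_imp_less zero_less_power)
        then have "2 * R < \<bar>a j\<bar>" by (rule power_less_imp_less_base) simp
        moreover have "norm z \<le> R" using z by simp
        ultimately have "norm z / \<bar>a j\<bar> \<le> 1 / 2" using pos by (simp add: field_simps)
        then have "norm (weierstrass_factor l (z / of_real (a j)) - 1) \<le> 3 * norm (z / of_real (a j)) ^ Suc l"
          by (intro weierstrass_factor_bound) (simp add: norm_divide)
        also have "norm (z / of_real (a j)) ^ Suc l \<le> (R / \<bar>a j\<bar>) ^ Suc l"
          using \<open>norm z \<le> R\<close> pos by (intro power_mono) (auto simp: norm_divide divide_right_mono)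
        finally show ?thesis using True by (simp add: genus_factor_def power_divide)
      qed (simp add: genus_factor_def)
    qed
  qed
qed

lemma summable_genus_bound: "summable (\<lambda>j. 3 * R ^ (l + 1) * (if j \<in> I then 1 / \<bar>a j\<bar> ^ (l + 1) else 0))"
  by (intro summable_mult summ)

lemma convergent_genus_factor: "convergent_prod (\<lambda>j. genus_factor I a l j z)"
proof -
  have "\<forall>\<^sub>F j in sequentially. norm (genus_factor I a l j z - 1) \<le> 3 * (norm z + 1) ^ (l + 1) * (if j \<in> I then 1 / \<bar>a j\<bar> ^ (l + 1) else 0)"
    using genus_factor_near_1[of "norm z + 1"] by (auto elim!: eventually_mono simp: add_nonneg_pos)
  then have "abs_convergent_prod (\<lambda>j. genus_factor I a l j z)"
    unfolding abs_convergent_prod_conv_summable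
    by (intro summable_comparison_test_ev[OF _ summable_genus_bound[of "norm z + 1"]]) (auto elim: eventually_mono)
  then show ?thesis by (rule abs_convergent_prod_imp_convergent_prod)
qed

lemma holomorphic_genus_factor: "genus_factor I a l j holomorphic_on A"
  unfolding genus_factor_def by (cases "j \<in> I") (auto intro!: holomorphic_intros simp: a_nz)

lemma uniform_limit_genus_prod:
  assumes "R > 0"
  shows "uniform_limit (cball 0 R) (\<lambda>N z. \<Prod>j<N. genus_factor I a l j z) (\<lambda>z. \<Prod>j. genus_factor I a l j z) sequentially"
proof -
  have "uniformly_convergent_on (cball 0 R) (\<lambda>N z. \<Prod>j<N. genus_factor I a l j z)"
  proof (rule uniformly_convergent_on_prod')
    show "uniformly_convergent_on (cball 0 R) (\<lambda>N z. \<Sum>j<N. norm (genus_factor I a l j z - 1))"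
    proof (rule Weierstrass_m_test'_ev)
      show "\<forall>\<^sub>F j in sequentially. \<forall>z\<in>cball 0 R. norm (norm (genus_factor I a l j z - 1)) \<le> 3 * R ^ (l + 1) * (if j \<in> I then 1 / \<bar>a j\<bar> ^ (l + 1) else 0)"
        using genus_factor_near_1[OF assms] by simp
    qed (rule summable_genus_bound)
  qed (auto intro: holomorphic_on_imp_continuous_on holomorphic_genus_factor)
  then obtain g where g: "uniform_limit (cball 0 R) (\<lambda>N z. \<Prod>j<N. genus_factor I a l j z) g sequentially"
    by (auto simp: uniformly_convergent_on_def)
  also have "?this \<longleftrightarrow> ?thesis"
  proof (intro uniform_limit_cong)
    fix z :: complex assume "z \<in> cball 0 R"
    with g have "(\<lambda>N. \<Prod>j<N. genus_factor I a l j z) \<longlonglongrightarrow> g z"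
      by (rule tendsto_uniform_limitI)
    then have "(\<lambda>N. \<Prod>j<Suc N. genus_factor I a l j z) \<longlonglongrightarrow> g z"
      by (rule LIMSEQ_Suc)
    moreover have "(\<lambda>N. \<Prod>j<Suc N. genus_factor I a l j z) \<longlonglongrightarrow> (\<Prod>j. genus_factor I a l j z)"
      using convergent_prod_LIMSEQ[OF convergent_genus_factor[of z]] unfolding lessThan_Suc_atMost .
    ultimately show "g z = (\<Prod>j. genus_factor I a l j z)"
      using tendsto_unique by force
  qed auto
  finally show ?thesis .
qed

lemma holomorphic_genus_prod: "(\<lambda>z. \<Prod>j. genus_factor I a l j z) holomorphic_on A"
proof (rule holomorphic_on_subset)
  show "(\<lambda>z. \<Prod>j. genus_factor I a l j z) holomorphic_on UNIV"
  proof (rule holomorphic_uniform_sequence)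
    fix z :: complex
    have "uniform_limit (cball 0 (norm z + 1)) (\<lambda>N z. \<Prod>j<N. genus_factor I a l j z) (\<lambda>z. \<Prod>j. genus_factor I a l j z) sequentially"
      by (rule uniform_limit_genus_prod) (auto intro: add_nonneg_pos)
    hence "uniform_limit (cball z 1) (\<lambda>N z. \<Prod>j<N. genus_factor I a l j z) (\<lambda>z. \<Prod>j. genus_factor I a l j z) sequentially"
      by (rule uniform_limit_on_subset) (simp add: cball_subset_cball_iff)
    thus "\<exists>d>0. cball z d \<subseteq> UNIV \<and> uniform_limit (cball z d) (\<lambda>N z. \<Prod>j<N. genus_factor I a l j z) (\<lambda>z. \<Prod>j. genus_factor I a l j z) sequentially"
      by (intro exI[of _ 1]) auto
  qed (auto intro!: holomorphic_on_prod holomorphic_genus_factor)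
qed auto

lemma genus_prod_eq_0_iff: "(\<Prod>j. genus_factor I a l j z) = 0 \<longleftrightarrow> (\<exists>j\<in>I. z = of_real (a j))"
proof -
  have "(\<lambda>j. genus_factor I a l j z) has_prod (\<Prod>j. genus_factor I a l j z)"
    using convergent_genus_factor by auto
  from has_prod_eq_0_iff[OF this] have "(\<Prod>j. genus_factor I a l j z) = 0 \<longleftrightarrow> (\<exists>j. genus_factor I a l j z = 0)"
    unfolding image_iff by auto
  moreover have "genus_factor I a l j z = 0 \<longleftrightarrow> j \<in> I \<and> z = of_real (a j)" for j
    using a_nz by (auto simp: genus_factor_def)
  ultimately show ?thesis by blast
qed

lemma cnj_genus_prod: "cnj (\<Prod>j. genus_factor I a l j z) = (\<Prod>j. genus_factor I a l j (cnj z))"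
proof -
  have "(\<lambda>N. cnj (\<Prod>j\<le>N. genus_factor I a l j z)) \<longlonglongrightarrow> cnj (\<Prod>j. genus_factor I a l j z)"
    by (intro tendsto_cnj convergent_prod_LIMSEQ convergent_genus_factor)
  moreover have "cnj (genus_factor I a l j z) = genus_factor I a l j (cnj z)" for j
    by (auto simp: genus_factor_def weierstrass_factor_def exp_cnj)
  ultimately have "(\<lambda>N. (\<Prod>j\<le>N. genus_factor I a l j (cnj z))) \<longlonglongrightarrow> cnj (\<Prod>j. genus_factor I a l j z)"
    by simp
  then show ?thesis using LIMSEQ_unique convergent_prod_LIMSEQ[OF convergent_genus_factor[of "cnj z"]] by blast
qed

text \<open>Termwise logarithmic differentiation is justified by the locally uniform convergence.
  The exponential factor contributes the constant 1 / a j for l = 1 and nothing for l = 0.\<close>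

lemma logderiv_genus_prod:
  assumes l: "l \<le> 1" and z: "\<And>j. j \<in> I \<Longrightarrow> z \<noteq> of_real (a j)"
  shows "(\<lambda>j. if j \<in> I then 1 / (z - of_real (a j)) + of_real (if l = 0 then 0 else 1 / a j) else 0) sums
     (deriv (\<lambda>z. \<Prod>j. genus_factor I a l j z) z / (\<Prod>j. genus_factor I a l j z))"
proof -
  have "(\<lambda>j. deriv (genus_factor I a l j) z / genus_factor I a l j z) sums
     (deriv (\<lambda>z. \<Prod>j. genus_factor I a l j z) z / (\<Prod>j. genus_factor I a l j z))"
  proof (rule logderiv_prodinf_complex_uniform_limit)
    show "uniform_limit (ball 0 (norm z + 1)) (\<lambda>N z. \<Prod>j<N. genus_factor I a l j z) (\<lambda>z. \<Prod>j. genus_factor I a l j z) sequentially"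
      by (rule uniform_limit_on_subset[OF uniform_limit_genus_prod[of "norm z + 1"]]) (auto intro: add_nonneg_pos)
    show "(\<Prod>j. genus_factor I a l j z) \<noteq> 0" using z by (auto simp: genus_prod_eq_0_iff)
  qed (auto intro: holomorphic_genus_factor)
  also have "(\<lambda>j. deriv (genus_factor I a l j) z / genus_factor I a l j z) =
     (\<lambda>j. if j \<in> I then 1 / (z - of_real (a j)) + of_real (if l = 0 then 0 else 1 / a j) else 0)"
  proof
    fix j
    show "deriv (genus_factor I a l j) z / genus_factor I a l j z = (if j \<in> I then 1 / (z - of_real (a j)) + of_real (if l = 0 then 0 else 1 / a j) else 0)"
    proof (cases "j \<in> I")
      case False
      then have "genus_factor I a l j = (\<lambda>_. 1)" by (auto simp: genus_factor_def)
      with False show ?thesis by simp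
    next
      case True
      define A where "A = complex_of_real (a j)"
      have nz: "A \<noteq> 0" "z \<noteq> A" using a_nz[OF True] z[OF True] unfolding A_def by auto
      from l consider "l = 0" | "l = 1" by linarith
      then show ?thesis
      proof cases
        case 1
        have "genus_factor I a l j = (\<lambda>z. 1 - z / A)" using True 1
          by (auto simp: genus_factor_def weierstrass_factor_def A_def)
        moreover have "((\<lambda>z. 1 - z / A) has_field_derivative - (1 / A)) (at z)"
          by (auto intro!: derivative_eq_intros simp: nz)
        ultimately have "deriv (genus_factor I a l j) z / genus_factor I a l j z = - (1 / A) / (1 - z / A)"
          by (simp add: DERIV_imp_deriv)
        also have "\<dots> = 1 / (z - A)" using nz by (simp add: divide_simps)
        finally show ?thesis using True 1 by (simp add: A_def)
      next
        case 2
        have "genus_factor I a l j = (\<lambda>z. (1 - z / A) * exp (z / A))" using True 2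
          by (auto simp: genus_factor_def weierstrass_factor_def A_def)
        moreover have "((\<lambda>z. (1 - z / A) * exp (z / A)) has_field_derivative (- (1 / A) + (1 - z / A) / A) * exp (z / A)) (at z)"
          by (auto intro!: derivative_eq_intros simp: nz field_simps)
        ultimately have "deriv (genus_factor I a l j) z / genus_factor I a l j z = ((- (1 / A) + (1 - z / A) / A) * exp (z / A)) / ((1 - z / A) * exp (z / A))"
          by (simp add: DERIV_imp_deriv)
        also have "\<dots> = 1 / (z - A) + 1 / A" using nz by (simp add: divide_simps) (simp add: algebra_simps)
        finally show ?thesis using True 2 by (simp add: A_def)
      qed
    qed
  qed
  finally show ?thesis .
qed

end


lemma real_poly_eval_mult: "real_poly_eval (p * q) z = real_poly_eval p z * real_poly_eval q z"
proof -
  have "map_poly complex_of_real (p * q) = map_poly of_real p * map_poly of_real q"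
    by (rule poly_eqI) (simp add: coeff_map_poly coeff_mult)
  then show ?thesis by simp
qed

lemma real_poly_eval_add: "real_poly_eval (p + q) z = real_poly_eval p z + real_poly_eval q z"
proof -
  have "map_poly complex_of_real (p + q) = map_poly of_real p + map_poly of_real q"
    by (rule poly_eqI) (simp add: coeff_map_poly)
  then show ?thesis by simp
qed

lemma real_poly_eval_smult: "real_poly_eval (smult c p) z = of_real c * real_poly_eval p z"
proof -
  have "map_poly complex_of_real (smult c p) = smult (of_real c) (map_poly of_real p)"
    by (rule poly_eqI) (simp add: coeff_map_poly)
  then show ?thesis by simp
qed

lemma real_poly_eval_of_real: "real_poly_eval p (of_real x) = of_real (poly p x)"
  by (induction p) (auto simp: map_poly_pCons)

text \<open>Normal form: the constant c, the power z^d, the factor exp (q 0) and the polynomial p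
  are merged into one real polynomial P. All nonreal zeros of \<phi> then belong to P, because the
  zeros \<open>a j\<close> of the product are real.\<close>

lemma Laguerre_Polya_starE:
  assumes "\<phi> \<in> Laguerre_Polya_star"
  obtains P :: "real poly" and \<gamma> q :: real and I :: "nat set" and a :: "nat \<Rightarrow> real" and l :: nat
  where "P \<noteq> 0" "\<gamma> \<ge> 0" "l \<le> 1" "\<And>j. j \<in> I \<Longrightarrow> a j \<noteq> 0"
    "summable (\<lambda>j. if j \<in> I then 1 / \<bar>a j\<bar> ^ (l + 1) else 0)"
    "\<phi> = (\<lambda>z. real_poly_eval P z * exp (- of_real \<gamma> * z ^ 2 + of_real q * z) * (\<Prod>j. genus_factor I a l j z))"
proof -
  obtain p f where pf: "f \<in> Laguerre_Polya" "\<And>x::real. poly p x \<noteq> 0" "\<And>z. \<phi> z = real_poly_eval p z * f z"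
    using assms unfolding Laguerre_Polya_star_def by blast
  obtain c::real and d::nat and \<gamma>::real and q::"real poly" and l::nat and \<omega>::enat and \<alpha>::"nat \<Rightarrow> real" where
    f: "c \<noteq> 0" "\<gamma> \<ge> 0" "degree q \<le> 1" "l \<le> 1"
     "\<forall>j. enat j < \<omega> \<longrightarrow> \<alpha> j \<noteq> 0"
     "summable (\<lambda>j. if enat j < \<omega> then 1 / \<bar>\<alpha> j\<bar> ^ (l + 1) else 0)"
     "\<forall>z. f z = of_real c * z ^ d * exp (- of_real \<gamma> * z ^ 2 + real_poly_eval q z) *
            (\<Prod>j. if enat j < \<omega> then weierstrass_factor l (z / of_real (\<alpha> j)) else 1)"
    using pf(1) unfolding Laguerre_Polya_def by blast
  obtain q0 q1 where q: "q = [:q0, q1:]"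
  proof -
    have "q = [:coeff q 0, coeff q 1:]"
    proof (rule poly_eqI)
      fix n show "coeff q n = coeff [:coeff q 0, coeff q 1:] n"
        using f(3) coeff_eq_0[of q n] by (auto simp: coeff_pCons split: nat.splits)
    qed
    then show thesis using that by blast
  qed
  define P where "P = smult (c * exp q0) (monom 1 d * p)"
  have P: "real_poly_eval P z = of_real (c * exp q0) * (z ^ d * real_poly_eval p z)" for z
    unfolding P_def real_poly_eval_mult real_poly_eval_smult by (simp add: map_poly_monom poly_monom)
  show thesis
  proof (rule that[of P \<gamma> l "{j. enat j < \<omega>}" \<alpha> q1])
    have "p \<noteq> 0" using pf(2) by auto
    then show "P \<noteq> 0" unfolding P_def using f(1) by (simp add: monom_eq_0_iff)
    show "\<phi> = (\<lambda>z. real_poly_eval P z * exp (- of_real \<gamma> * z ^ 2 + of_real q1 * z) * (\<Prod>j. genus_factor {j. enat j < \<omega>} \<alpha> l j z))"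
    proof
      fix z
      have "- of_real \<gamma> * z ^ 2 + real_poly_eval q z = of_real q0 + (- of_real \<gamma> * z ^ 2 + of_real q1 * z)"
        unfolding q by (simp add: map_poly_pCons)
      then have "exp (- of_real \<gamma> * z ^ 2 + real_poly_eval q z) = of_real (exp q0) * exp (- of_real \<gamma> * z ^ 2 + of_real q1 * z)"
        by (simp only: exp_add exp_of_real)
      then show "\<phi> z = real_poly_eval P z * exp (- of_real \<gamma> * z ^ 2 + of_real q1 * z) * (\<Prod>j. genus_factor {j. enat j < \<omega>} \<alpha> l j z)"
        unfolding P pf(3) f(7)[rule_format] genus_factor_def mem_Collect_eq by (simp only: of_real_mult mult_ac)
    qed
  qed (use f(2,4,5,6) in \<open>simp_all\<close>)
qed

text \<open>These five facts are all that the sequel uses about the class; the product itself does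
  not occur again.\<close>

lemma
  assumes "\<phi> \<in> Laguerre_Polya_star"
  shows holomorphic_Laguerre_Polya_star: "\<phi> holomorphic_on UNIV"
    and cnj_Laguerre_Polya_star: "\<phi> (cnj z) = cnj (\<phi> z)"
    and finite_nonreal_zeros_Laguerre_Polya_star: "finite {z. Im z \<noteq> 0 \<and> \<phi> z = 0}"
    and lp_logderiv_Laguerre_Polya_star: "lp_logderiv (\<lambda>z. deriv \<phi> z / \<phi> z)"
    and lp_logderiv_remove_zero: "\<phi> (of_real \<alpha>) = 0 \<Longrightarrow> lp_logderiv (\<lambda>z. deriv \<phi> z / \<phi> z - 1 / (z - of_real \<alpha>))"
proof -
  obtain P \<gamma> q I a l where *: "P \<noteq> 0" "\<gamma> \<ge> 0" "l \<le> 1" "\<And>j. j \<in> I \<Longrightarrow> a j \<noteq> 0"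
    "summable (\<lambda>j. if j \<in> I then 1 / \<bar>a j\<bar> ^ (l + 1) else 0)"
    and \<phi>: "\<phi> = (\<lambda>z. real_poly_eval P z * exp (- of_real \<gamma> * z ^ 2 + of_real q * z) * (\<Prod>j. genus_factor I a l j z))"
    by (rule Laguerre_Polya_starE[OF assms]) (rule that)
  define G where "G = (\<lambda>z. \<Prod>j. genus_factor I a l j z)"
  have Gholo: "G holomorphic_on A" for A unfolding G_def by (rule holomorphic_genus_prod[OF *(4,5)])
  have G0: "G z = 0 \<longleftrightarrow> (\<exists>j\<in>I. z = of_real (a j))" for z unfolding G_def by (rule genus_prod_eq_0_iff[OF *(4,5)])
  have Gl: "(\<lambda>j. if j \<in> I then 1 / (z - of_real (a j)) + of_real (if l = 0 then 0 else 1 / a j) else 0) sums (deriv G z / G z)"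
    if "Im z \<noteq> 0" for z unfolding G_def
    by (rule logderiv_genus_prod[OF *(4,5,3)]) (use that in auto)
  have \<phi>G: "\<phi> = (\<lambda>z. real_poly_eval P z * exp (- of_real \<gamma> * z ^ 2 + of_real q * z) * G z)"
    unfolding G_def \<phi> ..
  show holo: "\<phi> holomorphic_on UNIV" unfolding \<phi>G by (intro holomorphic_intros Gholo)
  show "\<phi> (cnj z) = cnj (\<phi> z)" unfolding \<phi>
    by (simp add: cnj_real_poly_eval cnj_genus_prod[OF *(4,5)] exp_cnj)
  have nz: "\<phi> z = 0 \<longleftrightarrow> real_poly_eval P z = 0 \<or> (\<exists>j\<in>I. z = of_real (a j))" for z unfolding \<phi>G by (simp add: G0)
  have "{z. Im z \<noteq> 0 \<and> \<phi> z = 0} \<subseteq> {z. real_poly_eval P z = 0}" unfolding nz by auto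
  moreover have "finite {z. real_poly_eval P z = 0}" by (rule poly_roots_finite) (use *(1) in \<open>simp add: map_poly_eq_0_iff\<close>)
  ultimately show "finite {z. Im z \<noteq> 0 \<and> \<phi> z = 0}" by (rule finite_subset)
  have ld: "deriv \<phi> z / \<phi> z = real_poly_eval (pderiv P) z / real_poly_eval P z - 2 * of_real \<gamma> * z + of_real q + deriv G z / G z"
    if "Im z \<noteq> 0" "real_poly_eval P z \<noteq> 0" for z
  proof -
    have Gz: "G z \<noteq> 0" unfolding G0 using that by auto
    have [derivative_intros]: "(G has_field_derivative deriv G z) (at z)"
      by (rule holomorphic_derivI[OF Gholo[of UNIV]]) auto
    have [derivative_intros]: "(real_poly_eval P has_field_derivative real_poly_eval (pderiv P) z) (at z)"
      unfolding map_poly_pderiv_of_real by (rule poly_DERIV)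
    define E where "E = (\<lambda>z::complex. exp (- of_real \<gamma> * z ^ 2 + of_real q * z))"
    have [derivative_intros]: "(E has_field_derivative E z * (- 2 * of_real \<gamma> * z + of_real q)) (at z)"
      unfolding E_def by (auto intro!: derivative_eq_intros)
    have \<phi>E: "\<phi> = (\<lambda>z. real_poly_eval P z * E z * G z)" unfolding \<phi>G E_def ..
    have Ez: "E z \<noteq> 0" unfolding E_def by simp
    have "(\<phi> has_field_derivative (real_poly_eval P z * (E z * (- 2 * of_real \<gamma> * z + of_real q)) + real_poly_eval (pderiv P) z * E z) * G z
         + real_poly_eval P z * E z * deriv G z) (at z)"
      unfolding \<phi>E by (auto intro!: derivative_eq_intros simp: algebra_simps)
    then have "deriv \<phi> z = (real_poly_eval P z * (E z * (- 2 * of_real \<gamma> * z + of_real q)) + real_poly_eval (pderiv P) z * E z) * G z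
         + real_poly_eval P z * E z * deriv G z" by (rule DERIV_imp_deriv)
    moreover have "\<phi> z = real_poly_eval P z * E z * G z" unfolding \<phi>G E_def ..
    ultimately show ?thesis using Gz Ez that by (simp add: divide_simps) (simp add: algebra_simps)
  qed
  show "lp_logderiv (\<lambda>z. deriv \<phi> z / \<phi> z)"
    unfolding lp_logderiv_def
    by (rule exI[of _ \<gamma>], rule exI[of _ q], rule exI[of _ P], rule exI[of _ I], rule exI[of _ a], rule exI[of _ "\<lambda>j. if l = 0 then 0 else 1 / a j"])
       (use * Gl ld in \<open>auto simp: algebra_simps\<close>)
  assume \<alpha>: "\<phi> (of_real \<alpha>) = 0"
  then consider "poly P \<alpha> = 0" | k where "k \<in> I" "a k = \<alpha>" unfolding nz by (auto simp: real_poly_eval_of_real)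
  then show "lp_logderiv (\<lambda>z. deriv \<phi> z / \<phi> z - 1 / (z - of_real \<alpha>))"
  proof cases
    \<comment> \<open>\<alpha> is a root of P: one linear factor of P is cancelled, and the series
      stays as it is.\<close>
    case 1
    then obtain P' where P': "P = [:-\<alpha>, 1:] * P'" by (metis poly_eq_0_iff_dvd dvdE)
    have ev: "real_poly_eval P z = (z - of_real \<alpha>) * real_poly_eval P' z" for z
      unfolding P' real_poly_eval_mult by (simp add: map_poly_pCons algebra_simps)
    have ev': "real_poly_eval (pderiv P) z = real_poly_eval P' z + (z - of_real \<alpha>) * real_poly_eval (pderiv P') z" for z
      unfolding P' pderiv_mult real_poly_eval_add real_poly_eval_mult by (simp add: map_poly_pCons pderiv_pCons algebra_simps)
    have "real_poly_eval (pderiv P) z / real_poly_eval P z = 1 / (z - of_real \<alpha>) + real_poly_eval (pderiv P') z / real_poly_eval P' z"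
      if "Im z \<noteq> 0" "real_poly_eval P' z \<noteq> 0" for z
    proof -
      have "z - of_real \<alpha> \<noteq> 0" using that by auto
      then show ?thesis unfolding ev ev' using that by (simp add: divide_simps)
    qed
    moreover have "real_poly_eval P z \<noteq> 0" if "Im z \<noteq> 0" "real_poly_eval P' z \<noteq> 0" for z
      unfolding ev using that by auto
    moreover have "P' \<noteq> 0" using *(1) P' by auto
    ultimately show ?thesis unfolding lp_logderiv_def
      by (intro exI[of _ \<gamma>] exI[of _ q] exI[of _ P'] exI[of _ I] exI[of _ a] exI[of _ "\<lambda>j. if l = 0 then 0 else 1 / a j"])
       (use * Gl ld in \<open>auto simp: algebra_simps\<close>)
  next
    \<comment> \<open>\<alpha> = a k: the index k is deleted from I, and its convergence term moves
      into the real constant.\<close>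
    case 2
    let ?e = "\<lambda>j. if l = 0 then 0 else 1 / a j"
    have "(\<lambda>j. if j \<in> I - {k} then 1 / (z - of_real (a j)) + of_real (?e j) else 0) sums
       (deriv G z / G z - (1 / (z - of_real \<alpha>) + of_real (?e k)))" if "Im z \<noteq> 0" for z
    proof -
      have "(\<lambda>j. (if j \<in> I then 1 / (z - of_real (a j)) + of_real (?e j) else 0) - (if j = k then 1 / (z - of_real (a k)) + of_real (?e k) else 0)) sums
        (deriv G z / G z - (1 / (z - of_real (a k)) + of_real (?e k)))"
        by (intro sums_diff Gl that sums_single)
      also have "(\<lambda>j. (if j \<in> I then 1 / (z - of_real (a j)) + of_real (?e j) else 0) - (if j = k then 1 / (z - of_real (a k)) + of_real (?e k) else 0))
        = (\<lambda>j. if j \<in> I - {k} then 1 / (z - of_real (a j)) + of_real (?e j) else 0)"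
        using 2 by auto
      finally show ?thesis using 2 by simp
    qed
    then show ?thesis unfolding lp_logderiv_def
      by (intro exI[of _ \<gamma>] exI[of _ "q + ?e k"] exI[of _ P] exI[of _ "I - {k}"] exI[of _ a] exI[of _ ?e])
       (use * ld in \<open>auto simp: algebra_simps\<close>)
  qed
qed

subsection \<open>Counting zeros segment by segment\<close>

definition iv :: "ereal \<Rightarrow> ereal \<Rightarrow> real set" where
  "iv a b = {x. a < ereal x \<and> ereal x < b}"

lemma iv_split:
  assumes "a < ereal c" "ereal c < b"
  shows "iv a b = iv a (ereal c) \<union> {c} \<union> iv (ereal c) b"
proof (rule set_eqI)
  fix x
  consider "x < c" | "x = c" | "c < x" by linarith
  then show "x \<in> iv a b \<longleftrightarrow> x \<in> iv a (ereal c) \<union> {c} \<union> iv (ereal c) b"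
  proof cases
    case 1
    then have "ereal x < ereal c" by simp
    from order.strict_trans[OF this assms(2)] 1 show ?thesis by (auto simp: iv_def)
  next
    case 3
    then have "ereal c < ereal x" by simp
    from order.strict_trans[OF assms(1) this] 3 show ?thesis by (auto simp: iv_def)
  qed (use assms in \<open>auto simp: iv_def\<close>)
qed

(* A consecutive pair of nodes gets the charge f of its left end plus the charge f' of its right end. *)
lemma sum_over_partition_ge:
  fixes w :: "real \<Rightarrow> int" and f f' :: "ereal \<Rightarrow> int"
  assumes "finite B" "B \<subseteq> iv lo hi" "lo < hi"
    and fin: "finite {x \<in> iv lo hi. w x \<noteq> 0}"
    and seg: "\<And>a b. a \<in> insert lo (ereal ` B) \<Longrightarrow> b \<in> insert hi (ereal ` B) \<Longrightarrow> a < b \<Longrightarrow> iv a b \<inter> B = {} \<Longrightarrow>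
        f a + f' b \<le> (\<Sum>x | x \<in> iv a b \<and> w x \<noteq> 0. w x)"
    and node: "\<And>x. x \<in> B \<Longrightarrow> 0 \<le> w x + f (ereal x) + f' (ereal x)"
  shows "f lo + f' hi \<le> (\<Sum>x | x \<in> iv lo hi \<and> w x \<noteq> 0. w x)"
  using assms
proof (induction "card B" arbitrary: B hi)
  case 0
  then have "B = {}" by simp
  with 0 show ?case by simp
next
  case (Suc n)
  then have "B \<noteq> {}" by auto
  define c where "c = Max B"
  have cB: "c \<in> B" unfolding c_def using Suc.prems \<open>B \<noteq> {}\<close> by simp
  have c_max: "x \<le> c" if "x \<in> B" for x unfolding c_def using Suc.prems that by simp
  have c: "lo < ereal c" "ereal c < hi" using cB Suc.prems(2) by (auto simp: iv_def)
  define B' where "B' = B - {c}"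
  have B': "B' \<subseteq> iv lo (ereal c)"
  proof
    fix x assume "x \<in> B'"
    then have "x \<in> B" "x \<noteq> c" unfolding B'_def by auto
    then show "x \<in> iv lo (ereal c)" using c_max[of x] Suc.prems(2) by (auto simp: iv_def)
  qed
  have sub: "iv lo (ereal c) \<subseteq> iv lo hi" "iv (ereal c) hi \<subseteq> iv lo hi"
    unfolding iv_split[OF c] by auto
  have fin1: "finite {x \<in> iv lo (ereal c). w x \<noteq> 0}" and fin2: "finite {x \<in> iv (ereal c) hi. w x \<noteq> 0}"
    using sub by (auto intro: finite_subset[OF _ Suc.prems(4)])
  have IH: "f lo + f' (ereal c) \<le> (\<Sum>x | x \<in> iv lo (ereal c) \<and> w x \<noteq> 0. w x)"
  proof (rule Suc.hyps(1))
    show "n = card B'" unfolding B'_def using Suc.hyps(2) cB Suc.prems(1) by (simp add: card_Diff_singleton)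
    show "finite B'" using Suc.prems(1) unfolding B'_def by simp
    show "f a + f' b \<le> (\<Sum>x | x \<in> iv a b \<and> w x \<noteq> 0. w x)"
      if "a \<in> insert lo (ereal ` B')" "b \<in> insert (ereal c) (ereal ` B')" "a < b" "iv a b \<inter> B' = {}" for a b
    proof (rule Suc.prems(5))
      have "b \<le> ereal c" using that(2) B' by (auto simp: iv_def)
      then have "c \<notin> iv a b" by (auto simp: iv_def)
      with that(4) show "iv a b \<inter> B = {}" unfolding B'_def by auto
    qed (use that cB in \<open>auto simp: B'_def\<close>)
  qed (use B' c fin1 Suc.prems in \<open>auto simp: B'_def\<close>)
  have last: "f (ereal c) + f' hi \<le> (\<Sum>x | x \<in> iv (ereal c) hi \<and> w x \<noteq> 0. w x)"
  proof (rule Suc.prems(5))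
    show "iv (ereal c) hi \<inter> B = {}" using c_max by (force simp: iv_def)
  qed (use cB c in auto)
  have "(\<Sum>x | x \<in> iv lo hi \<and> w x \<noteq> 0. w x) = (\<Sum>x \<in> {x \<in> iv lo (ereal c). w x \<noteq> 0} \<union> (insert c {x \<in> iv (ereal c) hi. w x \<noteq> 0}). w x)"
    by (rule sum.mono_neutral_left) (use fin1 fin2 in \<open>auto simp: iv_split[OF c]\<close>)
  also have "\<dots> = (\<Sum>x | x \<in> iv lo (ereal c) \<and> w x \<noteq> 0. w x) + (w c + (\<Sum>x | x \<in> iv (ereal c) hi \<and> w x \<noteq> 0. w x))"
    using fin1 fin2 by (subst sum.union_disjoint) (auto simp: iv_def)
  finally show ?case using IH last Suc.prems(6)[OF cB] by linarith
qed

subsection \<open>Zeros of the numerator of $Q_1$ on the real line\<close>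

lemma same_sign:
  fixes k :: "real \<Rightarrow> real"
  assumes "\<And>x. isCont k x" "\<And>z. min x y \<le> z \<Longrightarrow> z \<le> max x y \<Longrightarrow> k z \<noteq> 0"
  shows "k x * k y > 0"
proof (rule ccontr)
  assume n: "\<not> k x * k y > 0"
  have "connected (k ` {min x y..max x y})"
    by (intro connected_continuous_image continuous_at_imp_continuous_on) (use assms in auto)
  moreover have "k x \<in> k ` {min x y..max x y}" "k y \<in> k ` {min x y..max x y}" by auto
  moreover have "k x \<noteq> 0" "k y \<noteq> 0" using assms(2) by auto
  ultimately have "0 \<in> k ` {min x y..max x y}"
    using n unfolding connected_iff_interval by (metis less_eq_real_def linorder_not_less zero_less_mult_iff)
  then show False using assms(2) by auto
qed

locale real_jet =
  fixes f0 f1 f2 f3 :: "real \<Rightarrow> real"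
  assumes d0: "(f0 has_real_derivative f1 x) (at x)"
    and d1: "(f1 has_real_derivative f2 x) (at x)"
    and d2: "(f2 has_real_derivative f3 x) (at x)"
    and cont3: "isCont f3 x"
begin

definition F :: "real \<Rightarrow> real" where "F x = f0 x * f2 x - (f1 x)^2"
definition F1 :: "real \<Rightarrow> real" where "F1 x = f1 x * f3 x - (f2 x)^2"
definition h :: "real \<Rightarrow> real" where "h x = F x / f1 x"

lemma cont [continuous_intros]: "isCont f0 x" "isCont f1 x" "isCont f2 x" "isCont F x" "isCont F1 x"
proof -
  show c: "isCont f0 x" "isCont f1 x" "isCont f2 x" using d0 d1 d2 by (auto intro: DERIV_isCont)
  show "isCont F x" "isCont F1 x" unfolding F_def[abs_def] F1_def[abs_def] by (intro continuous_intros c cont3)+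
qed

lemma cont_h: "f1 x \<noteq> 0 \<Longrightarrow> isCont h x"
  unfolding h_def[abs_def] by (intro continuous_intros cont)

text \<open>With h written as f0 * (f2 / f1) - f1, the two terms f2 in the derivative cancel, and
  only f0 times the derivative of f2 / f1 remains.\<close>

lemma h_deriv:
  assumes "f1 x \<noteq> 0"
  shows "(h has_real_derivative f0 x * F1 x / (f1 x)^2) (at x)"
proof -
  have "((\<lambda>x. f0 x * (f2 x / f1 x) - f1 x) has_real_derivative f1 x * (f2 x / f1 x) + (f3 x * f1 x - f2 x * f2 x) / (f1 x * f1 x) * f0 x - f2 x) (at x)"
    by (intro DERIV_diff DERIV_mult DERIV_divide d0 d1 d2 assms)
  moreover have "\<forall>\<^sub>F y in nhds x. h y = f0 y * (f2 y / f1 y) - f1 y"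
  proof -
    have "\<forall>\<^sub>F y in nhds x. f1 y \<noteq> 0"
      using cont(2)[of x] assms by (simp add: isCont_def tendsto_imp_eventually_ne eventually_nhds_conv_at)
    then show ?thesis by eventually_elim (simp add: h_def F_def field_simps power2_eq_square)
  qed
  ultimately have "(h has_real_derivative f1 x * (f2 x / f1 x) + (f3 x * f1 x - f2 x * f2 x) / (f1 x * f1 x) * f0 x - f2 x) (at x)"
    by (subst DERIV_cong_ev[OF refl _ refl]) auto
  then show ?thesis using assms by (simp add: F1_def field_simps power2_eq_square)
qed

lemma logderiv_deriv:
  assumes "f0 x \<noteq> 0"
  shows "((\<lambda>x. f1 x / f0 x) has_real_derivative F x / (f0 x)^2) (at x)"
  using DERIV_divide[OF d1 d0 assms] by (simp add: F_def power2_eq_square algebra_simps)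

lemma logderiv1_deriv:
  assumes "f1 x \<noteq> 0"
  shows "((\<lambda>x. f2 x / f1 x) has_real_derivative F1 x / (f1 x)^2) (at x)"
  using DERIV_divide[OF d2 d1 assms] by (simp add: F1_def power2_eq_square algebra_simps)

lemma F1_zero_between:
  assumes "x < y" "F x = 0" "F y = 0" "\<And>z. x < z \<Longrightarrow> z < y \<Longrightarrow> f0 z \<noteq> 0" "\<And>z. x \<le> z \<Longrightarrow> z \<le> y \<Longrightarrow> f1 z \<noteq> 0"
  obtains z where "x < z" "z < y" "F1 z = 0"
proof -
  have "\<exists>z. x < z \<and> z < y \<and> (h has_real_derivative 0) (at z)"
  proof (rule Rolle)
    show "continuous_on {x..y} h"
      by (rule continuous_at_imp_continuous_on) (use cont_h assms in auto)
    show "h differentiable at z" if "x < z" "z < y" for z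
      using h_deriv[of z] assms(5)[of z] that by (auto simp: real_differentiable_def)
  qed (use assms in \<open>auto simp: h_def\<close>)
  then obtain z where z: "x < z" "z < y" "(h has_real_derivative 0) (at z)" by blast
  then have "f0 z * F1 z / (f1 z)^2 = 0"
    using h_deriv[of z] assms(5)[of z] DERIV_unique by force
  then show thesis using that[of z] z assms(4)[of z] assms(5)[of z] by auto
qed

text \<open>Here f0 is positive and decreases on the whole half-line. If F1 had no zero, h would be
  monotone; as it starts with h x0 = 0 and is positive far out, it would stay above a positive
  constant. Then the negative function u = f0 / f1 - f0 would have a derivative bounded below by a
  positive constant.\<close>

lemma F1_zero_at_infinity_pos:
  assumes "F x0 = 0" and nz: "\<And>x. x0 \<le> x \<Longrightarrow> f0 x > 0" "\<And>x. x0 \<le> x \<Longrightarrow> f1 x < 0"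
    and F: "\<And>x. X \<le> x \<Longrightarrow> F x < 0"
  obtains z where "x0 < z" "F1 z = 0"
proof (rule ccontr)
  assume n: "\<not> thesis"
  note thesisI = that
  have nz1: "F1 z \<noteq> 0" if "x0 < z" for z using thesisI[OF that] n by blast
  have cont_h: "continuous_on {x0..y} h" for y
    by (rule continuous_at_imp_continuous_on) (use cont_h nz(2) in force)
  define Y where "Y = max X (x0 + 1)"
  have Y: "X \<le> Y" "x0 < Y" unfolding Y_def by auto
  have hY: "h x > 0" if "Y \<le> x" for x
    unfolding h_def using F[of x] nz(2)[of x] that Y by (auto intro: divide_neg_neg)
  have pos: "F1 z > 0" if "x0 < z" for z
  proof (rule ccontr)
    assume "\<not> F1 z > 0"
    have neg: "F1 t < 0" if "x0 < t" for t
      using same_sign[of F1 z t] cont \<open>x0 < z\<close> that nz1 \<open>\<not> F1 z > 0\<close> by (auto simp: zero_less_mult_iff min_def split: if_splits)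
    have "h Y < h x0"
    proof (rule DERIV_neg_imp_decreasing_open[OF Y(2)])
      show "\<exists>d. (h has_real_derivative d) (at x) \<and> d < 0" if "x0 < x" "x < Y" for x
        using h_deriv[of x] neg[of x] nz[of x] that by (intro exI[of _ "f0 x * F1 x / (f1 x)^2"]) (auto intro!: divide_neg_pos mult_pos_neg)
    qed (rule cont_h)
    then show False using hY[of Y] assms(1) by (simp add: h_def)
  qed
  have mono: "h Y \<le> h x" if "Y \<le> x" for x
  proof (rule DERIV_nonneg_imp_nondecreasing[OF that])
    show "\<exists>d. (h has_real_derivative d) (at t) \<and> 0 \<le> d" if "Y \<le> t" "t \<le> x" for t
      using h_deriv[of t] pos[of t] nz[of t] that Y by (intro exI[of _ "f0 t * F1 t / (f1 t)^2"]) (auto intro!: divide_nonneg_pos mult_nonneg_nonneg less_imp_le)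
  qed
  \<comment> \<open>With t = - f1 x > 0 the derivative of u is h / t + t. The second summand is at
    least 1 if t \<ge> 1, the first at least h Y if t < 1. The term - f0 in u is there to produce
    the summand t.\<close>
  define k where "k = min 1 (h Y)"
  have k: "k > 0" using hY[of Y] unfolding k_def by auto
  define u where "u = (\<lambda>x. f0 x / f1 x - f0 x)"
  have u': "(u has_real_derivative - h x / f1 x - f1 x) (at x)" if "Y \<le> x" for x
  proof -
    have "f1 x \<noteq> 0" using nz(2)[of x] that Y by auto
    moreover from this have "(u has_real_derivative (f1 x * f1 x - f0 x * f2 x) / (f1 x * f1 x) - f1 x) (at x)"
      unfolding u_def by (intro DERIV_diff DERIV_divide d0 d1)
    ultimately show ?thesis by (simp add: h_def F_def field_simps power2_eq_square)
  qed
  have u'ge: "- h x / f1 x - f1 x \<ge> k" if "Y \<le> x" for x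
  proof -
    define t where "t = - f1 x"
    have t: "t > 0" using nz(2)[of x] that Y unfolding t_def by auto
    have hk: "h x \<ge> k" using mono[OF that] unfolding k_def by auto
    have "h x / t + t \<ge> k"
    proof (cases "t \<ge> 1")
      case True
      moreover have "h x / t \<ge> 0" using t hk k by auto
      ultimately show ?thesis unfolding k_def by linarith
    next
      case False
      then have "h x / t \<ge> h x / 1" using t hk k by (intro divide_left_mono) auto
      then show ?thesis using hk t by simp
    qed
    then show ?thesis unfolding t_def by simp
  qed
  have grow: "u x \<ge> u Y + k * (x - Y)" if "Y \<le> x" for x
  proof -
    have "(\<lambda>x. u x - k * x) Y \<le> (\<lambda>x. u x - k * x) x"
    proof (rule DERIV_nonneg_imp_nondecreasing[OF that])
      show "\<exists>d. ((\<lambda>x. u x - k * x) has_real_derivative d) (at t) \<and> 0 \<le> d" if "Y \<le> t" "t \<le> x" for t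
        using u'[of t] u'ge[of t] that by (intro exI[of _ "- h t / f1 t - f1 t - k"]) (auto intro!: derivative_eq_intros)
    qed
    then show ?thesis by (simp add: algebra_simps)
  qed
  define x where "x = Y + \<bar>u Y\<bar> / k"
  have "Y \<le> x" using k unfolding x_def by auto
  then have "u x \<ge> u Y + \<bar>u Y\<bar>" using grow[of x] k unfolding x_def by simp
  moreover have "u x < 0" 
  proof -
    have "f0 x > 0" "f1 x < 0" using nz[of x] \<open>Y \<le> x\<close> Y by auto
    then show ?thesis unfolding u_def using divide_pos_neg[of "f0 x" "f1 x"] by linarith
  qed
  ultimately show False by linarith
qed

end

lemma real_jet_uminus: "real_jet f0 f1 f2 f3 \<Longrightarrow> real_jet (\<lambda>x. - f0 x) (\<lambda>x. - f1 x) (\<lambda>x. - f2 x) (\<lambda>x. - f3 x)"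
  unfolding real_jet_def by (auto intro!: derivative_intros)

text \<open>Several one-sided statements are proved at one end only and carried to the other by x ->
  -x, under which the derivatives of odd order change sign.\<close>

lemma real_jet_mirror: "real_jet f0 f1 f2 f3 \<Longrightarrow> real_jet (\<lambda>x. f0 (- x)) (\<lambda>x. - f1 (- x)) (\<lambda>x. f2 (- x)) (\<lambda>x. - f3 (- x))"
proof -
  assume "real_jet f0 f1 f2 f3"
  then interpret real_jet f0 f1 f2 f3 .
  have *: "((\<lambda>x. k (- x)) has_real_derivative - k' (- x)) (at x)"
    if "\<And>x. (k has_real_derivative k' x) (at x)" for k k' :: "real \<Rightarrow> real" and x
    using that[of "- x"] by (simp add: DERIV_mirror)
  show ?thesis
  proof
    fix x
    show "((\<lambda>x. f0 (- x)) has_real_derivative - f1 (- x)) (at x)" by (rule *[OF d0])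
    show "((\<lambda>x. - f1 (- x)) has_real_derivative f2 (- x)) (at x)" using DERIV_minus[OF *[OF d1]] by simp
    show "((\<lambda>x. f2 (- x)) has_real_derivative - f3 (- x)) (at x)" by (rule *[OF d2])
    show "isCont (\<lambda>x. - f3 (- x)) x" by (intro continuous_intros isCont_o2[where f = uminus]) (rule cont3)
  qed
qed

context real_jet
begin

lemma F1_zero_at_infinity:
  assumes "F x0 = 0" and nz: "\<And>x. x0 \<le> x \<Longrightarrow> f0 x \<noteq> 0" "\<And>x. x0 \<le> x \<Longrightarrow> f1 x \<noteq> 0"
    and sg: "f0 x0 * f1 x0 < 0" and F: "\<And>x. X \<le> x \<Longrightarrow> F x < 0"
  obtains z where "x0 < z" "F1 z = 0"
proof -
  note thesisI = that
  have s: "f0 x0 * f0 x > 0" "f1 x0 * f1 x > 0" if "x0 \<le> x" for x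
    using same_sign[of f0 x0 x] same_sign[of f1 x0 x] that nz cont by (auto simp: min_def max_def)
  show thesis
  proof (cases "f0 x0 > 0")
    case True
    then have "f1 x0 < 0" using sg by (simp add: mult_less_0_iff)
    show thesis
      by (rule F1_zero_at_infinity_pos[OF assms(1) _ _ F]) (use s True \<open>f1 x0 < 0\<close> thesisI in \<open>force simp: zero_less_mult_iff\<close>)+
  next
    case False
    then have neg: "f0 x0 < 0" "f1 x0 > 0" using sg by (auto simp: mult_less_0_iff)
    interpret m: real_jet "\<lambda>x. - f0 x" "\<lambda>x. - f1 x" "\<lambda>x. - f2 x" "\<lambda>x. - f3 x"
      by (rule real_jet_uminus) (rule real_jet_axioms)
    have eq: "m.F = F" "m.F1 = F1" unfolding m.F_def F_def m.F1_def F1_def by auto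
    show thesis
      by (rule m.F1_zero_at_infinity_pos[of x0 X]) (use s neg thesisI eq F assms(1) in \<open>force simp: zero_less_mult_iff\<close>)+
  qed
qed


text \<open>f0^2 is positive at x and falls to 0 at \<alpha>, so its derivative 2 f0 f1 is negative
  somewhere in between, and without zeros this sign persists.\<close>

lemma logderiv_sign_left:
  assumes "f0 \<alpha> = 0" "x < \<alpha>" and nz: "\<And>z. x \<le> z \<Longrightarrow> z < \<alpha> \<Longrightarrow> f0 z \<noteq> 0 \<and> f1 z \<noteq> 0"
  shows "f0 x * f1 x < 0"
proof -
  obtain z where z: "x < z" "z < \<alpha>" "(f0 \<alpha>)^2 - (f0 x)^2 = (\<alpha> - x) * (2 * f0 z * f1 z)"
  proof -
    have "((\<lambda>x. (f0 x)^2) has_real_derivative 2 * f0 t * f1 t) (at t)" for t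
      using d0[of t] by (auto intro!: derivative_eq_intros)
    from MVT2[OF assms(2) this] show ?thesis using that by blast
  qed
  have "f0 x \<noteq> 0" using nz[of x] assms(2) by simp
  then have "(\<alpha> - x) * (2 * f0 z * f1 z) < 0" using z(3) assms(1) by (metis diff_0 neg_less_0_iff_less power_zero_numeral zero_less_power2)
  then have zneg: "f0 z * f1 z < 0" using assms(2) by (simp add: mult_less_0_iff zero_less_mult_iff)
  have "(f0 x * f1 x) * (f0 z * f1 z) > 0"
    by (rule same_sign) (use nz z cont in \<open>auto intro!: continuous_intros simp: min_def\<close>)
  then show ?thesis using zneg by (simp add: zero_less_mult_iff[of "f0 x * f1 x"])
qed

text \<open>At a multiple zero h = f2 * (f0 / f1) - f1 tends to 0, because f0 / f1 and f1 do.
  Extended by 0 to \<alpha>, it satisfies Rolle's theorem on [\<alpha>, x1], as if \<alpha> were a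
  zero of F / f1.\<close>

lemma F1_zero_right_of_multiple_zero:
  assumes "f1 \<alpha> = 0" "\<alpha> < x1" "F x1 = 0"
    and lim: "((\<lambda>x. f0 x / f1 x) \<longlongrightarrow> 0) (at_right \<alpha>)"
    and nz: "\<And>z. \<alpha> < z \<Longrightarrow> z \<le> x1 \<Longrightarrow> f0 z \<noteq> 0 \<and> f1 z \<noteq> 0"
  obtains z where "\<alpha> < z" "z < x1" "F1 z = 0"
proof -
  define k where "k = (\<lambda>x. if x = \<alpha> then 0 else h x)"
  have kd: "(k has_real_derivative f0 x * F1 x / (f1 x)^2) (at x)" if "\<alpha> < x" "x \<le> x1" for x
  proof -
    have "\<forall>\<^sub>F y in nhds x. k y = h y"
    proof -
      have "\<forall>\<^sub>F y in nhds x. y \<in> {\<alpha><..}" using that by (intro eventually_nhds_in_open) auto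
      then show ?thesis by eventually_elim (simp add: k_def)
    qed
    then show ?thesis using h_deriv[of x] nz[OF that] by (subst DERIV_cong_ev[OF refl _ refl]) auto
  qed
  have "continuous (at_right \<alpha>) k"
  proof -
    have "((\<lambda>x. f2 x * (f0 x / f1 x) - f1 x) \<longlongrightarrow> f2 \<alpha> * 0 - f1 \<alpha>) (at_right \<alpha>)"
      using cont[of \<alpha>] lim by (intro tendsto_intros) (auto simp: isCont_def intro: tendsto_within_subset)
    moreover have "\<forall>\<^sub>F x in at_right \<alpha>. f2 x * (f0 x / f1 x) - f1 x = k x"
      unfolding eventually_at_right_field using nz assms(2)
      by (intro exI[of _ x1]) (auto simp: k_def h_def F_def field_simps power2_eq_square)
    ultimately have "(k \<longlongrightarrow> 0) (at_right \<alpha>)" using assms(1) by (simp add: tendsto_cong)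
    then show ?thesis by (simp add: continuous_within k_def)
  qed
  have contk: "continuous_on {\<alpha>..x1} k"
    unfolding continuous_on_eq_continuous_within
  proof
    fix x assume x: "x \<in> {\<alpha>..x1}"
    show "continuous (at x within {\<alpha>..x1}) k"
    proof (cases "x = \<alpha>")
      case True
      then show ?thesis using \<open>continuous (at_right \<alpha>) k\<close> assms(2)
        by (simp add: continuous_within at_within_Icc_at_right)
    next
      case False
      then show ?thesis using kd[of x] x by (auto intro!: continuous_at_imp_continuous_at_within DERIV_isCont)
    qed
  qed
  have "\<exists>z. \<alpha> < z \<and> z < x1 \<and> (k has_real_derivative 0) (at z)"
  proof (rule Rolle[OF assms(2) _ contk])
    show "k \<alpha> = k x1" using assms by (simp add: k_def h_def)
    show "k differentiable at x" if "\<alpha> < x" "x < x1" for x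
      using kd[of x] that by (auto simp: real_differentiable_def)
  qed
  then obtain z where z: "\<alpha> < z" "z < x1" "(k has_real_derivative 0) (at z)" by blast
  then have "f0 z * F1 z / (f1 z)^2 = 0" using kd[of z] DERIV_unique by force
  then show thesis using that[of z] z nz[of z] by auto
qed

text \<open>h \<alpha> = - f1 \<alpha> is negative while h x1 = 0, but f0 \<ge> 0 to the right of
  \<alpha> together with F1 < 0 keeps h from increasing there.\<close>

lemma F1_zero_across_simple_zero_pos:
  assumes "f0 \<alpha> = 0" "b < \<alpha>" "\<alpha> < x1" "F x1 = 0"
    and nz: "\<And>z. b < z \<Longrightarrow> z \<le> x1 \<Longrightarrow> f1 z > 0"
    and neg: "\<And>z. b < z \<Longrightarrow> z < x1 \<Longrightarrow> F1 z < 0"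
  shows False
proof -
  have "f0 \<alpha> \<le> f0 x" if "\<alpha> \<le> x" "x \<le> x1" for x
    by (rule DERIV_nonneg_imp_nondecreasing[OF that(1)]) (use d0 nz that assms(2) in \<open>force intro: less_imp_le\<close>)
  then have f0: "f0 x \<ge> 0" if "\<alpha> \<le> x" "x \<le> x1" for x using that assms(1) by simp
  have "h x1 \<le> h \<alpha>"
  proof (rule DERIV_nonpos_imp_decreasing_open[where f = h])
    show "\<exists>d. (h has_real_derivative d) (at x) \<and> d \<le> 0" if "\<alpha> < x" "x < x1" for x
      using h_deriv[of x] neg[of x] nz[of x] f0[of x] that assms(2)
      by (intro exI[of _ "f0 x * F1 x / (f1 x)^2"]) (auto intro!: divide_nonpos_pos mult_nonneg_nonpos)
    show "continuous_on {\<alpha>..x1} h"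
    proof (intro continuous_at_imp_continuous_on ballI cont_h)
      show "f1 x \<noteq> 0" if "x \<in> {\<alpha>..x1}" for x using nz[of x] that assms(2) by auto
    qed
  qed (use assms in auto)
  moreover have "h \<alpha> = - f1 \<alpha>" using assms(1) nz[of \<alpha>] assms(2,3) by (simp add: h_def F_def power2_eq_square)
  moreover have "h x1 = 0" using assms(4) by (simp add: h_def)
  ultimately show False using nz[of \<alpha>] assms(2,3) by simp
qed

text \<open>Without a zero, F1 would keep the sign it has at y and be negative up to x1, which has
  just been refuted. So all that is needed from the left side of \<alpha> is one point y where F1 is
  not positive; the next two lemmas supply it for a finite and for an infinite left end.\<close>

lemma F1_zero_across_simple_zero:
  assumes "f0 \<alpha> = 0" "b < \<alpha>" "\<alpha> < x1" "F x1 = 0"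
    and nz: "\<And>z. b < z \<Longrightarrow> z \<le> x1 \<Longrightarrow> f1 z \<noteq> 0"
    and y: "b < y" "y < \<alpha>" "F1 y \<le> 0"
  obtains z where "b < z" "z < x1" "F1 z = 0"
proof (rule ccontr)
  assume n: "\<not> thesis"
  note thesisI = that
  have nz1: "F1 z \<noteq> 0" if "b < z" "z < x1" for z using thesisI[OF that] n by blast
  have neg: "F1 z < 0" if "b < z" "z < x1" for z
    using same_sign[of F1 y z] cont nz1 that y assms(3) by (auto simp: zero_less_mult_iff min_def max_def split: if_splits)
  have s: "f1 \<alpha> * f1 z > 0" if "b < z" "z \<le> x1" for z
    using same_sign[of f1 \<alpha> z] that nz cont assms(2,3) by (auto simp: min_def max_def split: if_splits)
  show False
  proof (cases "f1 \<alpha> > 0")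
    case True
    then show ?thesis using F1_zero_across_simple_zero_pos[OF assms(1-4) _ neg] s by (force simp: zero_less_mult_iff)
  next
    case False
    interpret m: real_jet "\<lambda>x. - f0 x" "\<lambda>x. - f1 x" "\<lambda>x. - f2 x" "\<lambda>x. - f3 x"
      by (rule real_jet_uminus) (rule real_jet_axioms)
    have eq: "m.F = F" "m.F1 = F1" unfolding m.F_def F_def m.F1_def F1_def by auto
    have "f1 \<alpha> < 0" using False nz[of \<alpha>] assms(2,3) by force
    then show ?thesis using m.F1_zero_across_simple_zero_pos[OF _ assms(2,3)] assms(1,4) neg s
      unfolding eq by (force simp: zero_less_mult_iff)
  qed
qed

text \<open>f2 / f1 is the logarithmic derivative of f1 and must be unbounded above to the right of
  the zero b; F1 > 0 would make it nondecreasing, hence bounded above by C near b. The contradiction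
  takes Gronwall's form: f1^2 * exp (- 2 C x) does not increase, yet it is 0 at b and positive at
  x0.\<close>

lemma F1_nonpos_near_zero:
  assumes "f1 b = 0" "b < \<alpha>" and nz: "\<And>z. b < z \<Longrightarrow> z < \<alpha> \<Longrightarrow> f1 z \<noteq> 0"
  obtains y where "b < y" "y < \<alpha>" "F1 y \<le> 0"
proof (rule ccontr)
  assume n: "\<not> thesis"
  note thesisI = that
  have pos: "F1 z > 0" if "b < z" "z < \<alpha>" for z using thesisI[OF that] n by (meson not_le)
  define x0 where "x0 = (b + \<alpha>) / 2"
  have x0: "b < x0" "x0 < \<alpha>" unfolding x0_def using assms(2) by auto
  define C where "C = f2 x0 / f1 x0"
  have C: "f2 x / f1 x \<le> C" if "b < x" "x \<le> x0" for x
    unfolding C_def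
  proof (rule DERIV_nonneg_imp_nondecreasing[OF that(2)])
    show "\<exists>d. ((\<lambda>x. f2 x / f1 x) has_real_derivative d) (at t) \<and> 0 \<le> d" if "x \<le> t" "t \<le> x0" for t
      using logderiv1_deriv[of t] pos[of t] nz[of t] that \<open>b < x\<close> x0
      by (intro exI[of _ "F1 t / (f1 t)^2"]) (auto intro!: divide_nonneg_nonneg)
  qed
  define k where "k = (\<lambda>x. (f1 x)^2 * exp (- 2 * C * x))"
  have "k x0 \<le> k b"
  proof (rule DERIV_nonpos_imp_decreasing_open[where f = k])
    show "\<exists>d. (k has_real_derivative d) (at x) \<and> d \<le> 0" if "b < x" "x < x0" for x
    proof -
      have "(k has_real_derivative 2 * (f1 x)^2 * (f2 x / f1 x - C) * exp (- 2 * C * x)) (at x)"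
        unfolding k_def using d1[of x] nz[of x] that x0 by (auto intro!: derivative_eq_intros simp: algebra_simps power2_eq_square)
      moreover have "2 * (f1 x)^2 * (f2 x / f1 x - C) * exp (- 2 * C * x) \<le> 0"
        using C[of x] that by (intro mult_nonpos_nonneg mult_nonneg_nonpos) auto
      ultimately show ?thesis by blast
    qed
    show "continuous_on {b..x0} k" unfolding k_def
      by (intro continuous_at_imp_continuous_on ballI continuous_intros cont)
  qed (use x0 in auto)
  moreover have "k b = 0" using assms(1) by (simp add: k_def)
  moreover have "k x0 > 0" using nz[of x0] x0 by (simp add: k_def)
  ultimately show False by simp
qed


(* If F1 were positive on the whole half-line, f2 / f1 = g + g' / g (with g = f1 / f0) would increase and hence stay
   above L = lim g at -infinity; for sigma = L - g this forces sigma' >= sigma^2, so sigma decays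
   at least as fast as for a single zero, whereas the tail contributes more than the zero alpha alone. *)
lemma F1_nonpos_near_minus_infinity:
  assumes f0\<alpha>: "f0 \<alpha> = 0" and X: "X < 0" "X \<le> \<alpha>"
    and nz: "\<And>z. z < \<alpha> \<Longrightarrow> f0 z \<noteq> 0 \<and> f1 z \<noteq> 0"
    and Fneg: "\<And>x. x < X \<Longrightarrow> F x < 0"
    and tail: "\<And>x. x < X \<Longrightarrow> f1 x / f0 x = 1 / (x - \<alpha>) + gt x"
    and alt: "(\<exists>b. \<forall>x<X. gt x = b) \<or> (\<exists>c>0. \<forall>x<X. \<exists>d. (gt has_real_derivative d) (at x) \<and> d \<le> - c / x^2)"
  obtains y where "y < \<alpha>" "F1 y \<le> 0"
proof (rule ccontr)
  assume n: "\<not> thesis"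
  note thesisI = that
  have pos: "F1 z > 0" if "z < \<alpha>" for z using thesisI[OF that] n by (meson not_le)
  define g where "g = (\<lambda>x. f1 x / f0 x)"
  have g': "(g has_real_derivative F x / (f0 x)^2) (at x)" if "x < \<alpha>" for x
    unfolding g_def using logderiv_deriv[of x] nz[OF that] by simp
  have sg: "f0 x * f1 x < 0" if "x < \<alpha>" for x
    using logderiv_sign_left[OF f0\<alpha> that] nz by auto
  have gneg: "g x < 0" if "x < \<alpha>" for x
    unfolding g_def using sg[OF that] by (auto simp: mult_less_0_iff divide_less_0_iff)
  have gdec: "g y < g x" if "x < y" "y < X" for x y
  proof (rule DERIV_neg_imp_decreasing[OF that(1)])
    show "\<exists>d. (g has_real_derivative d) (at t) \<and> d < 0" if "x \<le> t" "t \<le> y" for t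
      using g'[of t] Fneg[of t] nz[of t] that \<open>y < X\<close> X
      by (intro exI[of _ "F t / (f0 t)^2"]) (auto intro!: divide_neg_pos)
  qed
  have inc: "f2 x / f1 x \<le> f2 y / f1 y" if "x \<le> y" "y < \<alpha>" for x y
  proof (rule DERIV_nonneg_imp_nondecreasing[OF that(1)])
    show "\<exists>d. ((\<lambda>x. f2 x / f1 x) has_real_derivative d) (at t) \<and> 0 \<le> d" if "x \<le> t" "t \<le> y" for t
      using logderiv1_deriv[of t] pos[of t] nz[of t] that \<open>y < \<alpha>\<close>
      by (intro exI[of _ "F1 t / (f1 t)^2"]) (auto intro!: divide_nonneg_nonneg)
  qed
  have g1: "f2 x / f1 x = g x + F x / (f0 x * f1 x)" if "x < \<alpha>" for x
    using nz[OF that] by (simp add: g_def F_def field_simps power2_eq_square)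
  \<comment> \<open>By \<open>gdec\<close> this supremum is the limit of g at minus
    infinity.\<close>
  define L where "L = (SUP x\<in>{..<X}. g x)"
  have bdd: "bdd_above (g ` {..<X})" using gneg X by (intro bdd_aboveI[of _ 0]) (auto intro: less_imp_le)
  have gL: "g x \<le> L" if "x < X" for x unfolding L_def using that bdd by (intro cSUP_upper) auto
  have L0: "L \<le> 0" unfolding L_def using gneg X by (intro cSUP_least) (auto intro: less_imp_le exI[of _ "X - 1"])
  have gltL: "g x < L" if "x < X" for x using gL[of "x - 1"] gdec[of "x - 1" x] that by simp
  have near_L: "\<exists>x<y. g x > l" if ly: "l < L" "y < X" for l y
  proof -
    obtain x where x: "x < X" "g x > l" using ly(1) less_cSUP_iff[OF _ bdd, of l] X unfolding L_def by auto
    have "g (min x (y - 1)) > l"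
      using x gdec[of "min x (y - 1)" x] by (cases "x \<le> y - 1") (auto simp: min_def)
    then show ?thesis by (intro exI[of _ "min x (y - 1)"]) auto
  qed
  \<comment> \<open>Otherwise g y > f2 x / f1 x for some y < x. Since F and f0 * f1 are negative at
    y, f2 / f1 exceeds g there, so it would be larger at y than at x, against
    \<open>inc\<close>.\<close>
  have geL: "f2 x / f1 x \<ge> L" if xX: "x < X" for x
  proof (rule ccontr)
    assume "\<not> f2 x / f1 x \<ge> L"
    then obtain y where y: "y < x" "g y > f2 x / f1 x" using near_L[of "f2 x / f1 x" x] xX by auto
    have "F y / (f0 y * f1 y) > 0" using Fneg[of y] sg[of y] y that X by (intro divide_neg_neg) auto
    then have "f2 y / f1 y > g y" using g1[of y] y that X by simp
    then show False using inc[of y x] y that X by simp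
  qed
  define \<sigma> where "\<sigma> = (\<lambda>x. L - g x)"
  have \<sigma>pos: "\<sigma> x > 0" if "x < X" for x unfolding \<sigma>_def using gltL[OF that] by simp
  \<comment> \<open>This says g' \<le> g * \<sigma>. Since L \<le> 0 means - g \<ge> \<sigma>, it
    becomes \<sigma>' \<ge> \<sigma>^2 for \<sigma>' = - g'.\<close>
  have ineq: "F x / (f0 x)^2 \<le> g x * \<sigma> x" if "x < X" for x
  proof -
    have x: "x < \<alpha>" using that X by simp
    have "F x / (f0 x * f1 x) \<ge> \<sigma> x" using geL[OF that] g1[OF x] unfolding \<sigma>_def by simp
    then have "g x * (F x / (f0 x * f1 x)) \<le> g x * \<sigma> x" using gneg[OF x] by (intro mult_left_mono_neg) auto
    moreover have "g x * (F x / (f0 x * f1 x)) = F x / (f0 x)^2" using nz[OF x] by (simp add: g_def field_simps power2_eq_square)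
    ultimately show ?thesis by simp
  qed
  from alt show False
  proof
    \<comment> \<open>For a constant tail L = b, and the inequality together with L \<le> 0 leaves
      only b = 0. Then f2 vanishes left of X, so f3 and F1 vanish there too, whereas F1 was assumed
      to be positive.\<close>
    assume "\<exists>b. \<forall>x<X. gt x = b"
    then obtain b where b: "\<And>x. x < X \<Longrightarrow> g x = 1 / (x - \<alpha>) + b" using tail unfolding g_def by auto
    have lim: "b \<le> L"
    proof (rule ccontr)
      assume "\<not> b \<le> L"
      define x where "x = min (X - 1) (\<alpha> - 1 / (b - L))"
      have "x < X" "x \<le> \<alpha> - 1 / (b - L)" unfolding x_def by auto
      then have "1 / (b - L) \<le> \<alpha> - x" by simp
      then have "1 / (\<alpha> - x) \<le> b - L" using \<open>\<not> b \<le> L\<close>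
        le_imp_inverse_le[of "1 / (b - L)" "\<alpha> - x"] by (simp add: inverse_eq_divide)
      moreover have "1 / (x - \<alpha>) = - (1 / (\<alpha> - x))" by (metis minus_diff_eq minus_divide_right)
      ultimately have "g x \<ge> L" using b[OF \<open>x < X\<close>] by simp
      then show False using gltL[OF \<open>x < X\<close>] by simp
    qed
    have der: "F x / (f0 x)^2 = - 1 / (x - \<alpha>)^2" if "x < X" for x
    proof -
      have "((\<lambda>x. 1 / (x - \<alpha>) + b) has_real_derivative - 1 / (x - \<alpha>)^2) (at x)"
        using that X by (auto intro!: derivative_eq_intros simp: power2_eq_square)
      moreover have "\<forall>\<^sub>F y in nhds x. g y = 1 / (y - \<alpha>) + b"
      proof -
        have "\<forall>\<^sub>F y in nhds x. y \<in> {..<X}" using that by (intro eventually_nhds_in_open) auto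
        then show ?thesis by eventually_elim (simp add: b)
      qed
      ultimately have "(g has_real_derivative - 1 / (x - \<alpha>)^2) (at x)"
        by (subst DERIV_cong_ev[OF refl _ refl]) auto
      then show ?thesis using g'[of x] that X DERIV_unique by force
    qed
    have b0: "b = 0"
    proof -
      define x where "x = X - 1"
      have x: "x < X" "x - \<alpha> < 0" unfolding x_def using X by auto
      define s where "s = 1 / (x - \<alpha>)"
      have s: "s < 0" unfolding s_def using x by simp
      have "L \<le> b"
        unfolding L_def using b X by (intro cSUP_least) (auto intro!: exI[of _ "X - 1"] simp: divide_nonneg_neg divide_nonpos_neg)
      with lim have "L = b" by simp
      have "- (s^2) \<le> (s + b) * (- s)"
        using ineq[OF x(1)] der[OF x(1)] b[OF x(1)] unfolding \<sigma>_def \<open>L = b\<close> s_def by (simp add: power_divide)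
      then have "b * s \<le> 0" by (simp add: power2_eq_square algebra_simps)
      then have "b \<ge> 0" using s by (simp add: mult_le_0_iff)
      then show ?thesis using L0 \<open>L = b\<close> by simp
    qed
    have f2: "f2 x = 0" if "x < X" for x
    proof -
      have x: "x < \<alpha>" using that X by simp
      have "- 1 / (x - \<alpha>)^2 = - ((g x)^2)" using b[OF that] b0 by (simp add: power_divide)
      then have "F x / (f0 x)^2 = - ((f1 x)^2) / (f0 x)^2" using der[OF that] unfolding g_def by (simp add: power_divide)
      then have "F x = - ((f1 x)^2)" using nz[OF x] by (simp add: field_simps)
      then show ?thesis unfolding F_def using nz[OF x] by simp
    qed
    have "f3 (X - 1) = 0"
    proof -
      have "\<forall>\<^sub>F y in nhds (X - 1). y \<in> {..<X}" by (intro eventually_nhds_in_open) auto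
      then have "\<forall>\<^sub>F y in nhds (X - 1). f2 y = 0" by eventually_elim (simp add: f2)
      then have "(f2 has_real_derivative 0) (at (X - 1))" by (subst DERIV_cong_ev[OF refl _ refl]) auto
      then show ?thesis using d2 DERIV_unique by blast
    qed
    then have "F1 (X - 1) = 0" using f2[of "X - 1"] by (simp add: F1_def)
    then show False using pos[of "X - 1"] X by simp
  next
    assume "\<exists>c>0. \<forall>x<X. \<exists>d. (gt has_real_derivative d) (at x) \<and> d \<le> - c / x^2"
    then obtain c where c: "c > 0" and gt': "\<And>x. x < X \<Longrightarrow> \<exists>d. (gt has_real_derivative d) (at x) \<and> d \<le> - c / x^2"
      by blast
    define x0 where "x0 = X - 1"
    have x0: "x0 < X" unfolding x0_def by simp
    \<comment> \<open>Integrated form of \<sigma>' \<ge> \<sigma>^2: the function 1 / \<sigma> + x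
      does not increase, so \<sigma> x is at most 1 / (x0 - x) for x < x0.\<close>
    have up: "1 / \<sigma> x \<ge> x0 - x" if "x \<le> x0" for x
    proof -
      have "1 / \<sigma> x + x \<ge> 1 / \<sigma> x0 + x0"
      proof (rule DERIV_nonpos_imp_nonincreasing[OF that, of "\<lambda>x. 1 / \<sigma> x + x"])
        fix t assume t: "x \<le> t" "t \<le> x0"
        then have tX: "t < X" "t < \<alpha>" using x0 X by auto
        have "(\<sigma> has_real_derivative - (F t / (f0 t)^2)) (at t)"
          unfolding \<sigma>_def using g'[OF tX(2)] by (auto intro!: derivative_eq_intros)
        then have D: "((\<lambda>x. 1 / \<sigma> x + x) has_real_derivative (F t / (f0 t)^2) / (\<sigma> t)^2 + 1) (at t)"
          using \<sigma>pos[OF tX(1)] by (auto intro!: derivative_eq_intros simp: power2_eq_square)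
        have "g t \<le> - \<sigma> t" using L0 unfolding \<sigma>_def by simp
        then have "g t * \<sigma> t \<le> - \<sigma> t * \<sigma> t" using \<sigma>pos[OF tX(1)] by (intro mult_right_mono) auto
        then have "F t / (f0 t)^2 \<le> - ((\<sigma> t)^2)" using ineq[OF tX(1)] by (simp add: power2_eq_square)
        then have "(F t / (f0 t)^2) / (\<sigma> t)^2 \<le> - ((\<sigma> t)^2) / (\<sigma> t)^2" by (intro divide_right_mono) auto
        then have "(F t / (f0 t)^2) / (\<sigma> t)^2 \<le> - 1" using \<sigma>pos[OF tX(1)] by simp
        then show "\<exists>d. ((\<lambda>x. 1 / \<sigma> x + x) has_real_derivative d) (at t) \<and> d \<le> 0"
          using D by (intro exI[of _ "(F t / (f0 t)^2) / (\<sigma> t)^2 + 1"]) auto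
      qed
      moreover have "1 / \<sigma> x0 > 0" using \<sigma>pos[OF x0] by simp
      ultimately show ?thesis by linarith
    qed
    have mono: "gt x + c / y - c / x \<le> gt y" if yx: "y \<le> x" "x < X" for x y
    proof -
      have "gt y - c / y \<ge> gt x - c / x"
      proof (rule DERIV_nonpos_imp_nonincreasing[OF that(1), of "\<lambda>x. gt x - c / x"])
        fix t assume t: "y \<le> t" "t \<le> x"
        then obtain d where d: "(gt has_real_derivative d) (at t)" "d \<le> - c / t^2" using gt'[of t] yx by auto
        have "((\<lambda>x. gt x - c / x) has_real_derivative d - (- c / t^2)) (at t)"
          using d(1) t that X by (auto intro!: derivative_eq_intros simp: power2_eq_square)
        then show "\<exists>d. ((\<lambda>x. gt x - c / x) has_real_derivative d) (at t) \<and> d \<le> 0" using d(2) by (intro exI[of _ "d - (- c / t^2)"]) auto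
      qed
      then show ?thesis by linarith
    qed
    \<comment> \<open>Obtained from g y \<le> L and the integrated tail bound as y tends to minus
      infinity. So \<sigma> is asymptotically at least (c + 1) / |x|, whereas \<open>up\<close>
      admits only 1 / |x|; the limit at the end compares c + 1 with 1.\<close>
    have low: "\<sigma> x \<ge> - c / x - 1 / (x - \<alpha>)" if "x < X" for x
    proof -
      have "((\<lambda>y. 1 / (y - \<alpha>) + (gt x + c / y - c / x)) \<longlongrightarrow> 0 + (gt x + 0 - c / x)) at_bot"
        by (intro tendsto_intros) real_asymp+
      moreover have "\<forall>\<^sub>F y in at_bot. 1 / (y - \<alpha>) + (gt x + c / y - c / x) \<le> L"
        using eventually_le_at_bot[of x]
      proof eventually_elim
        case (elim y)
        then have "g y = 1 / (y - \<alpha>) + gt y" using tail[of y] that unfolding g_def by simp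
        then show ?case using gL[of y] mono[OF elim that] elim that by linarith
      qed
      ultimately have "0 + (gt x + 0 - c / x) \<le> L" by (intro tendsto_upperbound) auto
      then show ?thesis unfolding \<sigma>_def using tail[OF that] unfolding g_def by simp
    qed
    have ev: "\<forall>\<^sub>F x in at_bot. (- c / x - 1 / (x - \<alpha>)) * (x0 - x) \<le> 1"
      using eventually_le_at_bot[of "x0 - 1"]
    proof eventually_elim
      case (elim x)
      have s: "\<sigma> x > 0" using \<sigma>pos[of x] elim x0 by simp
      have "(- c / x - 1 / (x - \<alpha>)) * (x0 - x) \<le> \<sigma> x * (x0 - x)"
        using low[of x] elim x0 by (intro mult_right_mono) auto
      also have "\<dots> \<le> \<sigma> x * (1 / \<sigma> x)" using up[of x] elim s by (intro mult_left_mono) auto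
      finally show ?case using s by simp
    qed
    have "((\<lambda>x. (- c / x - 1 / (x - \<alpha>)) * (x0 - x)) \<longlongrightarrow> c + 1) at_bot" by real_asymp
    from tendsto_upperbound[OF this ev] show False using c by simp
  qed
qed

end

subsection \<open>The argument principle on a circle with a real diameter\<close>

lemma deriv_cnj_commute:
  assumes holo: "f holomorphic_on UNIV" and cnj: "\<And>z. f (cnj z) = cnj (f z)"
  shows "deriv f (cnj z) = cnj (deriv f z)"
proof -
  have "f = cnj \<circ> f \<circ> cnj" using cnj by (auto simp: fun_eq_iff)
  then have "deriv f (cnj z) = deriv (cnj \<circ> f \<circ> cnj) (cnj z)" by simp
  also have "\<dots> = cnj (deriv f z)"
  proof (rule DERIV_imp_deriv)
    have "(f has_field_derivative deriv f z) (at z)" by (rule holomorphic_derivI[OF holo]) auto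
    then show "(cnj \<circ> f \<circ> cnj has_field_derivative cnj (deriv f z)) (at (cnj z))"
      by (intro has_field_derivative_cnj_cnj) auto
  qed
  finally show ?thesis .
qed

lemma entire_finite_zeros:
  fixes f :: "complex \<Rightarrow> complex"
  assumes "f holomorphic_on UNIV" "f w \<noteq> 0" "bounded S"
  shows "finite {z \<in> S. f z = 0}"
proof (cases "\<exists>z. f z = 0")
  case True
  then have nc: "\<not> f constant_on UNIV" using assms(2) by (metis UNIV_I constant_on_def)
  have "finite {z \<in> closure S. f z = 0}"
    by (rule holomorphic_compact_finite_zeros[of _ UNIV]) (use assms nc in \<open>auto simp: compact_closure\<close>)
  then show ?thesis by (rule finite_subset[rotated]) (use closure_subset in auto)
qed auto

lemma contour_integral_logderiv_circlepath:
  assumes f: "f holomorphic_on UNIV" and r: "r > 0" and nz: "\<And>z. z \<in> sphere c r \<Longrightarrow> f z \<noteq> 0"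
  shows "contour_integral (circlepath c r) (\<lambda>z. deriv f z / f z) = 2 * pi * \<i> * of_int (\<Sum>z | z \<in> ball c r \<and> f z = 0. zorder f z)"
proof -
  have nz1: "f (c + of_real r) \<noteq> 0" using r by (intro nz) (simp add: dist_norm)
  \<comment> \<open>A slightly larger disc, so that the circle lies inside the open set of the
    argument principle; zeros beyond the circle have winding number 0.\<close>
  define S where "S = ball c (r + 1)"
  define pz where "pz = {w \<in> S. f w = 0 \<or> w \<in> {}}"
  have fin: "finite pz" using entire_finite_zeros[OF f nz1, of S] unfolding pz_def S_def by simp
  have "contour_integral (circlepath c r) (\<lambda>x. deriv f x * 1 / f x) = 2 * pi * \<i> *
          (\<Sum>p\<in>pz. winding_number (circlepath c r) p * 1 * zorder f p)"
    unfolding pz_def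
  proof (rule argument_principle)
    show "path_image (circlepath c r) \<subseteq> S - {w \<in> S. f w = 0 \<or> w \<in> {}}"
      using nz r by (auto simp: S_def)
    show "\<forall>z. z \<notin> S \<longrightarrow> winding_number (circlepath c r) z = 0"
      using r by (auto simp: S_def dist_commute dist_norm intro!: winding_number_zero_outside[of _ "cball c r"])
    show "finite {w \<in> S. f w = 0 \<or> w \<in> {}}" using fin unfolding pz_def .
    show "f holomorphic_on S - {}" using f by (auto intro: holomorphic_on_subset)
  qed (auto simp: S_def)
  also have "(\<Sum>p\<in>pz. winding_number (circlepath c r) p * 1 * zorder f p) = (\<Sum>p\<in>{z. z \<in> ball c r \<and> f z = 0}. of_int (zorder f p))"
  proof (rule sum.mono_neutral_cong_right[OF fin])
    show "{z. z \<in> ball c r \<and> f z = 0} \<subseteq> pz" unfolding pz_def S_def by auto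
    show "\<forall>i\<in>pz - {z. z \<in> ball c r \<and> f z = 0}. winding_number (circlepath c r) i * 1 * zorder f i = 0"
    proof
      fix i assume i: "i \<in> pz - {z. z \<in> ball c r \<and> f z = 0}"
      then have "i \<notin> ball c r" "i \<notin> sphere c r" using nz unfolding pz_def by auto
      then have "i \<notin> cball c r" by auto
      then have "winding_number (circlepath c r) i = 0"
        using r by (intro winding_number_zero_outside[of _ "cball c r"]) (auto)
      then show "winding_number (circlepath c r) i * 1 * zorder f i = 0" by simp
    qed
    show "winding_number (circlepath c r) x * 1 * zorder f x = of_int (zorder f x)" if "x \<in> {z. z \<in> ball c r \<and> f z = 0}" for x
      using that winding_number_circlepath[of x c r] by (simp add: dist_norm norm_minus_commute)
  qed
  finally show ?thesis by simp
qed

text \<open>Used at the two ends of the diameter, where g is real and so i g and - i g are purely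
  imaginary. The real parts of these logarithms cancel, and only the signs of g remain.\<close>

lemma Ln_i_times_of_real:
  assumes "x \<noteq> (0::real)"
  shows "Ln (\<i> * of_real x) = of_real (ln \<bar>x\<bar>) + \<i> * of_real (sgn x * pi / 2)"
    and "Ln (- \<i> * of_real x) = of_real (ln \<bar>x\<bar>) - \<i> * of_real (sgn x * pi / 2)"
proof -
  have "exp (\<i> * of_real (sgn x * pi / 2)) = of_real (sgn x) * \<i>"
  proof -
    have "exp (\<i> * of_real (pi / 2)) = \<i>" by (metis cis_conv_exp cis_pi_half)
    moreover from this have "exp (- (\<i> * of_real (pi / 2))) = - \<i>" unfolding exp_minus by simp
    ultimately show ?thesis using assms by (auto simp: sgn_if)
  qed
  note e1 = this
  have e2: "exp (- (\<i> * of_real (sgn x * pi / 2))) = - of_real (sgn x) * \<i>"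
    unfolding exp_minus e1 using assms by (auto simp: sgn_if)
  have x: "of_real \<bar>x\<bar> * of_real (sgn x) = (of_real x :: complex)"
    by (metis abs_mult_sgn of_real_mult)
  have p: "exp (of_real (ln \<bar>x\<bar>)) = (of_real \<bar>x\<bar> :: complex)"
    using assms by (simp add: exp_of_real)
  have e: "exp (of_real (ln \<bar>x\<bar>) + \<i> * of_real (sgn x * pi / 2)) = \<i> * of_real x"
    "exp (of_real (ln \<bar>x\<bar>) - \<i> * of_real (sgn x * pi / 2)) = - \<i> * of_real x"
    unfolding diff_conv_add_uminus exp_add p e1 e2 x[symmetric] by (simp_all only: mult_ac mult_minus_left mult_minus_right)
  show "Ln (\<i> * of_real x) = of_real (ln \<bar>x\<bar>) + \<i> * of_real (sgn x * pi / 2)"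
    by (rule Ln_unique[OF e(1)]; cases "x > 0"; simp add: sgn_if assms; use pi_gt_zero in linarith)
  show "Ln (- \<i> * of_real x) = of_real (ln \<bar>x\<bar>) - \<i> * of_real (sgn x * pi / 2)"
    by (rule Ln_unique[OF e(2)]; cases "x > 0"; simp add: sgn_if assms; use pi_gt_zero in linarith)
qed


lemma sin_le_zero_upto_2pi:
  assumes "pi \<le> x" "x \<le> 2 * pi"
  shows "sin x \<le> 0"
  using sin_ge_zero[of "2 * pi - x"] assms by (simp add: sin_diff)

text \<open>The difference of the two zero counts is the integral of g' / g. On the upper semicircle
  Im g < 0 keeps i g off the nonpositive reals; on the lower one the same holds for - i g by
  symmetry. So principal logarithms are primitives on the two halves, g has no room to wind, and the
  result depends only on its signs at the ends.\<close>

lemma sum_zorder_diff_circle: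
  fixes A1 A2 :: real
  assumes holo: "\<phi> holomorphic_on UNIV" and cnj: "\<And>z. \<phi> (cnj z) = cnj (\<phi> z)" and A: "A1 < A2"
  defines "c \<equiv> complex_of_real ((A1 + A2) / 2)" and "r \<equiv> (A2 - A1) / 2"
    and "g \<equiv> \<lambda>z. deriv \<phi> z / \<phi> z"
  assumes nz: "\<phi> A1 \<noteq> 0" "\<phi> A2 \<noteq> 0" "deriv \<phi> A1 \<noteq> 0" "deriv \<phi> A2 \<noteq> 0"
    and up: "\<And>z. z \<in> sphere c r \<Longrightarrow> Im z > 0 \<Longrightarrow> \<phi> z \<noteq> 0 \<and> Im (g z) < 0"
  shows "2 * (of_int (\<Sum>z | z \<in> ball c r \<and> deriv \<phi> z = 0. zorder (deriv \<phi>) z)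
           - of_int (\<Sum>z | z \<in> ball c r \<and> \<phi> z = 0. zorder \<phi> z)) = sgn (Re (g A1)) - sgn (Re (g A2))"
proof -
  have r: "r > 0" unfolding r_def using A by simp
  have holo': "deriv \<phi> holomorphic_on UNIV" using holo by (auto intro: holomorphic_deriv)
  have cnj': "deriv \<phi> (cnj z) = cnj (deriv \<phi> z)" for z by (rule deriv_cnj_commute[OF holo cnj])
  have gcnj: "g (cnj z) = cnj (g z)" for z unfolding g_def by (simp add: cnj cnj')
  have ends: "c + of_real r = of_real A2" "c - of_real r = of_real A1"
    unfolding c_def r_def by (simp_all add: field_simps flip: of_real_add of_real_diff)
  have real_sphere: "z = of_real A1 \<or> z = of_real A2" if zs: "z \<in> sphere c r" "Im z = 0" for z
  proof -
    obtain x where x: "z = of_real x" using zs(2) by (metis complex_is_Real_iff Reals_cases)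
    have "\<bar>(A1 + A2) / 2 - x\<bar> = r" using zs(1) unfolding x c_def
      by (simp add: dist_norm norm_of_real flip: of_real_diff of_real_add of_real_divide)
    then have "x = A1 \<or> x = A2" unfolding r_def using A by (auto simp: abs_if field_simps split: if_splits)
    then show ?thesis using x by auto
  qed
  have sphere_cnj: "cnj z \<in> sphere c r \<longleftrightarrow> z \<in> sphere c r" for z
  proof -
    have "dist c (cnj z) = dist c z" unfolding dist_norm c_def by (metis complex_cnj_complex_of_real complex_cnj_diff complex_mod_cnj)
    then show ?thesis by simp
  qed
  have down: "\<phi> z \<noteq> 0 \<and> Im (g z) > 0" if "z \<in> sphere c r" "Im z < 0" for z
    using up[of "cnj z"] that sphere_cnj[of z] by (simp add: gcnj cnj)
  have \<phi>nz: "\<phi> z \<noteq> 0" if "z \<in> sphere c r" for z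
    using up[OF that] down[OF that] real_sphere[OF that] nz by (cases "Im z" "0::real" rule: linorder_cases) auto
  have gnz: "g z \<noteq> 0" if "z \<in> sphere c r" for z
    using up[OF that] down[OF that] real_sphere[OF that] nz by (cases "Im z" "0::real" rule: linorder_cases) (auto simp: g_def)
  have \<phi>'nz: "deriv \<phi> z \<noteq> 0" if "z \<in> sphere c r" for z
    using gnz[OF that] unfolding g_def by auto
  define ff where "ff = (\<lambda>z. deriv (deriv \<phi>) z / deriv \<phi> z - deriv \<phi> z / \<phi> z)"
  have g_deriv: "(g has_field_derivative ff z * g z) (at z)" if "z \<in> sphere c r" for z
  proof -
    have "(\<phi> has_field_derivative deriv \<phi> z) (at z)" by (rule holomorphic_derivI[OF holo]) auto
    moreover have "(deriv \<phi> has_field_derivative deriv (deriv \<phi>) z) (at z)" by (rule holomorphic_derivI[OF holo']) auto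
    ultimately show ?thesis unfolding g_def ff_def using \<phi>nz[OF that] \<phi>'nz[OF that]
      by (auto intro!: derivative_eq_intros simp: field_simps)
  qed
  have Ln_deriv: "((\<lambda>z. Ln (k * g z)) has_field_derivative ff z) (at z within S)"
    if "z \<in> sphere c r" "k * g z \<notin> \<real>\<^sub>\<le>\<^sub>0" "k \<noteq> 0" for z k S
  proof -
    have "((\<lambda>z. Ln (k * g z)) has_field_derivative (k * (ff z * g z)) * inverse (k * g z)) (at z within S)"
      by (rule derivative_eq_intros refl that has_field_derivative_at_within[OF g_deriv])+ (simp add: that)
    then show ?thesis using gnz[OF that(1)] that(3) by (simp add: field_simps)
  qed
  have greal: "g (of_real x) = of_real (Re (g (of_real x)))" for x
    using gcnj[of "of_real x"] by (metis complex_cnj_complex_of_real Reals_cnj_iff of_real_Re)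
  define s1 s2 where "s1 = Re (g A1)" and "s2 = Re (g A2)"
  have s: "g A1 = of_real s1" "g A2 = of_real s2" unfolding s1_def s2_def by (rule greal)+
  have A_sphere: "of_real A1 \<in> sphere c r" "of_real A2 \<in> sphere c r"
    using r unfolding ends[symmetric] by (auto simp: dist_norm)
  have s0: "s1 \<noteq> 0" "s2 \<noteq> 0" using gnz A_sphere s by auto
  have nonpos1: "\<i> * g z \<notin> \<real>\<^sub>\<le>\<^sub>0" if "z \<in> sphere c r" "Im z \<ge> 0" for z
  proof (cases "Im z = 0")
    case True
    then have "g z = of_real s1 \<or> g z = of_real s2" using real_sphere[OF that(1)] s by auto
    then show ?thesis using s0 by (auto simp: complex_nonpos_Reals_iff)
  next
    case False
    then show ?thesis using up[OF that(1)] that(2) by (auto simp: complex_nonpos_Reals_iff)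
  qed
  have nonpos2: "- \<i> * g z \<notin> \<real>\<^sub>\<le>\<^sub>0" if "z \<in> sphere c r" "Im z \<le> 0" for z
  proof (cases "Im z = 0")
    case True
    then have "g z = of_real s1 \<or> g z = of_real s2" using real_sphere[OF that(1)] s by auto
    then show ?thesis using s0 by (auto simp: complex_nonpos_Reals_iff)
  next
    case False
    then show ?thesis using down[OF that(1)] that(2) by (auto simp: complex_nonpos_Reals_iff)
  qed
  have Imc: "Im c = 0" unfolding c_def by simp
  have "(ff has_contour_integral (Ln (\<i> * g (pathfinish (part_circlepath c r 0 pi))) - Ln (\<i> * g (pathstart (part_circlepath c r 0 pi))))) (part_circlepath c r 0 pi)"
  proof (rule contour_integral_primitive[where S = "{z \<in> sphere c r. Im z \<ge> 0}"])
    show "path_image (part_circlepath c r 0 pi) \<subseteq> {z \<in> sphere c r. 0 \<le> Im z}"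
      using r Imc by (auto simp: path_image_part_circlepath' closed_segment_eq_real_ivl dist_norm norm_mult sin_ge_zero
         intro!: mult_nonneg_nonneg)
    show "((\<lambda>z. Ln (\<i> * g z)) has_field_derivative ff x) (at x within {z \<in> sphere c r. 0 \<le> Im z})"
      if "x \<in> {z \<in> sphere c r. 0 \<le> Im z}" for x
      by (rule Ln_deriv) (use that nonpos1[of x] in auto)
  qed simp
  then have I1: "(ff has_contour_integral (Ln (\<i> * g A1) - Ln (\<i> * g A2))) (part_circlepath c r 0 pi)"
    using ends by simp
  have *: "(ff has_contour_integral (Ln (-\<i> * g (pathfinish (part_circlepath c r pi (2*pi)))) - Ln (-\<i> * g (pathstart (part_circlepath c r pi (2*pi)))))) (part_circlepath c r pi (2*pi))"
  proof (rule contour_integral_primitive[where S = "{z \<in> sphere c r. Im z \<le> 0}"])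
    show "path_image (part_circlepath c r pi (2*pi)) \<subseteq> {z \<in> sphere c r. Im z \<le> 0}"
      using r Imc by (auto simp: path_image_part_circlepath' closed_segment_eq_real_ivl dist_norm norm_mult mult_le_0_iff
         intro!: sin_le_zero_upto_2pi)
    show "((\<lambda>z. Ln (- \<i> * g z)) has_field_derivative ff x) (at x within {z \<in> sphere c r. Im z \<le> 0})"
      if "x \<in> {z \<in> sphere c r. Im z \<le> 0}" for x
      by (rule Ln_deriv) (use that nonpos2[of x] in auto)
  qed simp
  then have I2: "(ff has_contour_integral (Ln (-\<i> * g A2) - Ln (-\<i> * g A1))) (part_circlepath c r pi (2*pi))"
  proof -
    have "exp (\<i> * complex_of_real (2 * pi)) = 1" by (metis cis_conv_exp cis_2pi)
    then have "pathfinish (part_circlepath c r pi (2*pi)) = of_real A2" "pathstart (part_circlepath c r pi (2*pi)) = of_real A1"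
      using ends by simp_all
    with * show ?thesis by metis
  qed
  have "(ff has_contour_integral (Ln (\<i> * g A1) - Ln (\<i> * g A2)) + (Ln (-\<i> * g A2) - Ln (-\<i> * g A1))) (part_circlepath c r 0 (2*pi))"
    using I1 I2 pi_gt_zero by (auto simp: has_contour_integral_part_circlepath_iff intro!: has_integral_combine[of 0 pi "2*pi"])
  moreover have "(Ln (\<i> * g A1) - Ln (\<i> * g A2)) + (Ln (-\<i> * g A2) - Ln (-\<i> * g A1)) = \<i> * pi * (sgn s1 - sgn s2)"
    unfolding s Ln_i_times_of_real[OF s0(1)] Ln_i_times_of_real[OF s0(2)] by (simp add: algebra_simps)
  ultimately have I: "contour_integral (circlepath c r) ff = \<i> * pi * (sgn s1 - sgn s2)"
    unfolding circlepath_def by (metis contour_integral_unique)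
  have "contour_integral (circlepath c r) ff = contour_integral (circlepath c r) (\<lambda>z. deriv (deriv \<phi>) z / deriv \<phi> z)
     - contour_integral (circlepath c r) (\<lambda>z. deriv \<phi> z / \<phi> z)"
    unfolding ff_def
  proof (rule contour_integral_diff)
    have int: "(\<lambda>z. u z / k z) contour_integrable_on circlepath c r"
      if "u holomorphic_on UNIV" "k holomorphic_on UNIV" "\<And>z. z \<in> sphere c r \<Longrightarrow> k z \<noteq> 0" for u k
    proof -
      have "continuous_on (sphere c r) (\<lambda>z. u z / k z)"
        using that by (intro continuous_on_divide) (auto intro: holomorphic_on_imp_continuous_on holomorphic_on_subset)
      then show ?thesis unfolding circlepath_def using r
        by (intro contour_integrable_continuous_part_circlepath) (simp flip: circlepath_def)
    qed
    have "deriv (deriv \<phi>) holomorphic_on UNIV" using holo' by (auto intro: holomorphic_deriv)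
    then show "(\<lambda>z. deriv (deriv \<phi>) z / deriv \<phi> z) contour_integrable_on circlepath c r"
      using \<phi>'nz holo' by (intro int) auto
    show "(\<lambda>z. deriv \<phi> z / \<phi> z) contour_integrable_on circlepath c r"
      using \<phi>nz holo holo' by (intro int) auto
  qed
  also have "\<dots> = 2 * pi * \<i> * of_int (\<Sum>z | z \<in> ball c r \<and> deriv \<phi> z = 0. zorder (deriv \<phi>) z)
      - 2 * pi * \<i> * of_int (\<Sum>z | z \<in> ball c r \<and> \<phi> z = 0. zorder \<phi> z)"
    using contour_integral_logderiv_circlepath[OF holo r \<phi>nz] contour_integral_logderiv_circlepath[OF holo' r \<phi>'nz] by simp
  finally have "\<i> * pi * (sgn s1 - sgn s2) = \<i> * pi * of_real (2 * (of_int (\<Sum>z | z \<in> ball c r \<and> deriv \<phi> z = 0. zorder (deriv \<phi>) z)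
      - of_int (\<Sum>z | z \<in> ball c r \<and> \<phi> z = 0. zorder \<phi> z)))"
    unfolding I by (simp add: algebra_simps)
  then have "complex_of_real (sgn s1 - sgn s2) = of_real (2 * (of_int (\<Sum>z | z \<in> ball c r \<and> deriv \<phi> z = 0. zorder (deriv \<phi>) z)
      - of_int (\<Sum>z | z \<in> ball c r \<and> \<phi> z = 0. zorder \<phi> z)))" by simp
  then show ?thesis unfolding of_real_eq_iff s1_def s2_def by simp
qed

subsection \<open>Rolle's theorem with multiplicities\<close>

text \<open>Summing over the support gives sums over infinite intervals their meaning, as long as
  only finitely many weights are nonzero.\<close>

definition sum_supp :: "(real \<Rightarrow> int) \<Rightarrow> real set \<Rightarrow> int" where
  "sum_supp w A = (\<Sum>x | x \<in> A \<and> w x \<noteq> 0. w x)"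

lemma sum_supp_eq:
  assumes "finite K" "K \<subseteq> A" "\<And>x. x \<in> A \<Longrightarrow> x \<notin> K \<Longrightarrow> w x = 0"
  shows "sum_supp w A = sum w K"
  unfolding sum_supp_def by (rule sum.mono_neutral_left) (use assms in auto)

lemma sum_supp_add:
  assumes "finite {x \<in> A. w x \<noteq> 0}" "finite {x \<in> A. v x \<noteq> 0}"
  shows "sum_supp (\<lambda>x. w x + v x) A = sum_supp w A + sum_supp v A"
proof -
  let ?K = "{x \<in> A. w x \<noteq> 0} \<union> {x \<in> A. v x \<noteq> 0}"
  have "sum_supp (\<lambda>x. w x + v x) A = (\<Sum>x\<in>?K. w x + v x)" by (rule sum_supp_eq) (use assms in auto)
  moreover have "sum_supp w A = sum w ?K" "sum_supp v A = sum v ?K" by (rule sum_supp_eq; use assms in auto)+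
  ultimately show ?thesis by (simp add: sum.distrib)
qed

lemma sum_supp_uminus: "sum_supp (\<lambda>x. - w x) A = - sum_supp w A"
  unfolding sum_supp_def by (simp add: sum_negf)

lemma sum_supp_nonneg: "(\<And>x. x \<in> A \<Longrightarrow> w x \<ge> 0) \<Longrightarrow> sum_supp w A \<ge> 0"
  unfolding sum_supp_def by (rule sum_nonneg) auto

lemma sum_supp_pos:
  assumes "finite {x \<in> A. w x \<noteq> 0}" "\<And>x. x \<in> A \<Longrightarrow> w x \<ge> 0" "z \<in> A" "w z \<noteq> 0"
  shows "sum_supp w A \<ge> 1"
proof -
  have "w z \<le> sum_supp w A" unfolding sum_supp_def
    by (rule member_le_sum) (use assms in auto)
  then show ?thesis using assms(2)[OF assms(3)] assms(4) by linarith
qed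

lemma ivI: "x < y \<Longrightarrow> y < z \<Longrightarrow> y \<in> iv (ereal x) (ereal z)" by (simp add: iv_def)

lemma iv_mono: "a' \<le> a \<Longrightarrow> b \<le> b' \<Longrightarrow> iv a b \<subseteq> iv a' b'"
  unfolding iv_def by (auto intro: order.strict_trans1 order.strict_trans2)

lemma iv_convex: "x \<in> iv a b \<Longrightarrow> y \<in> iv a b \<Longrightarrow> x \<le> z \<Longrightarrow> z \<le> y \<Longrightarrow> z \<in> iv a b"
  unfolding iv_def by (auto intro: order.strict_trans1[of "ereal z" "ereal y"] order.strict_trans2[of a "ereal x"])

text \<open>What \<open>F1_nonpos_near_minus_infinity\<close> has to know about g: \<open>gt\<close>
  is g with the pole at \<alpha> split off, and the two alternatives are those of
  \<open>lp_logderiv_Im_le\<close>, carried to the real axis. The guards f0 x \<noteq> 0 allow for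
  infinitely many zeros towards minus infinity.\<close>

definition tail_at_bot :: "(real \<Rightarrow> real) \<Rightarrow> (real \<Rightarrow> real) \<Rightarrow> real \<Rightarrow> bool" where
  "tail_at_bot f0 f1 \<alpha> \<longleftrightarrow> (\<exists>X gt. X < 0 \<and> X \<le> \<alpha> \<and> (\<forall>x<X. f0 x \<noteq> 0 \<longrightarrow> f1 x / f0 x = 1 / (x - \<alpha>) + gt x) \<and>
       ((\<exists>b. \<forall>x<X. f0 x \<noteq> 0 \<longrightarrow> gt x = b) \<or> (\<exists>c>0. \<forall>x<X. f0 x \<noteq> 0 \<longrightarrow> (\<exists>d. (gt has_real_derivative d) (at x) \<and> d \<le> - c / x^2))))"

(* m0, m1, mF, mF1 are the orders of vanishing of the functions f0, f1, F, F1. *)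
locale real_jet_mult = real_jet +
  fixes m0 m1 mF mF1 :: "real \<Rightarrow> int" and R :: real
  assumes m0_nonneg: "m0 x \<ge> 0" and m0_0: "m0 x = 0 \<longleftrightarrow> f0 x \<noteq> 0"
    and m1_nonneg: "m1 x \<ge> 0" and m1_0: "m1 x = 0 \<longleftrightarrow> f1 x \<noteq> 0"
    and mF_nonneg: "mF x \<ge> 0" and mF_0: "mF x = 0 \<longleftrightarrow> F x \<noteq> 0"
    and mF1_nonneg: "mF1 x \<ge> 0" and mF1_0: "mF1 x = 0 \<longleftrightarrow> F1 x \<noteq> 0"
    and m_zero: "f0 x = 0 \<Longrightarrow> m1 x = m0 x - 1"
    and m_crit: "f0 x \<noteq> 0 \<Longrightarrow> f1 x = 0 \<Longrightarrow> mF x = m1 x - 1"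
    and m_Rolle: "f0 x \<noteq> 0 \<Longrightarrow> f1 x \<noteq> 0 \<Longrightarrow> F x = 0 \<Longrightarrow> mF x \<le> mF1 x + 1"
    and lim_zero: "f0 x = 0 \<Longrightarrow> ((\<lambda>x. f0 x / f1 x) \<longlongrightarrow> 0) (at x)"
    and fin0: "finite {x. a \<le> x \<and> x \<le> b \<and> f0 x = 0}"
    and finF: "finite {x. a \<le> x \<and> x \<le> b \<and> F x = 0}"
    and finf1: "finite {x. a \<le> x \<and> x \<le> b \<and> f1 x = 0}"
    and F_neg: "\<bar>x\<bar> \<ge> R \<Longrightarrow> f0 x \<noteq> 0 \<Longrightarrow> F x < 0"
    and tail_left: "f0 \<alpha> = 0 \<Longrightarrow> tail_at_bot f0 f1 \<alpha>"
    and tail_right: "f0 \<alpha> = 0 \<Longrightarrow> tail_at_bot (\<lambda>x. f0 (- x)) (\<lambda>x. - f1 (- x)) (- \<alpha>)"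
begin

text \<open>At a multiple zero of f0 the numerator F vanishes as well, but Q has a pole there; hence
  the weight 0.\<close>

definition wQ :: "real \<Rightarrow> int" where "wQ x = (if f0 x = 0 then 0 else mF x)"
definition wQ1 :: "real \<Rightarrow> int" where "wQ1 x = (if f1 x = 0 then 0 else mF1 x)"
text \<open>The order of g: -1 at every zero of f0, whatever its multiplicity, and positive exactly
  at the critical points where f0 is nonzero.\<close>

definition D :: "real \<Rightarrow> int" where "D x = m1 x - m0 x"

text \<open>Rolle's theorem is applied only up to the first zero t after x, so that the critical
  point it yields is not itself a zero of f0.\<close>

lemma crit_between_zeros:
  assumes "x < y" "f0 x = 0" "f0 y = 0"
  obtains z where "x < z" "z < y" "f1 z = 0" "f0 z \<noteq> 0"
proof -
  define K where "K = {t. x < t \<and> t \<le> y \<and> f0 t = 0}"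
  have "finite K" by (rule finite_subset[OF _ fin0[of x y]]) (auto simp: K_def)
  have "y \<in> K" using assms unfolding K_def by auto
  define t where "t = Min K"
  have t: "t \<in> K" "\<And>s. s \<in> K \<Longrightarrow> t \<le> s" unfolding t_def using \<open>finite K\<close> \<open>y \<in> K\<close> by (auto intro: Min_in)
  then have "x < t" "f0 x = f0 t" unfolding K_def using assms(2) by auto
  have "\<exists>z. x < z \<and> z < t \<and> (f0 has_real_derivative 0) (at z)"
    using Rolle[OF \<open>x < t\<close> \<open>f0 x = f0 t\<close>] d0
    by (meson DERIV_isCont continuous_at_imp_continuous_on real_differentiable_def)
  then obtain z where z: "x < z" "z < t" "(f0 has_real_derivative 0) (at z)" by blast
  have "z \<le> y" using z t(1) unfolding K_def by auto
  then have "f0 z \<noteq> 0" using t(2)[of z] z unfolding K_def by auto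
  moreover have "f1 z = 0" using z d0 DERIV_unique by blast
  ultimately show thesis using that[of z] z t(1) unfolding K_def by auto
qed

lemma wQ_nonneg: "wQ x \<ge> 0" and wQ1_nonneg: "wQ1 x \<ge> 0"
  unfolding wQ_def wQ1_def using mF_nonneg mF1_nonneg by auto

lemma wQ_nz: "wQ x \<noteq> 0 \<longleftrightarrow> f0 x \<noteq> 0 \<and> F x = 0" and wQ1_nz: "wQ1 x \<noteq> 0 \<longleftrightarrow> f1 x \<noteq> 0 \<and> F1 x = 0"
  unfolding wQ_def wQ1_def using mF_0 mF1_0 by auto

lemma fin_wQ: "finite {x \<in> A. wQ x \<noteq> 0}"
proof (rule finite_subset[OF _ finF[of "- R" R]])
  show "{x \<in> A. wQ x \<noteq> 0} \<subseteq> {x. - R \<le> x \<and> x \<le> R \<and> F x = 0}"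
  proof
    fix x assume "x \<in> {x \<in> A. wQ x \<noteq> 0}"
    then have "f0 x \<noteq> 0" "F x = 0" using wQ_nz by auto
    then have "\<bar>x\<bar> < R" using F_neg[of x] by (cases "\<bar>x\<bar> \<ge> R") auto
    then show "x \<in> {x. - R \<le> x \<and> x \<le> R \<and> F x = 0}" using \<open>F x = 0\<close> by auto
  qed
qed

lemma fin_wQ1: "finite {x. f1 x \<noteq> 0 \<and> F1 x = 0} \<Longrightarrow> finite {x \<in> A. wQ1 x \<noteq> 0}"
  by (rule rev_finite_subset) (auto simp: wQ1_nz)

lemma fin_wdiff: "finite {x. f1 x \<noteq> 0 \<and> F1 x = 0} \<Longrightarrow> finite {x \<in> A. wQ1 x - wQ x \<noteq> 0}"
  by (rule finite_subset[OF _ finite_UnI[OF fin_wQ[of A] fin_wQ1[of A]]]) auto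

(* el and er record an additional zero before the first and after the last zero of Q. *)
lemma Rolle_count:
  fixes el er :: int
  assumes fin1: "finite {x. f1 x \<noteq> 0 \<and> F1 x = 0}" and "a < b" and el: "el = 0 \<or> el = 1" and er: "er = 0 \<or> er = 1"
    and nz: "\<And>x y z. x \<in> iv a b \<Longrightarrow> y \<in> iv a b \<Longrightarrow> wQ x \<noteq> 0 \<Longrightarrow> wQ y \<noteq> 0 \<Longrightarrow> x \<le> z \<Longrightarrow> z \<le> y \<Longrightarrow> f0 z \<noteq> 0 \<and> f1 z \<noteq> 0"
    and l: "\<And>x. el = 1 \<Longrightarrow> x \<in> iv a b \<Longrightarrow> wQ x \<noteq> 0 \<Longrightarrow> \<exists>z\<in>iv a (ereal x). wQ1 z \<noteq> 0 \<or> wQ z \<noteq> 0"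
    and r: "\<And>x. er = 1 \<Longrightarrow> x \<in> iv a b \<Longrightarrow> wQ x \<noteq> 0 \<Longrightarrow> \<exists>z\<in>iv (ereal x) b. wQ1 z \<noteq> 0 \<or> wQ z \<noteq> 0"
    and e: "el + er \<le> 1"
  shows "sum_supp (\<lambda>x. wQ1 x - wQ x) (iv a b) \<ge> el + er - 1"
proof -
  define B where "B = {x \<in> iv a b. wQ x \<noteq> 0}"
  \<comment> \<open>A gap between two zeros of Q is charged 1, for the zero of Q_1 given by Rolle's
    theorem. The first gap is charged el, the last one 1 + (er - 1) = er, and an interval without
    zeros of Q gets el + er - 1 \<le> 0. At a zero of Q the charges add up to 1, which
    \<open>m_Rolle\<close> compensates.\<close>
  define f where "f = (\<lambda>x. if x = a then el else 1)"
  define f' where "f' = (\<lambda>x. if x = b then er - 1 else 0)"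
  have B: "x \<in> B \<Longrightarrow> a < ereal x \<and> ereal x < b \<and> wQ x \<noteq> 0" for x unfolding B_def iv_def by auto
  have pos: "sum_supp (\<lambda>x. wQ1 x - wQ x) (iv u v) \<ge> 1"
    if "iv u v \<inter> B = {}" "iv u v \<subseteq> iv a b" "z \<in> iv u v" "wQ1 z \<noteq> 0" for u v z
  proof (rule sum_supp_pos[OF fin_wdiff[OF fin1] _ that(3)])
    have z: "wQ x = 0" if "x \<in> iv u v" for x using \<open>iv u v \<inter> B = {}\<close> \<open>iv u v \<subseteq> iv a b\<close> that unfolding B_def by auto
    show "0 \<le> wQ1 x - wQ x" if "x \<in> iv u v" for x using z[OF that] wQ1_nonneg by simp
    show "wQ1 z - wQ z \<noteq> 0" using z[OF that(3)] that(4) by simp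
  qed
  have nonneg: "sum_supp (\<lambda>x. wQ1 x - wQ x) (iv u v) \<ge> 0"
    if "iv u v \<inter> B = {}" "iv u v \<subseteq> iv a b" for u v
  proof (rule sum_supp_nonneg)
    fix x assume "x \<in> iv u v"
    then have "wQ x = 0" using that unfolding B_def by auto
    then show "0 \<le> wQ1 x - wQ x" using wQ1_nonneg by simp
  qed
  have "f a + f' b \<le> (\<Sum>x | x \<in> iv a b \<and> wQ1 x - wQ x \<noteq> 0. wQ1 x - wQ x)"
  proof (rule sum_over_partition_ge[of B])
    show "finite B" unfolding B_def by (rule fin_wQ)
    show "B \<subseteq> iv a b" unfolding B_def by auto
    show "finite {x \<in> iv a b. wQ1 x - wQ x \<noteq> 0}" by (rule fin_wdiff[OF fin1])
    show "f u + f' v \<le> (\<Sum>x | x \<in> iv u v \<and> wQ1 x - wQ x \<noteq> 0. wQ1 x - wQ x)"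
      if uv: "u \<in> insert a (ereal ` B)" "v \<in> insert b (ereal ` B)" "u < v" "iv u v \<inter> B = {}" for u v
      unfolding sum_supp_def[symmetric]
    proof -
      have sub: "iv u v \<subseteq> iv a b" by (rule iv_mono) (use uv B in \<open>auto intro: less_imp_le\<close>)
      note pos' = pos[OF uv(4) sub] and nonneg' = nonneg[OF uv(4) sub]
      consider "u = a" "v = b" | x where "u = a" "x \<in> B" "v = ereal x" | x where "x \<in> B" "u = ereal x" "v = b"
        | x y where "x \<in> B" "y \<in> B" "u = ereal x" "v = ereal y" using uv by auto
      then show "f u + f' v \<le> sum_supp (\<lambda>x. wQ1 x - wQ x) (iv u v)"
      proof cases
        case 1
        then show ?thesis using nonneg' e unfolding f_def f'_def by simp
      next
        case (2 x)
        \<comment> \<open>A further zero of Q to the left of x is impossible, as x is the first one;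
          so \<open>l\<close> yields a zero of Q_1.\<close>
        have "el = 1 \<Longrightarrow> \<exists>z\<in>iv a (ereal x). wQ1 z \<noteq> 0"
          using l[of x] 2 B_def uv(4) sub by blast
        then show ?thesis using el pos' nonneg' 2 B[of x] unfolding f_def f'_def by auto
      next
        case (3 x)
        have "er = 1 \<Longrightarrow> \<exists>z\<in>iv (ereal x) b. wQ1 z \<noteq> 0"
          using r[of x] 3 B_def uv(4) sub by blast
        then show ?thesis using er pos' nonneg' 3 B[of x] unfolding f_def f'_def by auto
      next
        case (4 x y)
        have "x < y" using 4 uv(3) by simp
        have n: "f0 z \<noteq> 0 \<and> f1 z \<noteq> 0" if "x \<le> z" "z \<le> y" for z
          using nz[of x y z] 4 that unfolding B_def by auto
        obtain z where z: "x < z" "z < y" "F1 z = 0"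
          by (rule F1_zero_between[OF \<open>x < y\<close>]) (use n 4 wQ_nz in \<open>auto simp: B_def\<close>)
        then have "wQ1 z \<noteq> 0" using n wQ1_nz by auto
        then have "sum_supp (\<lambda>x. wQ1 x - wQ x) (iv u v) \<ge> 1" using pos'[of z] z 4 by (auto intro: ivI)
        then show ?thesis using 4 B[of x] B[of y] unfolding f_def f'_def by auto
      qed
    qed
    show "0 \<le> wQ1 x - wQ x + f (ereal x) + f' (ereal x)" if "x \<in> B" for x
    proof -
      have "x \<in> iv a b" "wQ x \<noteq> 0" using that unfolding B_def by auto
      then have "f0 x \<noteq> 0" "f1 x \<noteq> 0" "F x = 0" using nz[of x x x] wQ_nz[of x] by auto
      then have "wQ x \<le> wQ1 x + 1" using m_Rolle unfolding wQ_def wQ1_def by simp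
      then show ?thesis using B[OF that] unfolding f_def f'_def by auto
    qed
  qed (use assms(2) in simp)
  then show ?thesis unfolding sum_supp_def f_def f'_def by simp
qed

text \<open>The additional zero of Q_1 before a zero x1 of Q that lies to the right of \<alpha>. If
  \<alpha> is multiple, Rolle's theorem starts at \<alpha> itself; if it is simple, a point with F1
  \<le> 0 on the left side does the work.\<close>

lemma F1_zero_left_unit:
  assumes \<alpha>: "f0 \<alpha> = 0" "a < ereal \<alpha>" and a: "a = - \<infinity> \<or> (\<exists>b. a = ereal b \<and> f1 b = 0)"
    and nzl: "\<And>z. z \<in> iv a (ereal \<alpha>) \<Longrightarrow> f0 z \<noteq> 0 \<and> f1 z \<noteq> 0"
    and x1: "\<alpha> < x1" "F x1 = 0" and nzr: "\<And>z. \<alpha> < z \<Longrightarrow> z \<le> x1 \<Longrightarrow> f0 z \<noteq> 0 \<and> f1 z \<noteq> 0"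
  shows "\<exists>z\<in>iv a (ereal x1). wQ1 z \<noteq> 0"
proof (cases "f1 \<alpha> = 0")
  case True
  have "((\<lambda>x. f0 x / f1 x) \<longlongrightarrow> 0) (at_right \<alpha>)"
    using lim_zero[OF \<alpha>(1)] by (rule tendsto_within_subset) auto
  then obtain z where "\<alpha> < z" "z < x1" "F1 z = 0"
    using F1_zero_right_of_multiple_zero[OF True x1] nzr by blast
  moreover from this have "a < ereal z" using \<alpha>(2) by (auto intro: less_trans[of a "ereal \<alpha>"])
  ultimately show ?thesis using nzr[of z] wQ1_nz[of z] by (intro bexI[of _ z]) (auto simp: iv_def)
next
  case False
  have "\<exists>b y. b < y \<and> y < \<alpha> \<and> F1 y \<le> 0 \<and> (\<forall>z. b < z \<longrightarrow> a < ereal z)"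
    using a
  proof
    assume "\<exists>b. a = ereal b \<and> f1 b = 0"
    then obtain b where b: "a = ereal b" "f1 b = 0" by blast
    obtain y where "b < y" "y < \<alpha>" "F1 y \<le> 0"
      by (rule F1_nonpos_near_zero[OF b(2), of \<alpha>]) (use \<alpha>(2) b nzl in \<open>auto intro: ivI\<close>)
    then show ?thesis using b by auto
  next
    assume a: "a = - \<infinity>"
    obtain X gt where X: "X < 0" "X \<le> \<alpha>" "\<forall>x<X. f0 x \<noteq> 0 \<longrightarrow> f1 x / f0 x = 1 / (x - \<alpha>) + gt x"
      "(\<exists>b. \<forall>x<X. f0 x \<noteq> 0 \<longrightarrow> gt x = b) \<or> (\<exists>c>0. \<forall>x<X. f0 x \<noteq> 0 \<longrightarrow> (\<exists>d. (gt has_real_derivative d) (at x) \<and> d \<le> - c / x^2))"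
      using tail_left[OF \<alpha>(1)] unfolding tail_at_bot_def by blast
    define Y where "Y = min X (- \<bar>R\<bar>)"
    have nz: "f0 z \<noteq> 0 \<and> f1 z \<noteq> 0" if "z < \<alpha>" for z using nzl[of z] that a by (auto simp: iv_def)
    have Y: "Y < 0" "Y \<le> \<alpha>" "Y \<le> X" "Y \<le> - R" using X unfolding Y_def by auto
    obtain y where "y < \<alpha>" "F1 y \<le> 0"
    proof (rule F1_nonpos_near_minus_infinity[OF \<alpha>(1) Y(1,2) nz])
      show "F x < 0" if "x < Y" for x by (rule F_neg) (use that Y nz[of x] in auto)
      show "f1 x / f0 x = 1 / (x - \<alpha>) + gt x" if "x < Y" for x using X(3) that Y nz[of x] by auto
      show "(\<exists>b. \<forall>x<Y. gt x = b) \<or> (\<exists>c>0. \<forall>x<Y. \<exists>d. (gt has_real_derivative d) (at x) \<and> d \<le> - c / x^2)"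
        using X(4) Y nz by (meson less_le_trans)
    qed
    \<comment> \<open>The half-line has no left end, so any number below y can serve as b.\<close>
    then show ?thesis using a by (intro exI[of _ "y - 1"] exI[of _ y]) auto
  qed
  then obtain b y where yb: "b < y" "y < \<alpha>" "F1 y \<le> 0" "\<And>z. b < z \<Longrightarrow> a < ereal z" by blast
  have nz: "f1 z \<noteq> 0" if "b < z" "z \<le> x1" for z
    using nzl[of z] nzr[of z] False yb(4)[of z] that by (cases z \<alpha> rule: linorder_cases) (auto simp: iv_def)
  have "b < \<alpha>" using yb by simp
  then obtain z where "b < z" "z < x1" "F1 z = 0"
    using F1_zero_across_simple_zero[OF \<alpha>(1) _ x1 nz yb(1-3)] by blast
  then show ?thesis using nz[of z] yb(4)[of z] wQ1_nz by (intro bexI[of _ z]) (auto simp: iv_def)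
qed


end

section \<open>Reflection of the real line\<close>

lemma iv_uminus: "- x \<in> iv a b \<longleftrightarrow> x \<in> iv (- b) (- a)"
  unfolding iv_def by (auto simp: ereal_uminus_less_reorder ereal_less_uminus_reorder simp flip: uminus_ereal.simps(1))

lemma (in real_jet) F_mirror:
  "real_jet.F (\<lambda>x. f0 (- x)) (\<lambda>x. - f1 (- x)) (\<lambda>x. f2 (- x)) = (\<lambda>x. F (- x))"
  "real_jet.F1 (\<lambda>x. - f1 (- x)) (\<lambda>x. f2 (- x)) (\<lambda>x. - f3 (- x)) = (\<lambda>x. F1 (- x))"
proof -
  interpret m: real_jet "\<lambda>x. f0 (- x)" "\<lambda>x. - f1 (- x)" "\<lambda>x. f2 (- x)" "\<lambda>x. - f3 (- x)"
    by (rule real_jet_mirror) (rule real_jet_axioms)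
  show "m.F = (\<lambda>x. F (- x))" "m.F1 = (\<lambda>x. F1 (- x))" unfolding m.F_def F_def m.F1_def F1_def by auto
qed

lemma (in real_jet) logderiv_sign_right:
  assumes "f0 \<alpha> = 0" "\<alpha> < x" and nz: "\<And>z. \<alpha> < z \<Longrightarrow> z \<le> x \<Longrightarrow> f0 z \<noteq> 0 \<and> f1 z \<noteq> 0"
  shows "f0 x * f1 x > 0"
proof -
  interpret m: real_jet "\<lambda>x. f0 (- x)" "\<lambda>x. - f1 (- x)" "\<lambda>x. f2 (- x)" "\<lambda>x. - f3 (- x)"
    by (rule real_jet_mirror) (rule real_jet_axioms)
  have "f0 (- (- x)) * (- f1 (- (- x))) < 0"
    by (rule m.logderiv_sign_left[of "- \<alpha>" "- x"]) (use assms in \<open>auto simp: nz\<close>)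
  then show ?thesis by simp
qed

lemma (in real_jet) F1_zero_at_minus_infinity:
  assumes "F x0 = 0" and nz: "\<And>x. x \<le> x0 \<Longrightarrow> f0 x \<noteq> 0" "\<And>x. x \<le> x0 \<Longrightarrow> f1 x \<noteq> 0"
    and sg: "f0 x0 * f1 x0 > 0" and F: "\<And>x. x \<le> X \<Longrightarrow> F x < 0"
  obtains z where "z < x0" "F1 z = 0"
proof -
  interpret m: real_jet "\<lambda>x. f0 (- x)" "\<lambda>x. - f1 (- x)" "\<lambda>x. f2 (- x)" "\<lambda>x. - f3 (- x)"
    by (rule real_jet_mirror) (rule real_jet_axioms)
  obtain z where "- x0 < z" "m.F1 z = 0"
    by (rule m.F1_zero_at_infinity[of "- x0" "- X"]) (use assms in \<open>auto simp: F_mirror\<close>)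
  then show thesis using that[of "- z"] by (simp add: F_mirror)
qed

lemma real_jet_mult_mirror:
  assumes "real_jet_mult f0 f1 f2 f3 m0 m1 mF mF1 R"
  shows "real_jet_mult (\<lambda>x. f0 (- x)) (\<lambda>x. - f1 (- x)) (\<lambda>x. f2 (- x)) (\<lambda>x. - f3 (- x))
     (\<lambda>x. m0 (- x)) (\<lambda>x. m1 (- x)) (\<lambda>x. mF (- x)) (\<lambda>x. mF1 (- x)) R"
proof -
  interpret real_jet_mult f0 f1 f2 f3 m0 m1 mF mF1 R by fact
  interpret m: real_jet "\<lambda>x. f0 (- x)" "\<lambda>x. - f1 (- x)" "\<lambda>x. f2 (- x)" "\<lambda>x. - f3 (- x)"
    by (rule real_jet_mirror) (rule real_jet_axioms)
  have fin: "finite {x. a \<le> x \<and> x \<le> b \<and> P (- x)}" if "finite {x. - b \<le> x \<and> x \<le> - a \<and> P x}" for a b :: real and P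
    by (rule finite_subset[OF _ finite_imageI[OF that, of uminus]]) (force simp: image_iff intro: exI[of _ "- _"])
  have mlim: "((\<lambda>x. k (- x)) \<longlongrightarrow> l) (at x)" if "(k \<longlongrightarrow> l) (at (- x))" for k :: "real \<Rightarrow> real" and l x
    by (rule filterlim_compose[OF that]) (auto intro!: filterlim_atI tendsto_intros simp: eventually_at_filter)
  show ?thesis
  proof (unfold_locales, goal_cases)
    case 12
    then show ?case using tendsto_minus[OF mlim[OF lim_zero]] by simp
  next
    case 13 show ?case using fin[of _ _ "\<lambda>x. f0 x = 0"] fin0 by simp
  next
    case 14 show ?case unfolding F_mirror using fin[of _ _ "\<lambda>x. F x = 0"] finF by simp
  next
    case 15 show ?case using fin[of _ _ "\<lambda>x. f1 x = 0"] finf1 by simp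
  next
    case (17 \<alpha>)
    then show ?case using tail_right[of "- \<alpha>"] by simp
  next
    case (18 \<alpha>)
    then show ?case using tail_left[of "- \<alpha>"] by simp
  qed (use m0_nonneg m0_0 m1_nonneg m1_0 mF_nonneg mF_0 mF1_nonneg mF1_0 m_zero m_crit m_Rolle F_neg in \<open>simp_all add: F_mirror\<close>)
qed


context real_jet_mult
begin

lemma mirror: "real_jet_mult (\<lambda>x. f0 (- x)) (\<lambda>x. - f1 (- x)) (\<lambda>x. f2 (- x)) (\<lambda>x. - f3 (- x))
     (\<lambda>x. m0 (- x)) (\<lambda>x. m1 (- x)) (\<lambda>x. mF (- x)) (\<lambda>x. mF1 (- x)) R"
  by (rule real_jet_mult_mirror) (rule real_jet_mult_axioms)

lemma F1_zero_right_unit: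
  assumes \<alpha>: "f0 \<alpha> = 0" "ereal \<alpha> < b" and b: "b = \<infinity> \<or> (\<exists>c. b = ereal c \<and> f1 c = 0)"
    and nzr: "\<And>z. z \<in> iv (ereal \<alpha>) b \<Longrightarrow> f0 z \<noteq> 0 \<and> f1 z \<noteq> 0"
    and x1: "x1 < \<alpha>" "F x1 = 0" and nzl: "\<And>z. x1 \<le> z \<Longrightarrow> z < \<alpha> \<Longrightarrow> f0 z \<noteq> 0 \<and> f1 z \<noteq> 0"
  shows "\<exists>z\<in>iv (ereal x1) b. wQ1 z \<noteq> 0"
proof -
  interpret m: real_jet_mult "\<lambda>x. f0 (- x)" "\<lambda>x. - f1 (- x)" "\<lambda>x. f2 (- x)" "\<lambda>x. - f3 (- x)"
     "\<lambda>x. m0 (- x)" "\<lambda>x. m1 (- x)" "\<lambda>x. mF (- x)" "\<lambda>x. mF1 (- x)" R by (rule mirror)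
  have "\<exists>z\<in>iv (- b) (ereal (- x1)). m.wQ1 z \<noteq> 0"
  proof (rule m.F1_zero_left_unit[of "- \<alpha>"])
    show "- b < ereal (- \<alpha>)" using \<alpha>(2) by (metis ereal_minus_less_minus uminus_ereal.simps(1))
    show "- b = - \<infinity> \<or> (\<exists>c. - b = ereal c \<and> - f1 (- c) = 0)"
      using b by (auto intro: exI[of _ "- _"])
    show "f0 (- z) \<noteq> 0 \<and> - f1 (- z) \<noteq> 0" if "z \<in> iv (- b) (ereal (- \<alpha>))" for z
      using nzr[of "- z"] that iv_uminus[of z "ereal \<alpha>" b] by simp
    show "f0 (- z) \<noteq> 0 \<and> - f1 (- z) \<noteq> 0" if "- \<alpha> < z" "z \<le> - x1" for z
      using nzl[of "- z"] that by simp
  qed (use \<alpha> x1 in \<open>auto simp: F_mirror\<close>)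
  then obtain z where z: "z \<in> iv (- b) (ereal (- x1))" "m.wQ1 z \<noteq> 0" by blast
  then have "wQ1 (- z) \<noteq> 0" unfolding m.wQ1_nz F_mirror by (simp add: wQ1_nz)
  moreover have "- z \<in> iv (ereal x1) b" using z(1) iv_uminus[of z "ereal x1" b] by simp
  ultimately show ?thesis by blast
qed

(* Between consecutive critical points a and b with f0 nonzero, the zeros of Q number at least lft a + rgt b - 1 minus
   the number of zeros of f0; at infinite end points lft and rgt record the sign of f1 / f0 there. *)
definition lft :: "ereal \<Rightarrow> int" where
  "lft a = (if a = - \<infinity> \<and> \<not> (\<exists>X. \<forall>x<X. f0 x * f1 x < 0) then 0 else 1)"
definition rgt :: "ereal \<Rightarrow> int" where
  "rgt b = (if b = \<infinity> \<and> \<not> (\<exists>X. \<forall>x>X. f0 x * f1 x > 0) then 0 else 1)"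

lemma lft_rgt_cases: "lft a = 0 \<or> lft a = 1" "rgt b = 0 \<or> rgt b = 1"
  unfolding lft_def rgt_def by auto

section \<open>A single segment between consecutive zeros of g\<close>

context
  fixes a b :: ereal
  assumes ab: "a < b"
    and a_end: "a = - \<infinity> \<or> (\<exists>u. a = ereal u \<and> f1 u = 0 \<and> f0 u \<noteq> 0)"
    and b_end: "b = \<infinity> \<or> (\<exists>u. b = ereal u \<and> f1 u = 0 \<and> f0 u \<noteq> 0)"
    and no_crit: "\<And>x. x \<in> iv a b \<Longrightarrow> f1 x = 0 \<Longrightarrow> f0 x = 0"
begin

lemma unique_zero_less:
  assumes "x \<in> iv a b" "y \<in> iv a b" "f0 x = 0" "f0 y = 0" "x < y"
  shows False
proof -
  obtain z where "x < z" "z < y" "f1 z = 0" "f0 z \<noteq> 0" using crit_between_zeros[OF assms(5,3,4)] by blast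
  then show False using no_crit iv_convex[OF assms(1,2), of z] by auto
qed

lemma unique_zero: "x \<in> iv a b \<Longrightarrow> y \<in> iv a b \<Longrightarrow> f0 x = 0 \<Longrightarrow> f0 y = 0 \<Longrightarrow> x = y"
  using unique_zero_less[of x y] unique_zero_less[of y x] by (cases x y rule: linorder_cases) auto

lemma D_segment: "x \<in> iv a b \<Longrightarrow> D x = (if f0 x = 0 then - 1 else 0)"
  using no_crit[of x] m_zero[of x] m0_0[of x] m1_0[of x] unfolding D_def by auto

lemma fin_D_segment: "finite {x \<in> iv a b. D x \<noteq> 0}"
proof (cases "\<exists>\<alpha>\<in>iv a b. f0 \<alpha> = 0")
  case True
  then obtain \<alpha> where \<alpha>: "\<alpha> \<in> iv a b" "f0 \<alpha> = 0" by blast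
  have "x = \<alpha>" if "x \<in> iv a b" "D x \<noteq> 0" for x
    by (rule unique_zero[OF that(1) \<alpha>(1) _ \<alpha>(2)]) (use D_segment[OF that(1)] that(2) in argo)
  then have "{x \<in> iv a b. D x \<noteq> 0} \<subseteq> {\<alpha>}" by blast
  then show ?thesis by (rule finite_subset) simp
next
  case False
  then have "{x \<in> iv a b. D x \<noteq> 0} = {}" using D_segment by auto
  then show ?thesis by (metis finite.emptyI)
qed

lemma sum_D_segment_no_zero:
  assumes "\<And>x. x \<in> iv a b \<Longrightarrow> f0 x \<noteq> 0"
  shows "sum_supp D (iv a b) = 0"
  unfolding sum_supp_def by (rule sum.neutral) (use D_segment assms in auto)

lemma sum_D_segment_zero:
  assumes "\<alpha> \<in> iv a b" "f0 \<alpha> = 0"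
  shows "sum_supp D (iv a b) = - 1"
proof -
  have "sum_supp D (iv a b) = sum D {\<alpha>}"
    by (rule sum_supp_eq) (use assms unique_zero D_segment in auto)
  then show ?thesis using D_segment assms by simp
qed

lemma sides_nonzero:
  assumes "\<alpha> \<in> iv a b" "f0 \<alpha> = 0" "x \<in> iv a b" "x \<noteq> \<alpha>"
  shows "f0 x \<noteq> 0 \<and> f1 x \<noteq> 0"
  using unique_zero[OF assms(1,3)] assms no_crit[OF assms(3)] by auto

text \<open>Up to the ends of the segment g is negative to the left of its pole and positive to the
  right of it, which at an infinite end is just the sign condition behind the value 1.\<close>

lemma lft_rgt_zero:
  assumes \<alpha>: "\<alpha> \<in> iv a b" "f0 \<alpha> = 0"
  shows "lft a = 1" "rgt b = 1"
proof -
  have "f0 x * f1 x < 0" if "a = - \<infinity>" "x < \<alpha>" for x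
  proof (rule logderiv_sign_left[OF \<alpha>(2) that(2)])
    fix z assume z: "x \<le> z" "z < \<alpha>"
    then have "z \<in> iv a b" using \<alpha>(1) that(1) by (auto simp: iv_def intro: less_trans[of "ereal z" "ereal \<alpha>"])
    then show "f0 z \<noteq> 0 \<and> f1 z \<noteq> 0" using sides_nonzero[OF \<alpha>] z by auto
  qed
  then show "lft a = 1" unfolding lft_def by auto
  have "f0 x * f1 x > 0" if "b = \<infinity>" "\<alpha> < x" for x
  proof (rule logderiv_sign_right[OF \<alpha>(2) that(2)])
    fix z assume z: "\<alpha> < z" "z \<le> x"
    then have "z \<in> iv a b" using \<alpha>(1) that(1) by (auto simp: iv_def intro: less_trans[of a "ereal \<alpha>"])
    then show "f0 z \<noteq> 0 \<and> f1 z \<noteq> 0" using sides_nonzero[OF \<alpha>] z by auto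
  qed
  then show "rgt b = 1" unfolding rgt_def by auto
qed

lemma sign_const:
  assumes nz: "\<And>x. x \<in> iv a b \<Longrightarrow> f0 x \<noteq> 0" and xy: "x \<in> iv a b" "y \<in> iv a b"
  shows "(f0 x * f1 x) * (f0 y * f1 y) > 0"
proof (rule same_sign[where k = "\<lambda>x. f0 x * f1 x"])
  show "isCont (\<lambda>x. f0 x * f1 x) z" for z by (intro continuous_intros)
  show "f0 z * f1 z \<noteq> 0" if "min x y \<le> z" "z \<le> max x y" for z
  proof -
    have "z \<in> iv a b" using iv_convex[OF xy] iv_convex[OF xy(2,1)] that by (auto simp: min_def max_def split: if_splits)
    then show ?thesis using nz no_crit by auto
  qed
qed

text \<open>Without zeros of f0 the product f0 * f1 has constant sign on the segment, so the sign
  near minus infinity, which \<open>lft\<close> records, holds at every point.\<close>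

lemma neg_of_lft:
  assumes nz: "\<And>x. x \<in> iv a b \<Longrightarrow> f0 x \<noteq> 0" and a: "a = - \<infinity>" and x: "x \<in> iv a b"
  shows "if lft a = 1 then f0 x * f1 x < 0 else f0 x * f1 x > 0"
proof -
  have down: "y \<in> iv a b" if "y \<le> x" for y using x a that by (auto simp: iv_def intro: order.strict_trans1[of "ereal y" "ereal x"])
  show ?thesis
  proof (cases "lft a = 1")
    case True
    then obtain X where "\<forall>x<X. f0 x * f1 x < 0" using a unfolding lft_def by (auto split: if_splits)
    then have "f0 (min x (X - 1)) * f1 (min x (X - 1)) < 0" by (auto simp: min_def)
    moreover have "min x (X - 1) \<in> iv a b" by (rule down) auto
    ultimately show ?thesis using sign_const[OF nz x, of "min x (X - 1)"] True by (auto simp: zero_less_mult_iff[of "f0 x * f1 x"])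
  next
    case False
    then have "\<not> (\<forall>y<x. f0 y * f1 y < 0)" unfolding lft_def by (auto split: if_splits)
    then obtain y where "y < x" "\<not> f0 y * f1 y < 0" by auto
    then show ?thesis using sign_const[OF nz x down[of y]] False by (auto simp: zero_less_mult_iff[of "f0 x * f1 x"])
  qed
qed

lemma pos_of_rgt:
  assumes nz: "\<And>x. x \<in> iv a b \<Longrightarrow> f0 x \<noteq> 0" and b: "b = \<infinity>" and x: "x \<in> iv a b"
  shows "if rgt b = 1 then f0 x * f1 x > 0 else f0 x * f1 x < 0"
proof -
  have up: "y \<in> iv a b" if "x \<le> y" for y using x b that by (auto simp: iv_def intro: order.strict_trans2[of a "ereal x"])
  show ?thesis
  proof (cases "rgt b = 1")
    case True
    then obtain X where "\<forall>x>X. f0 x * f1 x > 0" using b unfolding rgt_def by (auto split: if_splits)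
    then have "f0 (max x (X + 1)) * f1 (max x (X + 1)) > 0" by (auto simp: max_def)
    moreover have "max x (X + 1) \<in> iv a b" by (rule up) auto
    ultimately show ?thesis using sign_const[OF nz x, of "max x (X + 1)"] True by (auto simp: zero_less_mult_iff[of "f0 x * f1 x"])
  next
    case False
    then have "\<not> (\<forall>y>x. f0 y * f1 y > 0)" unfolding rgt_def by (auto split: if_splits)
    then obtain y where "y > x" "\<not> f0 y * f1 y > 0" by auto
    then show ?thesis using sign_const[OF nz x up[of y]] False by (auto simp: zero_less_mult_iff[of "f0 x * f1 x"])
  qed
qed

text \<open>\<open>Rolle_count\<close> with el = 1 - lft a and er = 1 - rgt b. These are 1 only at
  an infinite end towards which |f0| decreases, and there \<open>F1_zero_at_infinity\<close> or its
  mirror image finds the additional zero. They are not both 1, because f0 * f1 has constant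
  sign.\<close>

lemma segment_upper_no_zero:
  assumes fin1: "finite {x. f1 x \<noteq> 0 \<and> F1 x = 0}" and nz: "\<And>x. x \<in> iv a b \<Longrightarrow> f0 x \<noteq> 0"
  shows "sum_supp (\<lambda>x. wQ1 x - wQ x) (iv a b) \<ge> 1 - lft a - rgt b"
proof -
  have nz': "f0 x \<noteq> 0 \<and> f1 x \<noteq> 0" if "x \<in> iv a b" for x using nz[OF that] no_crit[OF that] by auto
  obtain z0 where z0: "z0 \<in> iv a b" using ereal_dense2[OF ab] unfolding iv_def by auto
  have "sum_supp (\<lambda>x. wQ1 x - wQ x) (iv a b) \<ge> (1 - lft a) + (1 - rgt b) - 1"
  proof (rule Rolle_count[OF fin1 ab])
    show "(1 - lft a) + (1 - rgt b) \<le> 1"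
    proof (rule ccontr)
      assume "\<not> (1 - lft a) + (1 - rgt b) \<le> 1"
      then have "lft a = 0" "rgt b = 0" using lft_rgt_cases(1)[of a] lft_rgt_cases(2)[of b] by auto
      moreover from this have "a = - \<infinity>" "b = \<infinity>" unfolding lft_def rgt_def by (auto split: if_splits)
      ultimately show False using neg_of_lft[OF nz _ z0] pos_of_rgt[OF nz _ z0] by auto
    qed
    show "\<exists>z\<in>iv a (ereal x). wQ1 z \<noteq> 0 \<or> wQ z \<noteq> 0" if xx: "1 - lft a = 1" "x \<in> iv a b" "wQ x \<noteq> 0" for x
    proof -
      have l: "lft a = 0" using that(1) by simp
      then have a: "a = - \<infinity>" unfolding lft_def by (auto split: if_splits)
      have down: "y \<in> iv a b" if "y \<le> x" for y using \<open>x \<in> iv a b\<close> a that by (auto simp: iv_def intro: order.strict_trans1[of "ereal y" "ereal x"])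
      obtain z where z: "z < x" "F1 z = 0"
      proof (rule F1_zero_at_minus_infinity[of x "min x (- R)"])
        show "F x = 0" using xx(3) wQ_nz by auto
        show "f0 x * f1 x > 0" using neg_of_lft[OF nz a xx(2)] l by simp
        show "F y < 0" if "y \<le> min x (- R)" for y by (rule F_neg) (use that nz down[of y] in auto)
      qed (use nz' down in auto)
      then show ?thesis using nz' down[of z] a by (intro bexI[of _ z]) (auto simp: wQ1_nz iv_def)
    qed
    show "\<exists>z\<in>iv (ereal x) b. wQ1 z \<noteq> 0 \<or> wQ z \<noteq> 0" if xx: "1 - rgt b = 1" "x \<in> iv a b" "wQ x \<noteq> 0" for x
    proof -
      have l: "rgt b = 0" using that(1) by simp
      then have b: "b = \<infinity>" unfolding rgt_def by (auto split: if_splits)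
      have up: "y \<in> iv a b" if "x \<le> y" for y using \<open>x \<in> iv a b\<close> b that by (auto simp: iv_def intro: order.strict_trans2[of a "ereal x"])
      obtain z where z: "x < z" "F1 z = 0"
      proof (rule F1_zero_at_infinity[of x "max x R"])
        show "F x = 0" using xx(3) wQ_nz by auto
        show "f0 x * f1 x < 0" using pos_of_rgt[OF nz b xx(2)] l by simp
        show "F y < 0" if "max x R \<le> y" for y by (rule F_neg) (use that nz up[of y] in auto)
      qed (use nz' up in auto)
      then show ?thesis using nz' up[of z] b by (intro bexI[of _ z]) (auto simp: wQ1_nz iv_def)
    qed
    show "f0 z \<noteq> 0 \<and> f1 z \<noteq> 0" if "x \<in> iv a b" "y \<in> iv a b" "x \<le> z" "z \<le> y" for x y z
      using nz' iv_convex that by blast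
  qed (use lft_rgt_cases in auto)
  then show ?thesis by simp
qed

text \<open>As all zeros of Q lie on one side of \<alpha>, Rolle's theorem joins consecutive ones
  without crossing \<alpha>. The unit it costs is regained between \<alpha>'s other side and the
  nearest zero of Q, through el = 1 or er = 1.\<close>

lemma segment_upper_zero:
  assumes fin1: "finite {x. f1 x \<noteq> 0 \<and> F1 x = 0}" and \<alpha>: "\<alpha> \<in> iv a b" "f0 \<alpha> = 0"
    and A: "(\<forall>x\<in>iv a (ereal \<alpha>). wQ x = 0) \<or> (\<forall>x\<in>iv (ereal \<alpha>) b. wQ x = 0)"
  shows "sum_supp (\<lambda>x. wQ1 x - wQ x) (iv a b) \<ge> 0"
proof -
  have a\<alpha>b: "a < ereal \<alpha>" "ereal \<alpha> < b" using \<alpha>(1) by (auto simp: iv_def)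
  have iv: "z \<in> iv a b" if "z \<in> iv a (ereal \<alpha>) \<or> z \<in> iv (ereal \<alpha>) b" for z
    using iv_mono[of a a "ereal \<alpha>" b] iv_mono[of a "ereal \<alpha>" b b] a\<alpha>b that by (auto intro: less_imp_le)
  have wQ\<alpha>: "wQ \<alpha> = 0" using \<alpha> unfolding wQ_def by simp
  from A show ?thesis
  proof
    assume A: "\<forall>x\<in>iv a (ereal \<alpha>). wQ x = 0"
    have gt: "\<alpha> < x" if "x \<in> iv a b" "wQ x \<noteq> 0" for x
      using A wQ\<alpha> that by (cases x \<alpha> rule: linorder_cases) (auto simp: iv_def)
    have "sum_supp (\<lambda>x. wQ1 x - wQ x) (iv a b) \<ge> 1 + 0 - 1"
    proof (rule Rolle_count[OF fin1 ab])
      show "f0 z \<noteq> 0 \<and> f1 z \<noteq> 0" if "x \<in> iv a b" "y \<in> iv a b" "wQ x \<noteq> 0" "wQ y \<noteq> 0" "x \<le> z" "z \<le> y" for x y z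
        using sides_nonzero[OF \<alpha>, of z] iv_convex[OF that(1,2,5,6)] gt[of x] that by auto
      show "\<exists>z\<in>iv a (ereal x). wQ1 z \<noteq> 0 \<or> wQ z \<noteq> 0" if "x \<in> iv a b" "wQ x \<noteq> 0" for x
      proof -
        have "\<exists>z\<in>iv a (ereal x). wQ1 z \<noteq> 0"
        proof (rule F1_zero_left_unit[OF \<alpha>(2) a\<alpha>b(1)])
          show "a = - \<infinity> \<or> (\<exists>b. a = ereal b \<and> f1 b = 0)" using a_end by auto
          show "f0 z \<noteq> 0 \<and> f1 z \<noteq> 0" if "z \<in> iv a (ereal \<alpha>)" for z
            using sides_nonzero[OF \<alpha>, of z] iv that by (auto simp: iv_def)
          show "f0 z \<noteq> 0 \<and> f1 z \<noteq> 0" if "\<alpha> < z" "z \<le> x" for z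
            using sides_nonzero[OF \<alpha>, of z] iv_convex[OF \<alpha>(1) \<open>x \<in> iv a b\<close>] that by auto
        qed (use gt that wQ_nz in auto)
        then show ?thesis by blast
      qed
    qed auto
    then show ?thesis by simp
  next
    assume A: "\<forall>x\<in>iv (ereal \<alpha>) b. wQ x = 0"
    have lt: "x < \<alpha>" if "x \<in> iv a b" "wQ x \<noteq> 0" for x
      using A wQ\<alpha> that by (cases x \<alpha> rule: linorder_cases) (auto simp: iv_def)
    have "sum_supp (\<lambda>x. wQ1 x - wQ x) (iv a b) \<ge> 0 + 1 - 1"
    proof (rule Rolle_count[OF fin1 ab])
      show "f0 z \<noteq> 0 \<and> f1 z \<noteq> 0" if "x \<in> iv a b" "y \<in> iv a b" "wQ x \<noteq> 0" "wQ y \<noteq> 0" "x \<le> z" "z \<le> y" for x y z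
        using sides_nonzero[OF \<alpha>, of z] iv_convex[OF that(1,2,5,6)] lt[of y] that by auto
      show "\<exists>z\<in>iv (ereal x) b. wQ1 z \<noteq> 0 \<or> wQ z \<noteq> 0" if "x \<in> iv a b" "wQ x \<noteq> 0" for x
      proof -
        have "\<exists>z\<in>iv (ereal x) b. wQ1 z \<noteq> 0"
        proof (rule F1_zero_right_unit[OF \<alpha>(2) a\<alpha>b(2)])
          show "b = \<infinity> \<or> (\<exists>c. b = ereal c \<and> f1 c = 0)" using b_end by auto
          show "f0 z \<noteq> 0 \<and> f1 z \<noteq> 0" if "z \<in> iv (ereal \<alpha>) b" for z
            using sides_nonzero[OF \<alpha>, of z] iv that by (auto simp: iv_def)
          show "f0 z \<noteq> 0 \<and> f1 z \<noteq> 0" if "x \<le> z" "z < \<alpha>" for z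
            using sides_nonzero[OF \<alpha>, of z] iv_convex[OF \<open>x \<in> iv a b\<close> \<alpha>(1)] that by auto
        qed (use lt that wQ_nz in auto)
        then show ?thesis by blast
      qed
    qed auto
    then show ?thesis by simp
  qed
qed

text \<open>\<open>D\<close> makes one formula serve both kinds of segments: if there is a zero of
  f0, then lft = rgt = 1, and the contribution -1 of \<open>D\<close> turns the bound 0 into 1 - 1 -
  1.\<close>

lemma segment_upper:
  assumes fin1: "finite {x. f1 x \<noteq> 0 \<and> F1 x = 0}" and A: "\<And>\<alpha>. \<alpha> \<in> iv a b \<Longrightarrow> f0 \<alpha> = 0 \<Longrightarrow> (\<forall>x\<in>iv a (ereal \<alpha>). wQ x = 0) \<or> (\<forall>x\<in>iv (ereal \<alpha>) b. wQ x = 0)"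
  shows "sum_supp (\<lambda>x. wQ1 x - wQ x + D x) (iv a b) \<ge> 1 - lft a - rgt b"
proof -
  have "sum_supp (\<lambda>x. wQ1 x - wQ x + D x) (iv a b) = sum_supp (\<lambda>x. wQ1 x - wQ x) (iv a b) + sum_supp D (iv a b)"
    by (rule sum_supp_add[OF fin_wdiff[OF fin1] fin_D_segment])
  moreover have "sum_supp (\<lambda>x. wQ1 x - wQ x) (iv a b) + sum_supp D (iv a b) \<ge> 1 - lft a - rgt b"
  proof (cases "\<exists>\<alpha>\<in>iv a b. f0 \<alpha> = 0")
    case True
    then obtain \<alpha> where \<alpha>: "\<alpha> \<in> iv a b" "f0 \<alpha> = 0" by blast
    show ?thesis using segment_upper_zero[OF fin1 \<alpha> A[OF \<alpha>]] sum_D_segment_zero[OF \<alpha>] lft_rgt_zero[OF \<alpha>] by simp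
  next
    case False
    then show ?thesis using segment_upper_no_zero[OF fin1] sum_D_segment_no_zero by simp
  qed
  ultimately show ?thesis by simp
qed

text \<open>Otherwise g is strictly monotone. Between two finite ends this contradicts Rolle's
  theorem, since g vanishes at both. Next to an infinite end F < 0, so g decreases; being 0 at the
  finite end, it has the sign opposite to the one demanded by lft = 1 or rgt = 1. Two infinite ends
  demand opposite signs of a function of constant sign.\<close>

lemma segment_lower_no_zero:
  assumes nz: "\<And>x. x \<in> iv a b \<Longrightarrow> f0 x \<noteq> 0" and lr: "lft a = 1" "rgt b = 1"
  shows "\<exists>z\<in>iv a b. F z = 0"
proof (rule ccontr)
  assume "\<not> (\<exists>z\<in>iv a b. F z = 0)"
  then have F0: "F z \<noteq> 0" if "z \<in> iv a b" for z using that by auto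
  have nz': "f0 x \<noteq> 0 \<and> f1 x \<noteq> 0" if "x \<in> iv a b" for x using nz[OF that] no_crit[OF that] by auto
  obtain z0 where z0: "z0 \<in> iv a b" using ereal_dense2[OF ab] unfolding iv_def by auto
  have FF: "F x * F y > 0" if "x \<in> iv a b" "y \<in> iv a b" for x y
  proof (rule same_sign[OF cont(4)])
    fix z assume "min x y \<le> z" "z \<le> max x y"
    then have "z \<in> iv a b" using iv_convex[OF that] iv_convex[OF that(2,1)] by (auto simp: min_def max_def split: if_splits)
    then show "F z \<noteq> 0" by (rule F0)
  qed
  have neg: "F x < 0" if "y \<in> iv a b" "\<bar>y\<bar> \<ge> R" "x \<in> iv a b" for x y
    using F_neg[OF that(2) nz[OF that(1)]] FF[OF that(1,3)] by (auto simp: zero_less_mult_iff)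
  have dec: "f1 y / f0 y < f1 x / f0 x"
    if F: "\<And>z. z \<in> iv a b \<Longrightarrow> F z < 0" and "x < y" and sub: "\<And>z. x < z \<Longrightarrow> z < y \<Longrightarrow> z \<in> iv a b"
      and nzx: "f0 x \<noteq> 0" "f0 y \<noteq> 0" for x y
  proof (rule DERIV_neg_imp_decreasing_open[OF \<open>x < y\<close>])
    show "\<exists>d. ((\<lambda>x. f1 x / f0 x) has_real_derivative d) (at z) \<and> d < 0" if "x < z" "z < y" for z
      using logderiv_deriv[of z] nz[OF sub[OF that]] F[OF sub[OF that]]
      by (intro exI[of _ "F z / (f0 z)^2"]) (auto intro!: divide_neg_pos)
    show "continuous_on {x..y} (\<lambda>x. f1 x / f0 x)"
    proof (intro continuous_at_imp_continuous_on ballI continuous_intros cont)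
      fix z assume "z \<in> {x..y}"
      then show "f0 z \<noteq> 0" using nz[OF sub[of z]] nzx by (cases "z = x \<or> z = y") auto
    qed
  qed
  from a_end b_end show False
  proof (elim disjE exE conjE)
    assume "a = - \<infinity>" "b = \<infinity>"
    then show False using neg_of_lft[OF nz _ z0] pos_of_rgt[OF nz _ z0] lr by simp
  next
    fix v assume a: "a = - \<infinity>" and v: "b = ereal v" "f1 v = 0" "f0 v \<noteq> 0"
    define x where "x = min (v - 1) (- R)"
    have x: "x < v" "\<bar>x\<bar> \<ge> R" "x \<in> iv a b" using a v unfolding x_def iv_def by auto
    have "f1 v / f0 v < f1 x / f0 x"
      by (rule dec) (use x neg[OF x(3,2)] v nz[OF x(3)] a in \<open>auto simp: iv_def\<close>)
    then show False using neg_of_lft[OF nz a x(3)] lr v by (auto simp: zero_less_divide_iff mult_less_0_iff)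
  next
    fix u assume b: "b = \<infinity>" and u: "a = ereal u" "f1 u = 0" "f0 u \<noteq> 0"
    define x where "x = max (u + 1) R"
    have x: "u < x" "\<bar>x\<bar> \<ge> R" "x \<in> iv a b" using b u unfolding x_def iv_def by auto
    have "f1 x / f0 x < f1 u / f0 u"
      by (rule dec) (use x neg[OF x(3,2)] u nz[OF x(3)] b in \<open>auto simp: iv_def\<close>)
    then show False using pos_of_rgt[OF nz b x(3)] lr u by (auto simp: divide_less_0_iff zero_less_mult_iff)
  next
    fix u v assume u: "a = ereal u" "f1 u = 0" "f0 u \<noteq> 0" and v: "b = ereal v" "f1 v = 0" "f0 v \<noteq> 0"
    have "u < v" using ab u v by simp
    have nzc: "f0 z \<noteq> 0" if "u \<le> z" "z \<le> v" for z
      using nz[of z] u v that by (cases "z = u \<or> z = v") (auto simp: iv_def)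
    have "\<exists>z. u < z \<and> z < v \<and> ((\<lambda>x. f1 x / f0 x) has_real_derivative 0) (at z)"
    proof (rule Rolle[OF \<open>u < v\<close>])
      show "continuous_on {u..v} (\<lambda>x. f1 x / f0 x)"
        by (intro continuous_at_imp_continuous_on ballI continuous_intros cont) (use nzc in auto)
      show "(\<lambda>x. f1 x / f0 x) differentiable at z" if "u < z" "z < v" for z
        using logderiv_deriv[of z] nzc[of z] that by (auto simp: real_differentiable_def)
    qed (use u v in auto)
    then obtain z where z: "u < z" "z < v" "((\<lambda>x. f1 x / f0 x) has_real_derivative 0) (at z)" by blast
    then have "F z / (f0 z)^2 = 0" using logderiv_deriv[of z] nzc[of z] DERIV_unique by force
    then have "F z = 0" using nzc[of z] z by simp
    then show False using F0[of z] z u v by (auto simp: iv_def)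
  qed
qed

text \<open>The unit needed for lft = rgt = 1 comes from - D = 1 if f0 has a zero in the segment,
  and from a zero of Q if not. In the other cases nonnegativity is enough.\<close>

lemma segment_lower: "sum_supp (\<lambda>x. wQ x - D x) (iv a b) \<ge> lft a + rgt b - 1"
proof -
  have nn: "wQ x - D x \<ge> 0" if "x \<in> iv a b" for x using wQ_nonneg[of x] D_segment[OF that] by auto
  have fin: "finite {x \<in> iv a b. wQ x - D x \<noteq> 0}"
    by (rule finite_subset[OF _ finite_UnI[OF fin_wQ[of "iv a b"] fin_D_segment]]) auto
  have "sum_supp (\<lambda>x. wQ x - D x) (iv a b) \<ge> 1" if lr: "lft a = 1" "rgt b = 1"
  proof (cases "\<exists>\<alpha>\<in>iv a b. f0 \<alpha> = 0")
    case True
    then obtain \<alpha> where "\<alpha> \<in> iv a b" "f0 \<alpha> = 0" by blast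
    then show ?thesis using sum_supp_pos[OF fin nn, of \<alpha>] D_segment[of \<alpha>] wQ_nonneg[of \<alpha>] by simp
  next
    case False
    then obtain z where "z \<in> iv a b" "F z = 0" using segment_lower_no_zero lr by blast
    then show ?thesis using sum_supp_pos[OF fin nn, of z] D_segment[of z] wQ_nz[of z] False by auto
  qed
  moreover have "sum_supp (\<lambda>x. wQ x - D x) (iv a b) \<ge> 0" by (rule sum_supp_nonneg) (rule nn)
  ultimately show ?thesis using lft_rgt_cases(1)[of a] lft_rgt_cases(2)[of b] by auto
qed

end

section \<open>Summation over all segments of a window\<close>

lemma total_upper:
  assumes fin1: "finite {x. f1 x \<noteq> 0 \<and> F1 x = 0}" and "lo < hi"
    and lo: "lo = - \<infinity> \<or> (\<exists>u. lo = ereal u \<and> f1 u = 0 \<and> f0 u \<noteq> 0)"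
    and hi: "hi = \<infinity> \<or> (\<exists>u. hi = ereal u \<and> f1 u = 0 \<and> f0 u \<noteq> 0)"
    and fin: "finite {x \<in> iv lo hi. f1 x = 0 \<and> f0 x \<noteq> 0}" "finite {x \<in> iv lo hi. D x \<noteq> 0}"
    and A: "\<And>\<alpha> a b. a < ereal \<alpha> \<Longrightarrow> ereal \<alpha> < b \<Longrightarrow> f0 \<alpha> = 0 \<Longrightarrow>
        a = - \<infinity> \<or> (\<exists>u. a = ereal u \<and> f1 u = 0) \<Longrightarrow> b = \<infinity> \<or> (\<exists>u. b = ereal u \<and> f1 u = 0) \<Longrightarrow>
        (\<And>x. x \<in> iv a b \<Longrightarrow> x \<noteq> \<alpha> \<Longrightarrow> f1 x \<noteq> 0) \<Longrightarrow>
        (\<forall>x\<in>iv a (ereal \<alpha>). wQ x = 0) \<or> (\<forall>x\<in>iv (ereal \<alpha>) b. wQ x = 0)"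
  shows "sum_supp wQ1 (iv lo hi) - sum_supp wQ (iv lo hi) + sum_supp D (iv lo hi) \<ge> 1 - lft lo - rgt hi"
proof -
  define B where "B = {x \<in> iv lo hi. f1 x = 0 \<and> f0 x \<noteq> 0}"
  have finw: "finite {x \<in> iv lo hi. wQ1 x - wQ x + D x \<noteq> 0}"
    by (rule finite_subset[OF _ finite_UnI[OF fin_wdiff[OF fin1, of "iv lo hi"] fin(2)]]) auto
  have "(1 - lft lo) + (- rgt hi) \<le> (\<Sum>x | x \<in> iv lo hi \<and> wQ1 x - wQ x + D x \<noteq> 0. wQ1 x - wQ x + D x)"
  proof (rule sum_over_partition_ge[of B, where f = "\<lambda>x. 1 - lft x" and f' = "\<lambda>x. - rgt x"])
    show "(1 - lft a) + (- rgt b) \<le> (\<Sum>x | x \<in> iv a b \<and> wQ1 x - wQ x + D x \<noteq> 0. wQ1 x - wQ x + D x)"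
      if a: "a \<in> insert lo (ereal ` B)" and b: "b \<in> insert hi (ereal ` B)" and "a < b" "iv a b \<inter> B = {}" for a b
    proof -
      have a': "a = - \<infinity> \<or> (\<exists>u. a = ereal u \<and> f1 u = 0 \<and> f0 u \<noteq> 0)" using a lo unfolding B_def by auto
      have b': "b = \<infinity> \<or> (\<exists>u. b = ereal u \<and> f1 u = 0 \<and> f0 u \<noteq> 0)" using b hi unfolding B_def by auto
      have "iv a b \<subseteq> iv lo hi"
        by (rule iv_mono) (use a b in \<open>auto simp: B_def iv_def intro: less_imp_le\<close>)
      then have nc: "f0 x = 0" if "x \<in> iv a b" "f1 x = 0" for x using that \<open>iv a b \<inter> B = {}\<close> unfolding B_def by auto
      have "(\<forall>x\<in>iv a (ereal \<alpha>). wQ x = 0) \<or> (\<forall>x\<in>iv (ereal \<alpha>) b. wQ x = 0)"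
        if \<alpha>: "\<alpha> \<in> iv a b" "f0 \<alpha> = 0" for \<alpha>
      proof (rule A[OF _ _ \<alpha>(2)])
        show "f1 x \<noteq> 0" if "x \<in> iv a b" "x \<noteq> \<alpha>" for x
          using sides_nonzero[OF \<open>a < b\<close> a' b' nc \<alpha> that] by auto
      qed (use \<alpha> a' b' in \<open>auto simp: iv_def\<close>)
      then show ?thesis using segment_upper[OF \<open>a < b\<close> a' b' nc fin1] unfolding sum_supp_def by simp
    qed
    \<comment> \<open>At such a node wQ1 = 0, wQ = m1 - 1 and D = m1. The weight is therefore 1 and
      balances the charge - rgt = -1, while 1 - lft = 0.\<close>
    show "0 \<le> wQ1 x - wQ x + D x + (1 - lft (ereal x)) + - rgt (ereal x)" if "x \<in> B" for x
    proof -
      have x: "f1 x = 0" "f0 x \<noteq> 0" using that unfolding B_def by auto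
      then show ?thesis using m_crit[OF x(2,1)] m0_0[of x] unfolding wQ1_def wQ_def D_def lft_def rgt_def by simp
    qed
  qed (use assms finw in \<open>auto simp: B_def\<close>)
  also have "\<dots> = sum_supp (\<lambda>x. (wQ1 x - wQ x) + D x) (iv lo hi)" unfolding sum_supp_def by simp
  also have "\<dots> = sum_supp (\<lambda>x. wQ1 x - wQ x) (iv lo hi) + sum_supp D (iv lo hi)"
    by (rule sum_supp_add[OF fin_wdiff[OF fin1] fin(2)])
  also have "sum_supp (\<lambda>x. wQ1 x - wQ x) (iv lo hi) = sum_supp wQ1 (iv lo hi) - sum_supp wQ (iv lo hi)"
    using sum_supp_add[of "iv lo hi" wQ1 "\<lambda>x. - wQ x"] fin_wQ fin_wQ1[OF fin1] by (simp add: sum_supp_uminus)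
  finally show ?thesis by simp
qed

lemma total_lower:
  assumes "lo < hi"
    and lo: "lo = - \<infinity> \<or> (\<exists>u. lo = ereal u \<and> f1 u = 0 \<and> f0 u \<noteq> 0)"
    and hi: "hi = \<infinity> \<or> (\<exists>u. hi = ereal u \<and> f1 u = 0 \<and> f0 u \<noteq> 0)"
    and fin: "finite {x \<in> iv lo hi. f1 x = 0 \<and> f0 x \<noteq> 0}" "finite {x \<in> iv lo hi. D x \<noteq> 0}"
  shows "sum_supp wQ (iv lo hi) - sum_supp D (iv lo hi) \<ge> lft lo + rgt hi - 1"
proof -
  define B where "B = {x \<in> iv lo hi. f1 x = 0 \<and> f0 x \<noteq> 0}"
  have finw: "finite {x \<in> iv lo hi. wQ x - D x \<noteq> 0}"
    by (rule finite_subset[OF _ finite_UnI[OF fin_wQ[of "iv lo hi"] fin(2)]]) auto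
  have "(lft lo - 1) + rgt hi \<le> (\<Sum>x | x \<in> iv lo hi \<and> wQ x - D x \<noteq> 0. wQ x - D x)"
  proof (rule sum_over_partition_ge[of B, where f = "\<lambda>x. lft x - 1" and f' = rgt])
    show "(lft a - 1) + rgt b \<le> (\<Sum>x | x \<in> iv a b \<and> wQ x - D x \<noteq> 0. wQ x - D x)"
      if a: "a \<in> insert lo (ereal ` B)" and b: "b \<in> insert hi (ereal ` B)" and "a < b" "iv a b \<inter> B = {}" for a b
    proof -
      have a': "a = - \<infinity> \<or> (\<exists>u. a = ereal u \<and> f1 u = 0 \<and> f0 u \<noteq> 0)" using a lo unfolding B_def by auto
      have b': "b = \<infinity> \<or> (\<exists>u. b = ereal u \<and> f1 u = 0 \<and> f0 u \<noteq> 0)" using b hi unfolding B_def by auto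
      have "iv a b \<subseteq> iv lo hi"
        by (rule iv_mono) (use a b in \<open>auto simp: B_def iv_def intro: less_imp_le\<close>)
      then have nc: "f0 x = 0" if "x \<in> iv a b" "f1 x = 0" for x using that \<open>iv a b \<inter> B = {}\<close> unfolding B_def by auto
      show ?thesis using segment_lower[OF \<open>a < b\<close> a' b' nc] unfolding sum_supp_def by simp
    qed
    \<comment> \<open>Now the weight is (m1 - 1) - m1 = -1, balanced by the charge rgt = 1.\<close>
    show "0 \<le> wQ x - D x + (lft (ereal x) - 1) + rgt (ereal x)" if "x \<in> B" for x
    proof -
      have x: "f1 x = 0" "f0 x \<noteq> 0" using that unfolding B_def by auto
      then show ?thesis using m_crit[OF x(2,1)] m0_0[of x] unfolding wQ_def D_def lft_def rgt_def by simp
    qed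
  qed (use assms finw in \<open>auto simp: B_def\<close>)
  also have "\<dots> = sum_supp (\<lambda>x. wQ x + - D x) (iv lo hi)" unfolding sum_supp_def by simp
  also have "\<dots> = sum_supp wQ (iv lo hi) - sum_supp D (iv lo hi)"
    using sum_supp_add[of "iv lo hi" wQ "\<lambda>x. - D x"] fin_wQ fin(2) by (simp add: sum_supp_uminus)
  finally show ?thesis by simp
qed

text \<open>The circle of the argument principle meets the axis at A, while the segments end at lo;
  with neither zeros nor critical points in between, both see the same sum of \<open>D\<close>. If g
  has a zero beyond -R, it becomes lo, and A lies just to its right, where g < 0 because F < 0.
  Otherwise f0 has at most one zero beyond -R, and to the left of it g has constant sign.\<close>

lemma left_window:
  assumes "R > 0"
  obtains lo A where "A \<le> - R" "lo < ereal A" "lo = - \<infinity> \<or> (\<exists>u. lo = ereal u \<and> f1 u = 0 \<and> f0 u \<noteq> 0)"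
    "\<And>x. lo < ereal x \<Longrightarrow> x \<le> A \<Longrightarrow> f0 x \<noteq> 0 \<and> f1 x \<noteq> 0"
    "sgn (f1 A / f0 A) = 1 - 2 * of_int (lft lo)"
proof (cases "\<exists>u. u < - R \<and> f1 u = 0 \<and> f0 u \<noteq> 0")
  case True
  then obtain u where u: "u < - R" "f1 u = 0" "f0 u \<noteq> 0" by blast
  define K where "K = {x. u < x \<and> x \<le> - R \<and> (f0 x = 0 \<or> f1 x = 0)}"
  have "finite K" unfolding K_def
    by (rule finite_subset[OF _ finite_UnI[OF fin0[of u "- R"] finf1[of u "- R"]]]) auto
  \<comment> \<open>Halfway from u to the next zero or critical point, or to -R if none comes
    earlier.\<close>
  define A where "A = (u + Min (insert (- R) K)) / 2"
  have "Min (insert (- R) K) \<in> insert (- R) K" using \<open>finite K\<close> by (intro Min_in) auto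
  then have gt: "u < Min (insert (- R) K)" using u unfolding K_def by auto
  have le: "Min (insert (- R) K) \<le> x" if "x \<in> insert (- R) K" for x using \<open>finite K\<close> that by (intro Min_le) auto
  have A: "u < A" "A < Min (insert (- R) K)" "A \<le> - R" using gt le[of "- R"] unfolding A_def by auto
  have nz: "f0 x \<noteq> 0 \<and> f1 x \<noteq> 0" if "u < x" "x \<le> A" for x
    using le[of x] A that unfolding K_def by auto
  have nz0: "f0 x \<noteq> 0" if "u \<le> x" "x \<le> A" for x using nz[of x] u(3) that by (cases "x = u") auto
  have "f1 A / f0 A < f1 u / f0 u"
  proof (rule DERIV_neg_imp_decreasing[OF A(1)])
    show "\<exists>d. ((\<lambda>x. f1 x / f0 x) has_real_derivative d) (at x) \<and> d < 0" if "u \<le> x" "x \<le> A" for x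
      using logderiv_deriv[of x] F_neg[of x] nz0[OF that] that A
      by (intro exI[of _ "F x / (f0 x)^2"]) (auto intro!: divide_neg_pos)
  qed
  then have "f1 A / f0 A < 0" using u by simp
  then show thesis using A u nz by (intro that[of A "ereal u"]) (auto simp: lft_def sgn_if)
next
  case False
  have one: False if "x < y" "y < - R" "f0 x = 0" "f0 y = 0" for x y
  proof -
    obtain z where "x < z" "z < y" "f1 z = 0" "f0 z \<noteq> 0" using crit_between_zeros[OF \<open>x < y\<close>] \<open>f0 x = 0\<close> \<open>f0 y = 0\<close> by blast
    with False \<open>y < - R\<close> show False by (meson less_trans)
  qed
  obtain A where A: "A < - R" "\<And>x. x \<le> A \<Longrightarrow> f0 x \<noteq> 0"
  proof (cases "\<exists>y. y < - R \<and> f0 y = 0")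
    case True
    then obtain y where y: "y < - R" "f0 y = 0" by blast
    show ?thesis
    proof (rule that[of "y - 1"])
      show "f0 x \<noteq> 0" if "x \<le> y - 1" for x using one[of x y] that y by auto
    qed (use y in auto)
  next
    case False
    show ?thesis by (rule that[of "- R - 1"]) (use False in auto)
  qed
  have nz: "f0 x \<noteq> 0 \<and> f1 x \<noteq> 0" if "x \<le> A" for x using A(2)[OF that] A(1) False that by auto
  have const: "(f0 A * f1 A) * (f0 x * f1 x) > 0" if "x \<le> A" for x
  proof (rule same_sign[where k = "\<lambda>x. f0 x * f1 x"])
    show "isCont (\<lambda>x. f0 x * f1 x) z" for z by (intro continuous_intros)
  qed (use nz that in \<open>auto simp: min_def max_def split: if_splits\<close>)
  have "sgn (f1 A / f0 A) = 1 - 2 * of_int (lft (- \<infinity>))"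
  proof (cases "f0 A * f1 A < 0")
    case True
    then have "\<forall>x<A. f0 x * f1 x < 0" using const by (force simp: zero_less_mult_iff[of "f0 A * f1 A"])
    then have "lft (- \<infinity>) = 1" unfolding lft_def by auto
    then show ?thesis using True by (auto simp: sgn_if mult_less_0_iff divide_less_0_iff zero_less_divide_iff)
  next
    case 1: False
    have "\<not> (\<exists>X. \<forall>x<X. f0 x * f1 x < 0)"
    proof
      assume "\<exists>X. \<forall>x<X. f0 x * f1 x < 0"
      then obtain X where "\<forall>x<X. f0 x * f1 x < 0" by blast
      then have "f0 (min A (X - 1)) * f1 (min A (X - 1)) < 0" by (auto simp: min_def)
      then show False using const[of "min A (X - 1)"] 1 mult_nonneg_nonpos[of "f0 A * f1 A" "f0 (min A (X - 1)) * f1 (min A (X - 1))"] by linarith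
    qed
    then have "lft (- \<infinity>) = 0" unfolding lft_def by auto
    moreover have "f0 A * f1 A > 0" using 1 nz[of A] by (metis linorder_neqE_linordered_idom mult_eq_0_iff order_refl)
    ultimately show ?thesis by (auto simp: sgn_if zero_less_mult_iff zero_less_divide_iff divide_less_0_iff)
  qed
  then show thesis using A nz by (intro that[of A "- \<infinity>"]) auto
qed

lemma right_window:
  assumes "R > 0"
  obtains hi A where "R \<le> A" "ereal A < hi" "hi = \<infinity> \<or> (\<exists>u. hi = ereal u \<and> f1 u = 0 \<and> f0 u \<noteq> 0)"
    "\<And>x. A \<le> x \<Longrightarrow> ereal x < hi \<Longrightarrow> f0 x \<noteq> 0 \<and> f1 x \<noteq> 0"
    "sgn (f1 A / f0 A) = 2 * of_int (rgt hi) - 1"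
proof -
  interpret m: real_jet_mult "\<lambda>x. f0 (- x)" "\<lambda>x. - f1 (- x)" "\<lambda>x. f2 (- x)" "\<lambda>x. - f3 (- x)"
     "\<lambda>x. m0 (- x)" "\<lambda>x. m1 (- x)" "\<lambda>x. mF (- x)" "\<lambda>x. mF1 (- x)" R by (rule mirror)
  note thesisI = that
  show thesis
  proof (rule m.left_window[OF assms])
    fix lo A assume A: "A \<le> - R" "lo < ereal A" "lo = - \<infinity> \<or> (\<exists>u. lo = ereal u \<and> - f1 (- u) = 0 \<and> f0 (- u) \<noteq> 0)"
      "\<And>x. lo < ereal x \<Longrightarrow> x \<le> A \<Longrightarrow> f0 (- x) \<noteq> 0 \<and> - f1 (- x) \<noteq> 0"
      "sgn (- f1 (- A) / f0 (- A)) = 1 - 2 * of_int (m.lft lo)"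
    have "(\<exists>X. \<forall>x<X. f0 (- x) * - f1 (- x) < 0) \<longleftrightarrow> (\<exists>X. \<forall>x>X. f0 x * f1 x > 0)"
    proof
      assume "\<exists>X. \<forall>x<X. f0 (- x) * - f1 (- x) < 0"
      then obtain X where X: "\<And>x. x < X \<Longrightarrow> f0 (- x) * - f1 (- x) < 0" by blast
      have "f0 x * f1 x > 0" if "x > - X" for x using X[of "- x"] that by simp
      then show "\<exists>X. \<forall>x>X. f0 x * f1 x > 0" by blast
    next
      assume "\<exists>X. \<forall>x>X. f0 x * f1 x > 0"
      then obtain X where X: "\<And>x. x > X \<Longrightarrow> f0 x * f1 x > 0" by blast
      have "f0 (- x) * - f1 (- x) < 0" if "x < - X" for x using X[of "- x"] that by simp
      then show "\<exists>X. \<forall>x<X. f0 (- x) * - f1 (- x) < 0" by blast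
    qed
    moreover have "- lo = \<infinity> \<longleftrightarrow> lo = - \<infinity>" by (cases lo) auto
    ultimately have lr: "m.lft lo = rgt (- lo)" unfolding m.lft_def rgt_def by simp
    show thesis
    proof (rule thesisI[of "- A" "- lo"])
      show "ereal (- A) < - lo" using A(2) by (metis ereal_minus_less_minus uminus_ereal.simps(1))
      show "- lo = \<infinity> \<or> (\<exists>u. - lo = ereal u \<and> f1 u = 0 \<and> f0 u \<noteq> 0)"
        using A(3) by (auto intro: exI[of _ "- _"])
      show "f0 x \<noteq> 0 \<and> f1 x \<noteq> 0" if "- A \<le> x" "ereal x < - lo" for x
      proof -
        have "lo < ereal (- x)" using that(2) by (metis ereal_less_uminus_reorder uminus_ereal.simps(1))
        then show ?thesis using A(4)[of "- x"] that by simp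
      qed
      show "sgn (f1 (- A) / f0 (- A)) = 2 * of_int (rgt (- lo)) - 1"
        using A(5) unfolding lr by (simp add: sgn_minus)
    qed (use A in auto)
  qed
qed

end

subsection \<open>Orders of zeros of entire functions\<close>

lemma entire_eventually_nonzero:
  fixes f :: "complex \<Rightarrow> complex"
  assumes "f holomorphic_on UNIV" "f w \<noteq> 0"
  shows "eventually (\<lambda>z. f z \<noteq> 0) (at z)"
proof -
  have "finite {u \<in> ball z 1. f u = 0}" by (rule entire_finite_zeros[OF assms]) simp
  then have "open (ball z 1 - ({u \<in> ball z 1. f u = 0} - {z}))" by (intro open_Diff finite_imp_closed) auto
  then have "eventually (\<lambda>u. u \<in> ball z 1 - ({u \<in> ball z 1. f u = 0} - {z}) - {z}) (at z)"
    by (intro eventually_at_in_open) auto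
  then show ?thesis by eventually_elim auto
qed

lemma entire_zorder:
  fixes f :: "complex \<Rightarrow> complex"
  assumes "f holomorphic_on UNIV" "f w \<noteq> 0"
  shows "zorder f z \<ge> 0" "zorder f z = 0 \<longleftrightarrow> f z \<noteq> 0"
proof -
  have "f analytic_on {z}" using assms(1) by (simp add: analytic_on_open holomorphic_on_imp_analytic_at[of _ UNIV])
  moreover have "frequently (\<lambda>z. f z \<noteq> 0) (at z)"
    using entire_eventually_nonzero[OF assms] by (intro eventually_frequently) auto
  ultimately show "zorder f z \<ge> 0" "zorder f z = 0 \<longleftrightarrow> f z \<noteq> 0"
    by (simp_all add: zorder_ge_0 zorder_eq_0_iff)
qed

lemma zorder_deriv_analytic:
  assumes "f analytic_on {z}" "eventually (\<lambda>z. f z \<noteq> 0) (at z)" "f z = 0"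
  shows "zorder (deriv f) z = zorder f z - 1"
proof -
  have fr: "frequently (\<lambda>z. f z \<noteq> 0) (at z)" using assms(2) by (intro eventually_frequently) auto
  have "zorder f z \<noteq> 0" using zorder_eq_0_iff[OF assms(1) fr] assms(3) by simp
  then show ?thesis
    by (intro zorder_deriv_minus_1 fr isolated_singularity_at_analytic not_essential_analytic assms)
qed

lemma zorder_mult_nonzero:
  assumes "f analytic_on {z}" "eventually (\<lambda>z. f z \<noteq> 0) (at z)" "u analytic_on {z}" "u z \<noteq> 0"
  shows "zorder (\<lambda>w. f w * u w) z = zorder f z"
proof -
  have "isCont u z" using assms(3) by (rule analytic_at_imp_isCont)
  then have "eventually (\<lambda>w. u w \<noteq> 0) (at z)" using assms(4) unfolding isCont_def by (rule tendsto_imp_eventually_ne)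
  with assms(2) have "eventually (\<lambda>w. f w * u w \<noteq> 0) (at z)" by eventually_elim auto
  then have "zorder (\<lambda>w. f w * u w) z = zorder f z + zorder u z" by (rule zorder_times_analytic[OF assms(1,3)])
  then show ?thesis using zorder_eq_0I[OF assms(3,4)] by simp
qed

lemma zorder_cnj:
  fixes f :: "complex \<Rightarrow> complex"
  assumes holo: "f holomorphic_on UNIV" and "f w \<noteq> 0" and cnj: "\<And>z. f (cnj z) = cnj (f z)"
  shows "zorder f (cnj z) = zorder f z"
proof -
  have an: "f analytic_on {z}" using holo by (simp add: holomorphic_on_imp_analytic_at[of _ UNIV])
  have "frequently (\<lambda>z. f z \<noteq> 0) (at z)"
    using entire_eventually_nonzero[OF assms(1,2)] by (intro eventually_frequently) auto
  then obtain r where r: "zor_poly f z z \<noteq> 0" "r > 0" "zor_poly f z holomorphic_on cball z r"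
    "\<And>w. w \<in> cball z r - {z} \<Longrightarrow> f w = zor_poly f z w * (w - z) powi (zorder f z)"
    using zorder_exist[of f z] an by (metis isolated_singularity_at_analytic not_essential_analytic)
  show ?thesis
  proof (rule zorder_eqI)
    show "open (ball (cnj z) r)" "cnj z \<in> ball (cnj z) r" using r(2) by auto
    have "zor_poly f z holomorphic_on ball z r" using r(3) by (rule holomorphic_on_subset) auto
    moreover have "cnj ` ball (cnj z) r \<subseteq> ball z r"
    proof
      fix x assume "x \<in> cnj ` ball (cnj z) r"
      then obtain y where "x = cnj y" "norm (cnj z - y) < r" by (auto simp: dist_norm)
      then show "x \<in> ball z r" using complex_mod_cnj[of "z - x"] by (simp add: dist_norm)
    qed
    ultimately show "cnj \<circ> zor_poly f z \<circ> cnj holomorphic_on ball (cnj z) r"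
      by (intro holomorphic_on_compose_cnj_cnj) (auto intro: holomorphic_on_subset)
    show "(cnj \<circ> zor_poly f z \<circ> cnj) (cnj z) \<noteq> 0" using r(1) by simp
    show "f u = (cnj \<circ> zor_poly f z \<circ> cnj) u * (u - cnj z) powi (zorder f z)" if "u \<in> ball (cnj z) r" "u \<noteq> cnj z" for u
    proof -
      have "norm (z - cnj u) < r" using that(1) complex_mod_cnj[of "z - cnj u"] by (simp add: dist_norm)
      moreover have "cnj u \<noteq> z" using that(2) by auto
      ultimately have "f (cnj u) = zor_poly f z (cnj u) * (cnj u - z) powi (zorder f z)" by (intro r(4)) (simp add: dist_norm)
      then have "cnj (f (cnj u)) = cnj (zor_poly f z (cnj u) * (cnj u - z) powi (zorder f z))" by simp
      then show ?thesis using cnj[of u] by (simp add: power_int_def split: if_splits)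
    qed
  qed
qed

lemma of_real_Re_if_cnj:
  assumes "\<And>z. f (cnj z) = cnj (f z)"
  shows "of_real (Re (f (of_real x))) = f (of_real x)"
proof (rule complex_eqI)
  have "Im (f (of_real x)) = Im (cnj (f (of_real x)))" by (subst assms[symmetric]) (simp only: complex_cnj_complex_of_real)
  then show "Im (of_real (Re (f (of_real x)))) = Im (f (of_real x))" unfolding cnj.sel by simp
qed simp

lemma has_real_derivative_Re:
  assumes "(f has_field_derivative f') (at (of_real x))"
  shows "((\<lambda>x. Re (f (of_real x))) has_real_derivative Re f') (at x)"
proof -
  have "((\<lambda>x. f (of_real x)) has_vector_derivative f') (at x)"
    using has_vector_derivative_real_field[OF assms] .
  then have "((\<lambda>x. Re (f (of_real x))) has_vector_derivative Re f') (at x)"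
    by (rule bounded_linear.has_vector_derivative[OF bounded_linear_Re])
  then show ?thesis by (simp add: has_real_derivative_iff_has_vector_derivative)
qed

text \<open>The derivative may be computed in the vertical direction. As k is real at x, the real
  part of the difference quotient is Im (k (x + iy)) / y, to which the bound in the upper half-plane
  applies.\<close>

lemma Re_deriv_le_of_Im_le:
  assumes d: "(k has_field_derivative d) (at (of_real x))" and k0: "Im (k (of_real x)) = 0" and x: "x \<noteq> 0"
    and le: "\<And>y. y > 0 \<Longrightarrow> Im (k (Complex x y)) \<le> - c * y / (norm (Complex x y))^2"
  shows "Re d \<le> - c / x^2"
proof -
  have "((\<lambda>h. (k (of_real x + h) - k (of_real x)) / h) \<longlongrightarrow> d) (at 0)"
    using d by (simp add: DERIV_def)
  moreover have "filterlim (\<lambda>y. \<i> * of_real y) (at 0) (at_right (0::real))"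
    by (auto intro!: filterlim_atI tendsto_eq_intros simp: eventually_at_filter)
  ultimately have "((\<lambda>y. (k (of_real x + \<i> * of_real y) - k (of_real x)) / (\<i> * of_real y)) \<longlongrightarrow> d) (at_right (0::real))"
    by (rule filterlim_compose)
  then have "((\<lambda>y. Re ((k (of_real x + \<i> * of_real y) - k (of_real x)) / (\<i> * of_real y))) \<longlongrightarrow> Re d) (at_right (0::real))"
    by (rule tendsto_Re)
  moreover have "((\<lambda>y. - c / (norm (Complex x y))^2) \<longlongrightarrow> - c / x^2) (at_right 0)"
    unfolding cmod_power2 using x by (auto intro!: tendsto_eq_intros)
  moreover have "\<forall>\<^sub>F y in at_right 0. Re ((k (of_real x + \<i> * of_real y) - k (of_real x)) / (\<i> * of_real y)) \<le> - c / (norm (Complex x y))^2"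
    using eventually_at_right_less[of 0]
  proof eventually_elim
    case (elim y)
    have xy: "of_real x + \<i> * of_real y = Complex x y" by (simp add: complex_eq_iff)
    have "Re (A / (\<i> * of_real y)) = Im A / y" for A :: complex
      using elim by (simp add: Re_divide power2_eq_square)
    then have "Re ((k (of_real x + \<i> * of_real y) - k (of_real x)) / (\<i> * of_real y)) = Im (k (Complex x y)) / y"
      unfolding xy using k0 by simp
    also have "\<dots> \<le> (- c * y / (norm (Complex x y))^2) / y"
      using le[OF elim] elim by (intro divide_right_mono) auto
    finally show ?case using elim by simp
  qed
  ultimately show ?thesis by (intro tendsto_le[of "at_right 0"]) auto
qed

lemma entire_eq_0_if_eq_0_on_half_plane:
  assumes "f holomorphic_on UNIV" "finite N" "\<And>z. Im z > 0 \<Longrightarrow> z \<notin> N \<Longrightarrow> f z = 0"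
  shows "f z = 0"
proof (rule ccontr)
  assume "f z \<noteq> 0"
  have "finite {z \<in> ball \<i> 1. f z = 0}" by (rule entire_finite_zeros[OF assms(1) \<open>f z \<noteq> 0\<close>]) simp
  moreover have "ball \<i> 1 \<subseteq> {z \<in> ball \<i> 1. f z = 0} \<union> N"
  proof
    fix w assume w: "w \<in> ball \<i> 1"
    have "\<bar>Im (\<i> - w)\<bar> \<le> norm (\<i> - w)" by (rule abs_Im_le_cmod)
    then have "Im w > 0" using w by (simp add: dist_norm)
    then show "w \<in> {z \<in> ball \<i> 1. f z = 0} \<union> N" using w assms(3)[of w] by auto
  qed
  ultimately have "finite (ball \<i> 1 :: complex set)" using assms(2) finite_subset by blast
  then show False using uncountable_ball[of 1 \<i>] by (simp add: countable_finite)
qed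

text \<open>A constant \<phi>' / \<phi> is the case that the theorem excludes. At a nonreal zero of
  \<phi> the hypothesis is about the value of a division by 0; these finitely many points are set
  aside, and \<phi>' = b \<phi> extends to them and to the axis by the identity theorem.\<close>

lemma real_entire_exponential:
  assumes holo: "\<phi> holomorphic_on UNIV" and cnj: "\<And>z. \<phi> (cnj z) = cnj (\<phi> z)"
    and fin: "finite {z. Im z \<noteq> 0 \<and> \<phi> z = 0}"
    and const: "\<And>z. Im z \<noteq> 0 \<Longrightarrow> deriv \<phi> z / \<phi> z = of_real b"
  shows "\<exists>C \<beta> :: real. \<forall>z. \<phi> z = of_real C * exp (of_real \<beta> * z)"
proof -
  have holo': "deriv \<phi> holomorphic_on UNIV" using holo by (auto intro: holomorphic_deriv)
  have der: "deriv \<phi> z - of_real b * \<phi> z = 0" for z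
  proof (rule entire_eq_0_if_eq_0_on_half_plane[OF _ fin, where f = "\<lambda>z. deriv \<phi> z - of_real b * \<phi> z"])
    show "(\<lambda>z. deriv \<phi> z - of_real b * \<phi> z) holomorphic_on UNIV" by (intro holomorphic_intros holo holo')
    show "deriv \<phi> z - of_real b * \<phi> z = 0" if "Im z > 0" "z \<notin> {z. Im z \<noteq> 0 \<and> \<phi> z = 0}" for z
      using const[of z] that by (simp add: field_simps)
  qed
  have "((\<lambda>z. \<phi> z * exp (- of_real b * z)) has_field_derivative 0) (at z within UNIV)" for z
  proof -
    have "(\<phi> has_field_derivative deriv \<phi> z) (at z)" by (rule holomorphic_derivI[OF holo]) auto
    then show ?thesis using der[of z] by (auto intro!: derivative_eq_intros simp: algebra_simps)
  qed
  then obtain C where C: "\<And>z. \<phi> z * exp (- of_real b * z) = C"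
    using has_field_derivative_zero_constant[of UNIV "\<lambda>z. \<phi> z * exp (- of_real b * z)"] by auto
  have eq: "\<phi> z = C * exp (of_real b * z)" for z
    using C[of z] by (simp add: exp_minus field_simps)
  have "of_real (Re C) = C" using of_real_Re_if_cnj[of \<phi> 0, OF cnj] eq[of 0] by simp
  then show ?thesis using eq by metis
qed

lemma lp_logderiv_far_bound:
  assumes "lp_logderiv g"
  obtains b where "\<And>z. Im z \<noteq> 0 \<Longrightarrow> g z = complex_of_real b"
  | R c where "R \<ge> 1" "c > 0" "\<And>z. norm z \<ge> R \<Longrightarrow> Im z > 0 \<Longrightarrow> Im (g z) \<le> - c * Im z / (norm z)^2"
  using lp_logderiv_Im_le[OF assms] by blast

subsection \<open>Functions of the class $\mathcal{L-P^*}$\<close>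

locale lp_star =
  fixes \<phi> :: "complex \<Rightarrow> complex"
  assumes star: "\<phi> \<in> Laguerre_Polya_star"
    and not_exp: "\<not> (\<exists>C \<beta> :: real. \<forall>z. \<phi> z = of_real C * exp (of_real \<beta> * z))"
begin

abbreviation "\<phi>1 \<equiv> deriv \<phi>"
abbreviation "\<phi>2 \<equiv> deriv \<phi>1"
abbreviation "\<phi>3 \<equiv> deriv \<phi>2"
abbreviation "lg \<equiv> \<lambda>z. \<phi>1 z / \<phi> z"
definition "G z = \<phi> z * \<phi>2 z - (\<phi>1 z)^2"
definition "G1 z = \<phi>1 z * \<phi>3 z - (\<phi>2 z)^2"

lemma holo: "\<phi> holomorphic_on UNIV" "\<phi>1 holomorphic_on UNIV" "\<phi>2 holomorphic_on UNIV" "\<phi>3 holomorphic_on UNIV"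
  using holomorphic_Laguerre_Polya_star[OF star] by (auto intro!: holomorphic_deriv)

lemma holo_G: "G holomorphic_on UNIV" "G1 holomorphic_on UNIV"
  unfolding G_def[abs_def] G1_def[abs_def] by (intro holomorphic_intros holo)+

lemma analytic: "f holomorphic_on UNIV \<Longrightarrow> f analytic_on {z}"
  by (simp add: holomorphic_on_imp_analytic_at[of _ UNIV])

lemma deriv_at: "f holomorphic_on UNIV \<Longrightarrow> (f has_field_derivative deriv f z) (at z)"
  by (rule holomorphic_derivI) auto

lemma cnj0: "\<phi> (cnj z) = cnj (\<phi> z)" by (rule cnj_Laguerre_Polya_star[OF star])
lemma cnj1: "\<phi>1 (cnj z) = cnj (\<phi>1 z)" by (rule deriv_cnj_commute[OF holo(1) cnj0])
lemma cnj2: "\<phi>2 (cnj z) = cnj (\<phi>2 z)" by (rule deriv_cnj_commute[OF holo(2) cnj1])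
lemma cnj3: "\<phi>3 (cnj z) = cnj (\<phi>3 z)" by (rule deriv_cnj_commute[OF holo(3) cnj2])

lemma nonzero: obtains w where "\<phi> w \<noteq> 0"
proof -
  have "\<not> (\<forall>z. \<phi> z = 0)" using not_exp by (metis mult_zero_left of_real_0)
  then show thesis using that by blast
qed

lemma nonzero1: obtains w where "\<phi>1 w \<noteq> 0"
proof (rule ccontr)
  assume "\<not> thesis"
  then have z: "\<phi>1 z = 0" for z using that by blast
  have "\<exists>C \<beta> :: real. \<forall>z. \<phi> z = of_real C * exp (of_real \<beta> * z)"
    by (rule real_entire_exponential[OF holo(1) cnj0 finite_nonreal_zeros_Laguerre_Polya_star[OF star], of 0]) (simp add: z)
  then show False using not_exp by blast
qed

lemma far_bound:
  obtains R c where "R \<ge> 1" "c > 0" "\<And>z. norm z \<ge> R \<Longrightarrow> Im z \<noteq> 0 \<Longrightarrow> \<phi> z \<noteq> 0"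
    "\<And>z. norm z \<ge> R \<Longrightarrow> Im z > 0 \<Longrightarrow> Im (lg z) \<le> - c * Im z / (norm z)^2"
  using lp_logderiv_far_bound[OF lp_logderiv_Laguerre_Polya_star[OF star]]
proof cases
  case (1 b)
  then show ?thesis
    using real_entire_exponential[OF holo(1) cnj0 finite_nonreal_zeros_Laguerre_Polya_star[OF star]] not_exp by blast
next
  case (2 R c)
  have "bounded {z. Im z \<noteq> 0 \<and> \<phi> z = 0}"
    using finite_nonreal_zeros_Laguerre_Polya_star[OF star] by (rule finite_imp_bounded)
  then obtain B where B: "\<And>z. Im z \<noteq> 0 \<Longrightarrow> \<phi> z = 0 \<Longrightarrow> norm z \<le> B" unfolding bounded_iff by auto
  show ?thesis by (rule that[of "max R (B + 1)" c]) (use 2 B in force)+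
qed

definition "f0 x = Re (\<phi> (of_real x))"
definition "f1 x = Re (\<phi>1 (of_real x))"
definition "f2 x = Re (\<phi>2 (of_real x))"
definition "f3 x = Re (\<phi>3 (of_real x))"

lemma of_real_f: "\<phi> (of_real x) = of_real (f0 x)" "\<phi>1 (of_real x) = of_real (f1 x)"
  "\<phi>2 (of_real x) = of_real (f2 x)" "\<phi>3 (of_real x) = of_real (f3 x)"
  unfolding f0_def f1_def f2_def f3_def
  using of_real_Re_if_cnj[of \<phi>, OF cnj0] of_real_Re_if_cnj[of \<phi>1, OF cnj1]
    of_real_Re_if_cnj[of \<phi>2, OF cnj2] of_real_Re_if_cnj[of \<phi>3, OF cnj3] by simp_all

sublocale jet: real_jet f0 f1 f2 f3
proof
  fix x
  show "(f0 has_real_derivative f1 x) (at x)" "(f1 has_real_derivative f2 x) (at x)" "(f2 has_real_derivative f3 x) (at x)"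
    unfolding f0_def[abs_def] f1_def[abs_def] f2_def[abs_def] f3_def by (intro has_real_derivative_Re deriv_at holo)+
  have "(f3 has_real_derivative Re (deriv \<phi>3 (of_real x))) (at x)"
    unfolding f3_def[abs_def] by (intro has_real_derivative_Re deriv_at holo)
  then show "isCont f3 x" by (rule DERIV_isCont)
qed

lemma of_real_G: "G (of_real x) = of_real (jet.F x)" "G1 (of_real x) = of_real (jet.F1 x)"
  unfolding G_def G1_def jet.F_def jet.F1_def of_real_f by simp_all

lemma zero_iff: "\<phi> (of_real x) = 0 \<longleftrightarrow> f0 x = 0" "\<phi>1 (of_real x) = 0 \<longleftrightarrow> f1 x = 0"
  "G (of_real x) = 0 \<longleftrightarrow> jet.F x = 0" "G1 (of_real x) = 0 \<longleftrightarrow> jet.F1 x = 0"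
  unfolding of_real_f of_real_G by simp_all

lemma lg_deriv: "\<phi> z \<noteq> 0 \<Longrightarrow> (lg has_field_derivative G z / (\<phi> z)^2) (at z)"
  using DERIV_divide[OF deriv_at[OF holo(2)] deriv_at[OF holo(1)]] by (simp add: G_def power2_eq_square mult_ac)

lemma F_neg_far:
  assumes "R \<ge> 1" "c > 0" "\<And>z. norm z \<ge> R \<Longrightarrow> Im z > 0 \<Longrightarrow> Im (lg z) \<le> - c * Im z / (norm z)^2"
    and x: "\<bar>x\<bar> \<ge> R" "f0 x \<noteq> 0"
  shows "jet.F x < 0"
proof -
  have "Re (of_real (jet.F x / (f0 x)^2)) \<le> - c / x^2"
  proof (rule Re_deriv_le_of_Im_le)
    show "(lg has_field_derivative of_real (jet.F x / (f0 x)^2)) (at (of_real x))"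
      using lg_deriv[of "of_real x"] x(2) unfolding of_real_f of_real_G by simp
    show "Im (lg (of_real x)) = 0" unfolding of_real_f by simp
    show "Im (lg (Complex x y)) \<le> - c * y / (norm (Complex x y))^2" if "y > 0" for y
      using assms(3)[of "Complex x y"] x that abs_Re_le_cmod[of "Complex x y"] by simp
  qed (use x assms(1) in auto)
  also have "\<dots> < 0" using x assms by auto
  finally have "jet.F x / (f0 x)^2 < 0" by simp
  then show ?thesis using x(2) by (simp add: divide_less_0_iff)
qed

text \<open>With the pole at \<alpha> split off, k is again of the form \<open>lp_logderiv\<close>.
  The two alternatives, known off the axis, reach real points by continuity in the constant case and
  by \<open>Re_deriv_le_of_Im_le\<close> in the other. The constant case does occur, for C (z -
  \<alpha>) exp (\<beta> z).\<close>

lemma far_tail: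
  assumes \<alpha>: "f0 \<alpha> = 0"
  obtains X gt where "X > 0" "X \<ge> \<bar>\<alpha>\<bar>" "\<And>x. \<bar>x\<bar> > X \<Longrightarrow> f0 x \<noteq> 0 \<Longrightarrow> f1 x / f0 x = 1 / (x - \<alpha>) + gt x"
    "(\<exists>b. \<forall>x. \<bar>x\<bar> > X \<and> f0 x \<noteq> 0 \<longrightarrow> gt x = b) \<or>
     (\<exists>c>0. \<forall>x. \<bar>x\<bar> > X \<and> f0 x \<noteq> 0 \<longrightarrow> (\<exists>d. (gt has_real_derivative d) (at x) \<and> d \<le> - c / x^2))"
proof -
  define k where "k = (\<lambda>z. lg z - 1 / (z - of_real \<alpha>))"
  have lp: "lp_logderiv k" unfolding k_def
    by (rule lp_logderiv_remove_zero[OF star]) (simp add: zero_iff \<alpha>)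
  define gt where "gt = (\<lambda>x. Re (k (of_real x)))"
  have kx: "k (of_real x) = of_real (f1 x / f0 x - 1 / (x - \<alpha>))" for x unfolding k_def of_real_f by simp
  have kreal: "k (of_real x) = of_real (gt x)" for x unfolding gt_def kx by simp
  have eq: "f1 x / f0 x = 1 / (x - \<alpha>) + gt x" for x unfolding gt_def kx by simp
  have kd: "k field_differentiable (at (of_real x))" if "f0 x \<noteq> 0" "x \<noteq> \<alpha>" for x
    unfolding k_def using lg_deriv[of "of_real x"] that
    by (intro derivative_intros) (auto simp: field_differentiable_def zero_iff intro: deriv_at[OF holo(1)] deriv_at[OF holo(2)])
  show thesis
    using lp_logderiv_far_bound[OF lp]
  proof cases
    case (1 b)
    have "gt x = b" if "\<bar>x\<bar> > \<bar>\<alpha>\<bar> + 1" "f0 x \<noteq> 0" for x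
    proof -
      have "isCont k (of_real x)" by (rule field_differentiable_imp_continuous_at[OF kd]) (use that in auto)
      moreover have "filterlim (\<lambda>y. of_real x + \<i> * of_real y) (at (of_real x)) (at_right (0::real))"
        by (auto intro!: filterlim_atI tendsto_eq_intros simp: eventually_at_filter)
      ultimately have "((\<lambda>y. k (of_real x + \<i> * of_real y)) \<longlongrightarrow> k (of_real x)) (at_right (0::real))"
        unfolding isCont_def by (rule filterlim_compose)
      moreover have "\<forall>\<^sub>F y in at_right (0::real). k (of_real x + \<i> * of_real y) = of_real b"
        using eventually_at_right_less[of 0] by eventually_elim (simp add: 1)
      ultimately have "((\<lambda>y. of_real b) \<longlongrightarrow> k (of_real x)) (at_right (0::real))"
        by (simp add: tendsto_cong)
      then have "k (of_real x) = of_real b" by (simp add: tendsto_const_iff)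
      then show ?thesis unfolding kreal by simp
    qed
    then show thesis by (intro that[of "\<bar>\<alpha>\<bar> + 1" gt]) (auto simp: eq)
  next
    case (2 R c)
    have "\<exists>d. (gt has_real_derivative d) (at x) \<and> d \<le> - c / x^2" if x: "\<bar>x\<bar> > max R \<bar>\<alpha>\<bar>" "f0 x \<noteq> 0" for x
    proof -
      have kd': "(k has_field_derivative deriv k (of_real x)) (at (of_real x))"
        using kd[of x] x by (auto simp: field_differentiable_derivI)
      have "Re (deriv k (of_real x)) \<le> - c / x^2"
      proof (rule Re_deriv_le_of_Im_le[OF kd'])
        show "Im (k (Complex x y)) \<le> - c * y / (norm (Complex x y))^2" if "y > 0" for y
          using 2(3)[of "Complex x y"] x that abs_Re_le_cmod[of "Complex x y"] by simp
      qed (use x 2 kreal in auto)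
      moreover have "(gt has_real_derivative Re (deriv k (of_real x))) (at x)"
        unfolding gt_def by (rule has_real_derivative_Re[OF kd'])
      ultimately show ?thesis by blast
    qed
    then show thesis using 2 by (intro that[of "max R \<bar>\<alpha>\<bar>" gt]) (auto simp: eq)
  qed
qed

lemma tail_left: "f0 \<alpha> = 0 \<Longrightarrow> tail_at_bot f0 f1 \<alpha>"
proof -
  assume "f0 \<alpha> = 0"
  then show ?thesis
  proof (rule far_tail)
    fix X gt assume X: "X > 0" "X \<ge> \<bar>\<alpha>\<bar>" "\<And>x. \<bar>x\<bar> > X \<Longrightarrow> f0 x \<noteq> 0 \<Longrightarrow> f1 x / f0 x = 1 / (x - \<alpha>) + gt x"
      "(\<exists>b. \<forall>x. \<bar>x\<bar> > X \<and> f0 x \<noteq> 0 \<longrightarrow> gt x = b) \<or>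
       (\<exists>c>0. \<forall>x. \<bar>x\<bar> > X \<and> f0 x \<noteq> 0 \<longrightarrow> (\<exists>d. (gt has_real_derivative d) (at x) \<and> d \<le> - c / x^2))"
    have lt: "x < - X \<Longrightarrow> \<bar>x\<bar> > X" for x by auto
    show ?thesis unfolding tail_at_bot_def
      by (rule exI[of _ "- X"], rule exI[of _ gt]) (use X lt in \<open>auto; blast\<close>)
  qed
qed

lemma tail_right: "f0 \<alpha> = 0 \<Longrightarrow> tail_at_bot (\<lambda>x. f0 (- x)) (\<lambda>x. - f1 (- x)) (- \<alpha>)"
proof -
  assume "f0 \<alpha> = 0"
  then show ?thesis
  proof (rule far_tail)
    fix X gt assume X: "X > 0" "X \<ge> \<bar>\<alpha>\<bar>" "\<And>x. \<bar>x\<bar> > X \<Longrightarrow> f0 x \<noteq> 0 \<Longrightarrow> f1 x / f0 x = 1 / (x - \<alpha>) + gt x"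
      and alt: "(\<exists>b. \<forall>x. \<bar>x\<bar> > X \<and> f0 x \<noteq> 0 \<longrightarrow> gt x = b) \<or>
       (\<exists>c>0. \<forall>x. \<bar>x\<bar> > X \<and> f0 x \<noteq> 0 \<longrightarrow> (\<exists>d. (gt has_real_derivative d) (at x) \<and> d \<le> - c / x^2))"
    have md: "((\<lambda>x. - gt (- x)) has_real_derivative d) (at x)" if "(gt has_real_derivative d) (at (- x))" for d x
    proof -
      have "((\<lambda>x. gt (- x)) has_real_derivative - d) (at x)" using that by (simp add: DERIV_mirror)
      from DERIV_minus[OF this] show ?thesis by simp
    qed
    show ?thesis unfolding tail_at_bot_def
    proof (rule exI[of _ "- X"], rule exI[of _ "\<lambda>x. - gt (- x)"], intro conjI allI impI)
      fix x assume x: "x < - X" "f0 (- x) \<noteq> 0"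
      have "f1 (- x) / f0 (- x) = 1 / (- x - \<alpha>) + gt (- x)" by (rule X(3)) (use x in auto)
      moreover have "1 / (- x - \<alpha>) = - (1 / (x - - \<alpha>))" by (metis diff_minus_eq_add minus_diff_eq minus_divide_right minus_diff_commute)
      ultimately show "- f1 (- x) / f0 (- x) = 1 / (x - - \<alpha>) + - gt (- x)" by simp
    next
      from alt show "(\<exists>b. \<forall>x<(- X). f0 (- x) \<noteq> 0 \<longrightarrow> - gt (- x) = b) \<or>
        (\<exists>c>0. \<forall>x<(- X). f0 (- x) \<noteq> 0 \<longrightarrow> (\<exists>d. ((\<lambda>x. - gt (- x)) has_real_derivative d) (at x) \<and> d \<le> - c / x^2))"
      proof (elim disjE exE conjE)
        fix b assume "\<forall>x. \<bar>x\<bar> > X \<and> f0 x \<noteq> 0 \<longrightarrow> gt x = b"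
        then have "\<forall>x<(- X). f0 (- x) \<noteq> 0 \<longrightarrow> - gt (- x) = - b" by auto
        then show ?thesis by blast
      next
        fix c assume c: "c > 0" "\<forall>x. \<bar>x\<bar> > X \<and> f0 x \<noteq> 0 \<longrightarrow> (\<exists>d. (gt has_real_derivative d) (at x) \<and> d \<le> - c / x^2)"
        have "\<exists>d. ((\<lambda>x. - gt (- x)) has_real_derivative d) (at x) \<and> d \<le> - c / x^2" if x: "x < - X" "f0 (- x) \<noteq> 0" for x
        proof -
          have "\<bar>- x\<bar> > X" using x by auto
          then obtain d where "(gt has_real_derivative d) (at (- x))" "d \<le> - c / (- x)^2" using c(2) x(2) by blast
          then show ?thesis using md by (intro exI[of _ d]) auto
        qed
        then show ?thesis using c(1) by blast
      qed
    qed (use X in auto)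
  qed
qed

end

text \<open>At a zero of \<psi>, of whatever order, \<psi>' / \<psi> has a simple pole, so Q has a
  pole even if its numerator K vanishes. Elsewhere Q is K times the nonvanishing analytic factor 1 /
  \<psi>^2.\<close>

lemma zero_at_Qf_iff:
  fixes \<psi> :: "complex \<Rightarrow> complex"
  assumes holo: "\<psi> holomorphic_on UNIV" and nz: "\<psi> w \<noteq> 0"
  defines "K \<equiv> \<lambda>z. \<psi> z * deriv (deriv \<psi>) z - (deriv \<psi> z)^2"
  shows "zero_at (Qf \<psi>) z \<longleftrightarrow> \<psi> z \<noteq> 0 \<and> K z = 0"
    and "\<psi> z \<noteq> 0 \<Longrightarrow> K v \<noteq> 0 \<Longrightarrow> zorder (Qf \<psi>) z = zorder K z"
proof -
  have holo1: "deriv \<psi> holomorphic_on UNIV" using holo by (auto intro: holomorphic_deriv)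
  have holo2: "deriv (deriv \<psi>) holomorphic_on UNIV" using holo1 by (auto intro: holomorphic_deriv)
  have holoK: "K holomorphic_on UNIV" unfolding K_def by (intro holomorphic_intros holo holo1 holo2)
  have an: "f analytic_on {z}" if "f holomorphic_on UNIV" for f z using that by (simp add: holomorphic_on_imp_analytic_at[of _ UNIV])
  have near: "\<forall>\<^sub>F u in nhds z. Qf \<psi> u = K u * (1 / (\<psi> u)^2)" if "\<psi> z \<noteq> 0"
  proof -
    have "isCont \<psi> z" by (rule analytic_at_imp_isCont[OF an[OF holo]])
    then have "\<forall>\<^sub>F u in nhds z. \<psi> u \<noteq> 0"
      using that by (simp add: isCont_def tendsto_imp_eventually_ne eventually_nhds_conv_at)
    then show ?thesis by eventually_elim (simp add: Qf_eq[OF holo] K_def)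
  qed
  have an1: "(\<lambda>u. 1 / (\<psi> u)^2) analytic_on {z}" if "\<psi> z \<noteq> 0" using that by (intro analytic_intros an holo) auto
  show "zorder (Qf \<psi>) z = zorder K z" if "\<psi> z \<noteq> 0" "K v \<noteq> 0"
  proof -
    have "zorder (Qf \<psi>) z = zorder (\<lambda>u. K u * (1 / (\<psi> u)^2)) z"
      using near[OF that(1)] by (intro zorder_cong) (auto simp: eventually_nhds_conv_at)
    also have "\<dots> = zorder K z"
      by (rule zorder_mult_nonzero[OF an[OF holoK] entire_eventually_nonzero[OF holoK that(2)] an1[OF that(1)]]) (use that in auto)
    finally show ?thesis .
  qed
  show "zero_at (Qf \<psi>) z \<longleftrightarrow> \<psi> z \<noteq> 0 \<and> K z = 0"
  proof (cases "\<psi> z = 0")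
    case False
    have "isCont (\<lambda>u. K u * (1 / (\<psi> u)^2)) z"
      by (intro analytic_at_imp_isCont analytic_intros an1[OF False] an holoK)
    then have "isCont (Qf \<psi>) z" using isCont_cong[OF near[OF False]] by simp
    moreover have "Qf \<psi> z = K z * (1 / (\<psi> z)^2)" using near[OF False] by (rule eventually_nhds_x_imp_x)
    ultimately show ?thesis using False by (simp add: zero_at_isCont)
  next
    case True
    note ev = entire_eventually_nonzero[OF holo nz, of z]
    have d: "zorder (deriv \<psi>) z = zorder \<psi> z - 1" by (rule zorder_deriv_analytic[OF an[OF holo] ev True])
    have ev1: "\<forall>\<^sub>F u in at z. deriv \<psi> u \<noteq> 0"
    proof -
      have "\<exists>u. deriv \<psi> u \<noteq> 0"
      proof (rule ccontr)
        assume "\<not> (\<exists>u. deriv \<psi> u \<noteq> 0)"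
        then have "(\<psi> has_field_derivative 0) (at u within UNIV)" for u
          using holomorphic_derivI[OF holo, of u] by auto
        then obtain C where "\<And>u. \<psi> u = C" using has_field_derivative_zero_constant[of UNIV \<psi>] by auto
        then show False using True nz by metis
      qed
      then show ?thesis using entire_eventually_nonzero[OF holo1] by blast
    qed
    have fr: "\<exists>\<^sub>F u in at z. \<psi> u \<noteq> 0" "\<exists>\<^sub>F u in at z. deriv \<psi> u \<noteq> 0"
      using ev ev1 by (auto intro: eventually_frequently)
    have mero: "\<psi> meromorphic_on {z}" "deriv \<psi> meromorphic_on {z}"
      using an[OF holo] an[OF holo1] by (auto intro: analytic_on_imp_meromorphic_on)
    have ord: "zorder (\<lambda>u. deriv \<psi> u / \<psi> u) z = - 1"
      using zorder_divide[OF mero(2) fr(2) mero(1) fr(1)] d by simp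
    have m: "(\<lambda>u. deriv \<psi> u / \<psi> u) meromorphic_on {z}" by (intro meromorphic_intros mero)
    have "\<forall>\<^sub>F u in at z. deriv \<psi> u / \<psi> u \<noteq> 0" using ev ev1 by eventually_elim auto
    then have "is_pole (\<lambda>u. deriv \<psi> u / \<psi> u) z" using ord by (intro zorder_neg_imp_is_pole m) auto
    then have "is_pole (Qf \<psi>) z" unfolding Qf_def using m by (intro is_pole_deriv) (auto simp: meromorphic_at_iff)
    then show ?thesis using True unfolding zero_at_def is_pole_def
      using not_tendsto_and_filterlim_at_infinity[of "at z" "Qf \<psi>"] by auto
  qed
qed

lemma entire_finite_real_zeros:
  assumes "f holomorphic_on UNIV" "f w \<noteq> 0"
  shows "finite {x::real. a \<le> x \<and> x \<le> b \<and> f (of_real x) = 0}"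
proof (rule finite_imageD[of complex_of_real])
  have "finite {z \<in> cball 0 (max \<bar>a\<bar> \<bar>b\<bar>). f z = 0}" by (rule entire_finite_zeros[OF assms]) simp
  then show "finite (complex_of_real ` {x. a \<le> x \<and> x \<le> b \<and> f (of_real x) = 0})"
    by (rule finite_subset[rotated]) auto
qed (auto simp: inj_on_def)

context lp_star
begin

lemma exists_f0_nonzero: "\<exists>x>a. f0 x \<noteq> 0"
proof (rule ccontr)
  assume n: "\<not> (\<exists>x>a. f0 x \<noteq> 0)"
  obtain w where "\<phi> w \<noteq> 0" by (rule nonzero)
  then have "finite {x::real. a \<le> x \<and> x \<le> a + 1 \<and> \<phi> (of_real x) = 0}"
    by (rule entire_finite_real_zeros[OF holo(1)])
  moreover have "{a<..<a + 1} \<subseteq> {x::real. a \<le> x \<and> x \<le> a + 1 \<and> \<phi> (of_real x) = 0}"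
    using n by (auto simp: zero_iff)
  ultimately have "finite {a<..<a + 1}" by (rule finite_subset[rotated])
  then show False using infinite_Ioo[of a "a + 1"] by simp
qed

lemma nonzero_G: obtains w where "G w \<noteq> 0"
proof (rule far_bound)
  fix R c assume R: "R \<ge> 1" "c > 0" "\<And>z. norm z \<ge> R \<Longrightarrow> Im z > 0 \<Longrightarrow> Im (lg z) \<le> - c * Im z / (norm z)^2"
  obtain x where "x > R" "f0 x \<noteq> 0" using exists_f0_nonzero by blast
  then have "jet.F x < 0" by (intro F_neg_far[OF R]) auto
  then have "G (of_real x) \<noteq> 0" by (simp add: zero_iff)
  then show thesis by (rule that)
qed

definition mz :: "real \<Rightarrow> int" where "mz x = zorder \<phi> (of_real x)"
definition mz1 :: "real \<Rightarrow> int" where "mz1 x = zorder \<phi>1 (of_real x)"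
definition mG :: "real \<Rightarrow> int" where "mG x = zorder G (of_real x)"
(* If G1 vanishes identically its order is a junk value; then any choice compatible with Rolle's theorem will do. *)
definition mG1 :: "real \<Rightarrow> int" where
  "mG1 x = (if \<exists>w. G1 w \<noteq> 0 then zorder G1 (of_real x) else max 1 (mG x))"

text \<open>Near z the function G is g' up to the nonvanishing factor \<phi>^2, and differentiation
  lowers the order of the zero of g by one.\<close>

lemma zorder_G_crit:
  assumes "\<phi> z \<noteq> 0" "\<phi>1 z = 0"
  shows "zorder G z = zorder \<phi>1 z - 1"
proof -
  obtain w1 where w1: "\<phi>1 w1 \<noteq> 0" by (rule nonzero1)
  obtain w where w: "G w \<noteq> 0" by (rule nonzero_G)
  have an: "(\<lambda>u. 1 / \<phi> u) analytic_on {z}" "(\<lambda>u. 1 / (\<phi> u)^2) analytic_on {z}"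
    using assms by (intro analytic_intros analytic holo; simp)+
  have "isCont \<phi> z" by (rule analytic_at_imp_isCont[OF analytic[OF holo(1)]])
  then have ev: "\<forall>\<^sub>F u in nhds z. \<phi> u \<noteq> 0"
    using assms(1) by (simp add: isCont_def tendsto_imp_eventually_ne eventually_nhds_conv_at)
  have ev1: "\<forall>\<^sub>F u in at z. \<phi>1 u \<noteq> 0" by (rule entire_eventually_nonzero[OF holo(2) w1])
  have 1: "zorder (\<lambda>u. \<phi>1 u * (1 / \<phi> u)) z = zorder \<phi>1 z"
    by (rule zorder_mult_nonzero[OF analytic[OF holo(2)] ev1 an(1)]) (use assms in auto)
  have "zorder (deriv (\<lambda>u. \<phi>1 u * (1 / \<phi> u))) z = zorder (\<lambda>u. \<phi>1 u * (1 / \<phi> u)) z - 1"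
  proof (rule zorder_deriv_analytic)
    show "(\<lambda>u. \<phi>1 u * (1 / \<phi> u)) analytic_on {z}" by (intro analytic_on_mult analytic holo an)
    show "\<forall>\<^sub>F u in at z. \<phi>1 u * (1 / \<phi> u) \<noteq> 0"
      using ev1 ev unfolding eventually_nhds_conv_at by (auto elim: eventually_elim2)
  qed (use assms in simp)
  also have "zorder (deriv (\<lambda>u. \<phi>1 u * (1 / \<phi> u))) z = zorder (\<lambda>u. G u * (1 / (\<phi> u)^2)) z"
  proof (rule zorder_cong)
    have "\<forall>\<^sub>F u in nhds z. deriv (\<lambda>u. \<phi>1 u * (1 / \<phi> u)) u = G u * (1 / (\<phi> u)^2)"
      using ev by eventually_elim (use lg_deriv in \<open>auto intro!: DERIV_imp_deriv\<close>)
    then show "\<forall>\<^sub>F u in at z. deriv (\<lambda>u. \<phi>1 u * (1 / \<phi> u)) u = G u * (1 / (\<phi> u)^2)"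
      by (simp add: eventually_nhds_conv_at)
  qed simp
  also have "\<dots> = zorder G z"
    by (rule zorder_mult_nonzero[OF analytic[OF holo_G(1)] entire_eventually_nonzero[OF holo_G(1) w] an(2)]) (use assms in auto)
  finally show ?thesis using 1 by simp
qed

text \<open>The same argument for G / \<phi>1, which has the order of G at z and the derivative
  \<phi> * G1 / \<phi>1^2.\<close>

lemma zorder_G_Rolle:
  assumes "\<phi> z \<noteq> 0" "\<phi>1 z \<noteq> 0" "G z = 0" "G1 v \<noteq> 0"
  shows "zorder G z = zorder G1 z + 1"
proof -
  obtain w where w: "G w \<noteq> 0" by (rule nonzero_G)
  have an: "(\<lambda>u. 1 / \<phi>1 u) analytic_on {z}" "(\<lambda>u. \<phi> u / (\<phi>1 u)^2) analytic_on {z}"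
    using assms by (intro analytic_intros analytic holo; simp)+
  have "isCont \<phi>1 z" by (rule analytic_at_imp_isCont[OF analytic[OF holo(2)]])
  then have ev: "\<forall>\<^sub>F u in nhds z. \<phi>1 u \<noteq> 0"
    using assms(2) by (simp add: isCont_def tendsto_imp_eventually_ne eventually_nhds_conv_at)
  have evG: "\<forall>\<^sub>F u in at z. G u \<noteq> 0" by (rule entire_eventually_nonzero[OF holo_G(1) w])
  have 1: "zorder (\<lambda>u. G u * (1 / \<phi>1 u)) z = zorder G z"
    by (rule zorder_mult_nonzero[OF analytic[OF holo_G(1)] evG an(1)]) (use assms in auto)
  have "zorder (deriv (\<lambda>u. G u * (1 / \<phi>1 u))) z = zorder (\<lambda>u. G u * (1 / \<phi>1 u)) z - 1"
  proof (rule zorder_deriv_analytic)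
    show "(\<lambda>u. G u * (1 / \<phi>1 u)) analytic_on {z}" by (intro analytic_on_mult analytic holo_G an)
    show "\<forall>\<^sub>F u in at z. G u * (1 / \<phi>1 u) \<noteq> 0"
      using evG ev unfolding eventually_nhds_conv_at by (auto elim: eventually_elim2)
  qed (use assms in simp)
  also have "zorder (deriv (\<lambda>u. G u * (1 / \<phi>1 u))) z = zorder (\<lambda>u. G1 u * (\<phi> u / (\<phi>1 u)^2)) z"
  proof (rule zorder_cong)
    have D: "deriv (\<lambda>u. G u * (1 / \<phi>1 u)) u = G1 u * (\<phi> u / (\<phi>1 u)^2)" if "\<phi>1 u \<noteq> 0" for u
    proof -
      have "(G has_field_derivative \<phi>1 u * \<phi>2 u + \<phi>3 u * \<phi> u - 2 * \<phi>1 u * \<phi>2 u) (at u)"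
        unfolding G_def[abs_def] by (auto intro!: derivative_eq_intros deriv_at holo)
      then have "((\<lambda>u. G u * (1 / \<phi>1 u)) has_field_derivative G1 u * (\<phi> u / (\<phi>1 u)^2)) (at u)"
        using that by (auto intro!: derivative_eq_intros deriv_at holo simp: G_def G1_def field_simps power2_eq_square)
      then show ?thesis by (rule DERIV_imp_deriv)
    qed
    then have "\<forall>\<^sub>F u in nhds z. deriv (\<lambda>u. G u * (1 / \<phi>1 u)) u = G1 u * (\<phi> u / (\<phi>1 u)^2)"
      using ev by (auto elim: eventually_mono)
    then show "\<forall>\<^sub>F u in at z. deriv (\<lambda>u. G u * (1 / \<phi>1 u)) u = G1 u * (\<phi> u / (\<phi>1 u)^2)"
      by (simp add: eventually_nhds_conv_at)
  qed simp
  also have "\<dots> = zorder G1 z"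
    by (rule zorder_mult_nonzero[OF analytic[OF holo_G(2)] entire_eventually_nonzero[OF holo_G(2) assms(4)] an(2)]) (use assms in auto)
  finally show ?thesis using 1 by simp
qed

text \<open>\<phi> / \<phi>' has a simple zero at \<alpha>, whatever the multiplicity of
  \<alpha>.\<close>

lemma inverse_logderiv_tendsto_0:
  assumes "f0 \<alpha> = 0"
  shows "((\<lambda>x. f0 x / f1 x) \<longlongrightarrow> 0) (at \<alpha>)"
proof -
  let ?z = "complex_of_real \<alpha>"
  obtain w w1 where w: "\<phi> w \<noteq> 0" "\<phi>1 w1 \<noteq> 0" using nonzero nonzero1 by metis
  note ev = entire_eventually_nonzero[OF holo(1) w(1), of ?z] entire_eventually_nonzero[OF holo(2) w(2), of ?z]
  have mero: "\<phi> meromorphic_on {?z}" "\<phi>1 meromorphic_on {?z}"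
    using holo by (auto intro: analytic_on_imp_meromorphic_on analytic)
  have "zorder (\<lambda>u. \<phi> u / \<phi>1 u) ?z = zorder \<phi> ?z - zorder \<phi>1 ?z"
    by (rule zorder_divide) (use mero ev in \<open>auto intro: eventually_frequently\<close>)
  also have "\<dots> = 1"
    using zorder_deriv_analytic[OF analytic[OF holo(1)] ev(1)] assms by (simp add: zero_iff)
  finally have "isolated_zero (\<lambda>u. \<phi> u / \<phi>1 u) ?z"
    using ev by (intro zorder_pos_imp_isolated_zero meromorphic_intros mero) (auto elim: eventually_elim2)
  then have "((\<lambda>u. \<phi> u / \<phi>1 u) \<longlongrightarrow> 0) (at ?z)" by (simp add: isolated_zero_def)
  moreover have "filterlim complex_of_real (at ?z) (at \<alpha>)"
    by (auto intro!: filterlim_atI tendsto_intros simp: eventually_at_filter)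
  ultimately have "((\<lambda>x. \<phi> (of_real x) / \<phi>1 (of_real x)) \<longlongrightarrow> 0) (at \<alpha>)" by (rule filterlim_compose)
  then have "((\<lambda>x. complex_of_real (f0 x / f1 x)) \<longlongrightarrow> of_real 0) (at \<alpha>)" unfolding of_real_f by simp
  then show ?thesis unfolding tendsto_of_real_iff .
qed

lemma real_jet_mult:
  assumes R: "R \<ge> 1" "c > 0" "\<And>z. norm z \<ge> R \<Longrightarrow> Im z > 0 \<Longrightarrow> Im (lg z) \<le> - c * Im z / (norm z)^2"
  shows "real_jet_mult f0 f1 f2 f3 mz mz1 mG mG1 R"
proof -
  obtain w where w: "\<phi> w \<noteq> 0" by (rule nonzero)
  obtain w1 where w1: "\<phi>1 w1 \<noteq> 0" by (rule nonzero1)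
  obtain wG where wG: "G wG \<noteq> 0" by (rule nonzero_G)
  show ?thesis
  proof
    fix x a b \<alpha>
    show "mz x \<ge> 0" "mz x = 0 \<longleftrightarrow> f0 x \<noteq> 0" unfolding mz_def using entire_zorder[OF holo(1) w] by (simp_all add: zero_iff)
    show "mz1 x \<ge> 0" "mz1 x = 0 \<longleftrightarrow> f1 x \<noteq> 0" unfolding mz1_def using entire_zorder[OF holo(2) w1] by (simp_all add: zero_iff)
    show mG: "mG x \<ge> 0" "mG x = 0 \<longleftrightarrow> jet.F x \<noteq> 0" unfolding mG_def using entire_zorder[OF holo_G(1) wG] by (simp_all add: zero_iff)
    have "mG1 x \<ge> 0 \<and> (mG1 x = 0 \<longleftrightarrow> jet.F1 x \<noteq> 0)"
    proof (cases "\<exists>w. G1 w \<noteq> 0")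
      case True
      then obtain v where v: "G1 v \<noteq> 0" by blast
      show ?thesis unfolding mG1_def using True entire_zorder[OF holo_G(2) v] by (simp add: zero_iff)
    next
      case False
      then show ?thesis unfolding mG1_def using zero_iff(4)[of x] by auto
    qed
    then show "mG1 x \<ge> 0" "mG1 x = 0 \<longleftrightarrow> jet.F1 x \<noteq> 0" by auto
    show "mz1 x = mz x - 1" if "f0 x = 0" unfolding mz1_def mz_def
      by (rule zorder_deriv_analytic[OF analytic[OF holo(1)] entire_eventually_nonzero[OF holo(1) w]]) (simp add: zero_iff that)
    show "mG x = mz1 x - 1" if "f0 x \<noteq> 0" "f1 x = 0" unfolding mG_def mz1_def
      by (rule zorder_G_crit) (use that in \<open>simp_all add: zero_iff\<close>)
    show "mG x \<le> mG1 x + 1" if "f0 x \<noteq> 0" "f1 x \<noteq> 0" "jet.F x = 0"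
    proof (cases "\<exists>w. G1 w \<noteq> 0")
      case True
      then obtain v where v: "G1 v \<noteq> 0" by blast
      then show ?thesis using True zorder_G_Rolle[OF _ _ _ v, of "of_real x"] that
        unfolding mG_def mG1_def by (simp add: zero_iff)
    next
      case False
      then show ?thesis unfolding mG1_def by auto
    qed
    show "((\<lambda>x. f0 x / f1 x) \<longlongrightarrow> 0) (at x)" if "f0 x = 0" by (rule inverse_logderiv_tendsto_0[OF that])
    show "finite {x. a \<le> x \<and> x \<le> b \<and> f0 x = 0}" using entire_finite_real_zeros[OF holo(1) w] by (simp add: zero_iff)
    show "finite {x. a \<le> x \<and> x \<le> b \<and> jet.F x = 0}" using entire_finite_real_zeros[OF holo_G(1) wG] by (simp add: zero_iff)
    show "finite {x. a \<le> x \<and> x \<le> b \<and> f1 x = 0}" using entire_finite_real_zeros[OF holo(2) w1] by (simp add: zero_iff)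
    show "jet.F x < 0" if "\<bar>x\<bar> \<ge> R" "f0 x \<noteq> 0" by (rule F_neg_far[OF R that])
    show "tail_at_bot f0 f1 \<alpha>" if "f0 \<alpha> = 0" by (rule tail_left[OF that])
    show "tail_at_bot (\<lambda>x. f0 (- x)) (\<lambda>x. - f1 (- x)) (- \<alpha>)" if "f0 \<alpha> = 0" by (rule tail_right[OF that])
  qed
qed

end

section \<open>Zero counts as sums of orders\<close>

lemma num_real_zeros_eq:
  fixes w :: "real \<Rightarrow> int"
  assumes Z: "{z. z \<in> \<real> \<and> zero_at q z} = complex_of_real ` X" and "finite X"
    and w: "\<And>x. x \<in> X \<Longrightarrow> zorder q (of_real x) = w x \<and> w x \<ge> 0"
  shows "num_real_zeros q = enat (nat (sum w X))"
proof -
  have "int (\<Sum>z | z \<in> \<real> \<and> zero_at q z. nat (zorder q z)) = (\<Sum>x\<in>X. int (nat (zorder q (of_real x))))"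
    unfolding Z by (subst sum.reindex) (auto simp: inj_on_def)
  also have "\<dots> = sum w X" using w by (intro sum.cong) auto
  finally have "(\<Sum>z | z \<in> \<real> \<and> zero_at q z. nat (zorder q z)) = nat (sum w X)" by (metis nat_int)
  moreover have "finite {z \<in> \<real>. zero_at q z}" unfolding Z using assms(2) by simp
  ultimately show ?thesis unfolding num_zeros_def by simp
qed

lemma num_nonreal_zeros_entire:
  assumes holo: "\<psi> holomorphic_on UNIV" and nz: "\<psi> w \<noteq> 0" and fin: "finite {z. Im z \<noteq> 0 \<and> \<psi> z = 0}"
  shows "num_nonreal_zeros \<psi> = enat (nat (\<Sum>z | Im z \<noteq> 0 \<and> \<psi> z = 0. zorder \<psi> z))"
proof -
  have "isCont \<psi> z" for z
    using holo by (simp add: analytic_at_imp_isCont holomorphic_on_imp_analytic_at[of _ UNIV])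
  then have Z: "{z. z \<in> - \<real> \<and> zero_at \<psi> z} = {z. Im z \<noteq> 0 \<and> \<psi> z = 0}"
    by (auto simp: zero_at_isCont complex_is_Real_iff)
  have "int (\<Sum>z | z \<in> - \<real> \<and> zero_at \<psi> z. nat (zorder \<psi> z)) = (\<Sum>z | z \<in> - \<real> \<and> zero_at \<psi> z. int (nat (zorder \<psi> z)))"
    by simp
  also have "\<dots> = (\<Sum>z | z \<in> - \<real> \<and> zero_at \<psi> z. zorder \<psi> z)"
    by (rule sum.cong[OF refl]) (rule int_nat_eq[THEN trans], simp add: entire_zorder(1)[OF holo nz])
  finally have "nat (int (\<Sum>z | z \<in> - \<real> \<and> zero_at \<psi> z. nat (zorder \<psi> z))) = nat (\<Sum>z | Im z \<noteq> 0 \<and> \<psi> z = 0. zorder \<psi> z)"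
    unfolding Z by (rule arg_cong)
  then have "(\<Sum>z | z \<in> - \<real> \<and> zero_at \<psi> z. nat (zorder \<psi> z)) = nat (\<Sum>z | Im z \<noteq> 0 \<and> \<psi> z = 0. zorder \<psi> z)"
    unfolding nat_int .
  moreover have "finite {z \<in> - \<real>. zero_at \<psi> z}" unfolding Z by (rule fin)
  ultimately show ?thesis unfolding num_zeros_def by simp
qed

lemma even_sum_zorder_nonreal:
  assumes holo: "\<psi> holomorphic_on UNIV" and nz: "\<psi> w \<noteq> 0" and cnj: "\<And>z. \<psi> (cnj z) = cnj (\<psi> z)"
    and fin: "finite {z. Im z \<noteq> 0 \<and> \<psi> z = 0}"
  shows "even (\<Sum>z | Im z \<noteq> 0 \<and> \<psi> z = 0. zorder \<psi> z)"
proof -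
  let ?U = "{z. Im z > 0 \<and> \<psi> z = 0}" and ?L = "{z. Im z < 0 \<and> \<psi> z = 0}"
  have eq: "{z. Im z \<noteq> 0 \<and> \<psi> z = 0} = ?U \<union> ?L" by auto
  have "(\<Sum>z\<in>?L. zorder \<psi> z) = (\<Sum>z\<in>?U. zorder \<psi> z)"
    by (rule sum.reindex_bij_witness[where i = cnj and j = cnj]) (auto simp: cnj zorder_cnj[OF holo nz cnj])
  moreover have "(\<Sum>z | Im z \<noteq> 0 \<and> \<psi> z = 0. zorder \<psi> z) = (\<Sum>z\<in>?U. zorder \<psi> z) + (\<Sum>z\<in>?L. zorder \<psi> z)"
    unfolding eq by (rule sum.union_disjoint) (use fin in \<open>auto simp: eq\<close>)
  ultimately show ?thesis by simp
qed

text \<open>x + iy lies in the disc with diameter [A1, A2] iff y^2 < (x - A1) * (A2 - x), and for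
  |x| < R this product only grows when [-R, R] is enlarged to [A1, A2].\<close>

lemma ball_of_diameter:
  fixes A1 A2 R :: real
  assumes "R > 0" "A1 \<le> - R" "R \<le> A2" "norm z < R"
  shows "z \<in> ball (complex_of_real ((A1 + A2) / 2)) ((A2 - A1) / 2)"
proof -
  let ?c = "(A1 + A2) / 2"
  define x y where "x = Re z" and "y = Im z"
  have n: "x^2 + y^2 < R^2" using assms(1,4) unfolding x_def y_def cmod_power2[symmetric] by (intro power_strict_mono) auto
  have "\<bar>x\<bar> < R" unfolding x_def using abs_Re_le_cmod[of z] assms(4) by linarith
  then have "(x + R) * (R - x) \<le> (x - A1) * (A2 - x)" using assms by (intro mult_mono) auto
  then have "(x - ?c)^2 + y^2 < ((A2 - A1) / 2)^2" using n by (simp add: power2_eq_square field_simps)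
  moreover have "(norm (of_real ?c - z))^2 = (x - ?c)^2 + y^2"
    unfolding cmod_power2 x_def y_def by (simp add: power2_commute)
  ultimately have "(norm (of_real ?c - z))^2 < ((A2 - A1) / 2)^2" by simp
  then have "norm (of_real ?c - z) < (A2 - A1) / 2"
    by (rule power_less_imp_less_base) (use assms in simp)
  then show ?thesis by (simp add: dist_norm)
qed

text \<open>All nonreal zeros have modulus below R and lie in the disc wherever A1 and A2 are chosen
  beyond R; only the real part of the count depends on them.\<close>

lemma sum_zorder_ball:
  fixes A1 A2 R :: real
  assumes holo: "\<psi> holomorphic_on UNIV" and nz: "\<psi> w \<noteq> 0"
    and R: "R > 0" "A1 \<le> - R" "R \<le> A2" and far: "\<And>z. norm z \<ge> R \<Longrightarrow> Im z \<noteq> 0 \<Longrightarrow> \<psi> z \<noteq> 0"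
  shows "(\<Sum>z | z \<in> ball (complex_of_real ((A1 + A2) / 2)) ((A2 - A1) / 2) \<and> \<psi> z = 0. zorder \<psi> z)
    = (\<Sum>z | Im z \<noteq> 0 \<and> \<psi> z = 0. zorder \<psi> z) + (\<Sum>x | A1 < x \<and> x < A2 \<and> \<psi> (of_real x) = 0. zorder \<psi> (of_real x))"
    and "finite {z. Im z \<noteq> 0 \<and> \<psi> z = 0}" "finite {x. A1 < x \<and> x < A2 \<and> \<psi> (of_real x) = 0}"
proof -
  let ?B = "ball (complex_of_real ((A1 + A2) / 2)) ((A2 - A1) / 2)"
  let ?N = "{z. Im z \<noteq> 0 \<and> \<psi> z = 0}" and ?Z = "{x. A1 < x \<and> x < A2 \<and> \<psi> (of_real x) = 0}"
  have real_ball: "complex_of_real x \<in> ?B \<longleftrightarrow> A1 < x \<and> x < A2" for x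
  proof -
    have "dist (complex_of_real ((A1 + A2) / 2)) (of_real x) = \<bar>(A1 + A2) / 2 - x\<bar>"
      unfolding dist_norm of_real_diff[symmetric] norm_of_real ..
    then show ?thesis by (auto simp: abs_if field_simps)
  qed
  have "?N \<subseteq> ?B" using far ball_of_diameter[OF R] by force
  then have eq: "{z. z \<in> ?B \<and> \<psi> z = 0} = ?N \<union> complex_of_real ` ?Z"
  proof (intro set_eqI iffI)
    fix z assume z: "z \<in> {z. z \<in> ?B \<and> \<psi> z = 0}"
    show "z \<in> ?N \<union> complex_of_real ` ?Z"
    proof (cases "Im z = 0")
      case True
      then have "z = of_real (Re z)" by (simp add: complex_eq_iff)
      then show ?thesis using z real_ball[of "Re z"] by (metis (mono_tags, lifting) UnI2 imageI mem_Collect_eq)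
    qed (use z in auto)
  qed (use real_ball in auto)
  have fin: "finite {z \<in> ?B. \<psi> z = 0}" by (rule entire_finite_zeros[OF holo nz]) simp
  then have fins: "finite ?N" "finite (complex_of_real ` ?Z)" unfolding eq by auto
  then show "finite ?N" "finite ?Z" by (auto dest!: finite_imageD simp: inj_on_def)
  have "(\<Sum>z | z \<in> ?B \<and> \<psi> z = 0. zorder \<psi> z) = (\<Sum>z\<in>?N. zorder \<psi> z) + (\<Sum>z\<in>complex_of_real ` ?Z. zorder \<psi> z)"
    unfolding eq by (rule sum.union_disjoint) (use fins in auto)
  also have "(\<Sum>z\<in>complex_of_real ` ?Z. zorder \<psi> z) = (\<Sum>x\<in>?Z. zorder \<psi> (of_real x))"
    by (subst sum.reindex) (auto simp: inj_on_def)
  finally show "(\<Sum>z | z \<in> ?B \<and> \<psi> z = 0. zorder \<psi> z) = (\<Sum>z\<in>?N. zorder \<psi> z) + (\<Sum>x\<in>?Z. zorder \<psi> (of_real x))" .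
qed

section \<open>The two inequalities\<close>

context lp_star
begin

lemma zero_at_Qf: "zero_at (Qf \<phi>) (of_real x) \<longleftrightarrow> f0 x \<noteq> 0 \<and> jet.F x = 0"
proof -
  obtain w where w: "\<phi> w \<noteq> 0" by (rule nonzero)
  show ?thesis using zero_at_Qf_iff(1)[OF holo(1) w] by (simp add: zero_iff flip: G_def)
qed

lemma zero_at_Qf1: "zero_at (Qf \<phi>1) (of_real x) \<longleftrightarrow> f1 x \<noteq> 0 \<and> jet.F1 x = 0"
proof -
  obtain w where w: "\<phi>1 w \<noteq> 0" by (rule nonzero1)
  show ?thesis using zero_at_Qf_iff(1)[OF holo(2) w] by (simp add: zero_iff flip: G1_def)
qed

text \<open>\<open>left_crit\<close> and \<open>right_crit\<close> determine their ends uniquely, so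
  these coincide with a and b, and property A speaks about the two halves of the segment.\<close>

lemma property_A_segment:
  assumes pA: "property_A \<phi>" and \<alpha>: "a < ereal \<alpha>" "ereal \<alpha> < b" "f0 \<alpha> = 0"
    and a: "a = - \<infinity> \<or> (\<exists>u. a = ereal u \<and> f1 u = 0)" and b: "b = \<infinity> \<or> (\<exists>u. b = ereal u \<and> f1 u = 0)"
    and nz: "\<And>x. x \<in> iv a b \<Longrightarrow> x \<noteq> \<alpha> \<Longrightarrow> f1 x \<noteq> 0"
  shows "(\<forall>x\<in>iv a (ereal \<alpha>). \<not> (f0 x \<noteq> 0 \<and> jet.F x = 0)) \<or> (\<forall>x\<in>iv (ereal \<alpha>) b. \<not> (f0 x \<noteq> 0 \<and> jet.F x = 0))"
proof -
  have nzl: "f1 x \<noteq> 0" if "a < ereal x" "x < \<alpha>" for x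
    by (rule nz) (use that \<alpha> in \<open>auto simp: iv_def intro: less_trans[of "ereal x" "ereal \<alpha>"]\<close>)
  have nzr: "f1 x \<noteq> 0" if "\<alpha> < x" "ereal x < b" for x
    by (rule nz) (use that \<alpha> in \<open>auto simp: iv_def intro: less_trans[of a "ereal \<alpha>"]\<close>)
  obtain \<beta>1 \<beta>2 where \<beta>: "left_crit \<phi> \<alpha> \<beta>1" "right_crit \<phi> \<alpha> \<beta>2"
    and Q: "(\<forall>x::real. \<beta>1 < ereal x \<and> x < \<alpha> \<longrightarrow> \<not> zero_at (Qf \<phi>) (of_real x)) \<or>
      (\<forall>x::real. \<alpha> < x \<and> ereal x < \<beta>2 \<longrightarrow> \<not> zero_at (Qf \<phi>) (of_real x))"
    using pA \<alpha>(3) unfolding property_A_def property_A_at_def zero_iff by blast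
  have "\<beta>1 = a"
  proof -
    from \<beta>(1) consider u where "\<beta>1 = ereal u" "u < \<alpha>" "f1 u = 0" "\<forall>x\<in>{u<..<\<alpha>}. f1 x \<noteq> 0"
      | "\<beta>1 = - \<infinity>" "\<forall>x<\<alpha>. f1 x \<noteq> 0"
      unfolding left_crit_def zero_iff by auto
    then show ?thesis
    proof cases
      case (1 u)
      have "\<not> a < ereal u" using nzl[of u] 1 by auto
      moreover have "\<not> ereal u < a" using a 1 \<alpha>(1) by auto
      ultimately show ?thesis using 1 by auto
    qed (use a \<alpha>(1) in auto)
  qed
  moreover have "\<beta>2 = b"
  proof -
    from \<beta>(2) consider u where "\<beta>2 = ereal u" "\<alpha> < u" "f1 u = 0" "\<forall>x\<in>{\<alpha><..<u}. f1 x \<noteq> 0"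
      | "\<beta>2 = \<infinity>" "\<forall>x>\<alpha>. f1 x \<noteq> 0"
      unfolding right_crit_def zero_iff by auto
    then show ?thesis
    proof cases
      case (1 u)
      have "\<not> ereal u < b" using nzr[of u] 1 by auto
      moreover have "\<not> b < ereal u" using b 1 \<alpha>(2) by auto
      ultimately show ?thesis using 1 by auto
    qed (use b \<alpha>(2) in auto)
  qed
  ultimately show ?thesis using Q unfolding zero_at_Qf iv_def by auto
qed

lemma zero_bounds:
  assumes m: "num_nonreal_zeros \<phi> = enat (2 * m)" and pA: "property_A \<phi>"
  shows "\<exists>m1::nat. num_nonreal_zeros \<phi>1 = enat (2 * m1) \<and>
    ereal (2 * real m - 2 * real m1) \<le> ereal_of_enat (num_real_zeros (Qf \<phi>)) \<and>
    ereal_of_enat (num_real_zeros (Qf \<phi>)) \<le>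
      ereal (2 * real m - 2 * real m1) + ereal_of_enat (num_real_zeros (Qf \<phi>1))"
proof (rule far_bound)
  fix R c assume R1: "R \<ge> 1" and c: "c > 0" and far0: "\<And>z. norm z \<ge> R \<Longrightarrow> Im z \<noteq> 0 \<Longrightarrow> \<phi> z \<noteq> 0"
    and Im_le: "\<And>z. norm z \<ge> R \<Longrightarrow> Im z > 0 \<Longrightarrow> Im (lg z) \<le> - c * Im z / (norm z)^2"
  interpret jm: real_jet_mult f0 f1 f2 f3 mz mz1 mG mG1 R by (rule real_jet_mult[OF R1 c Im_le])
  have R: "R > 0" using R1 by simp
  obtain w where w: "\<phi> w \<noteq> 0" by (rule nonzero)
  obtain w1 where w1: "\<phi>1 w1 \<noteq> 0" by (rule nonzero1)
  obtain wG where wG: "G wG \<noteq> 0" by (rule nonzero_G)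
  have up: "\<phi> z \<noteq> 0 \<and> Im (lg z) < 0" if "norm z \<ge> R" "Im z > 0" for z
  proof -
    have "- c * Im z / (norm z)^2 < 0" using c that R by (intro divide_neg_pos) auto
    then show ?thesis using far0[of z] Im_le[OF that] that by auto
  qed
  have far1: "\<phi>1 z \<noteq> 0" if "norm z \<ge> R" "Im z \<noteq> 0" for z
    using up[of z] up[of "cnj z"] that by (cases "Im z > 0") (auto simp: cnj0 cnj1)
  obtain lo A1 where A1: "A1 \<le> - R" "lo < ereal A1" and lo: "lo = - \<infinity> \<or> (\<exists>u. lo = ereal u \<and> f1 u = 0 \<and> f0 u \<noteq> 0)"
    and nzl: "\<And>x. lo < ereal x \<Longrightarrow> x \<le> A1 \<Longrightarrow> f0 x \<noteq> 0 \<and> f1 x \<noteq> 0"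
    and sl: "sgn (f1 A1 / f0 A1) = 1 - 2 * of_int (jm.lft lo)"
    using jm.left_window[OF R] by metis
  obtain hi A2 where A2: "R \<le> A2" "ereal A2 < hi" and hi: "hi = \<infinity> \<or> (\<exists>u. hi = ereal u \<and> f1 u = 0 \<and> f0 u \<noteq> 0)"
    and nzr: "\<And>x. A2 \<le> x \<Longrightarrow> ereal x < hi \<Longrightarrow> f0 x \<noteq> 0 \<and> f1 x \<noteq> 0"
    and sr: "sgn (f1 A2 / f0 A2) = 2 * of_int (jm.rgt hi) - 1"
    using jm.right_window[OF R] by metis
  have A12: "A1 < A2" using A1 A2 R by linarith
  have lohi: "lo < hi" using A1 A2 A12 by (metis less_ereal.simps(1) less_trans)
  have ivA: "x \<in> iv lo hi" if "A1 \<le> x" "x \<le> A2" for x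
    unfolding iv_def using A1(2) A2(2) that by (auto intro: order.strict_trans2[of lo "ereal A1"] order.strict_trans1[of "ereal x" "ereal A2"])
  have outside: "A1 < x \<and> x < A2" if "x \<in> iv lo hi" "f0 x = 0 \<or> f1 x = 0" for x
    using nzl[of x] nzr[of x] that unfolding iv_def by (auto simp: not_le[symmetric])

  define N0 where "N0 = (\<Sum>z | Im z \<noteq> 0 \<and> \<phi> z = 0. zorder \<phi> z)"
  define N1 where "N1 = (\<Sum>z | Im z \<noteq> 0 \<and> \<phi>1 z = 0. zorder \<phi>1 z)"
  define Z0 where "Z0 = {x. A1 < x \<and> x < A2 \<and> f0 x = 0}"
  define Z1 where "Z1 = {x. A1 < x \<and> x < A2 \<and> f1 x = 0}"
  note ball0 = sum_zorder_ball[OF holo(1) w R A1(1) A2(1) far0]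
  note ball1 = sum_zorder_ball[OF holo(2) w1 R A1(1) A2(1) far1]
  have finZ: "finite Z0" "finite Z1" using ball0(3) ball1(3) unfolding Z0_def Z1_def by (simp_all add: zero_iff)
  have N0: "N0 \<ge> 0" "N1 \<ge> 0" unfolding N0_def N1_def
    using entire_zorder(1)[OF holo(1) w] entire_zorder(1)[OF holo(2) w1] by (auto intro: sum_nonneg)
  have num0: "N0 = 2 * int m"
    using num_nonreal_zeros_entire[OF holo(1) w ball0(2)] m N0 unfolding N0_def by simp
  \<comment> \<open>Nonreal zeros of \<phi>' form conjugate pairs of equal order; this provides
    m1.\<close>
  have "even N1" unfolding N1_def by (rule even_sum_zorder_nonreal[OF holo(2) w1 cnj1 ball1(2)])
  then obtain k where "N1 = 2 * k" by (rule evenE)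
  then obtain m1 where m1: "N1 = 2 * int m1" using N0(2) by (intro that[of "nat k"]) simp
  have num1: "num_nonreal_zeros \<phi>1 = enat (2 * m1)"
    using num_nonreal_zeros_entire[OF holo(2) w1 ball1(2)] m1 unfolding N1_def by simp

  \<comment> \<open>The part of the window outside (A1, A2) has neither zeros nor critical points,
    so the sum of \<open>D\<close> is the difference of the real zero counts on the diameter of the
    circle.\<close>
  have SD: "sum_supp jm.D (iv lo hi) = (\<Sum>x\<in>Z1. mz1 x) - (\<Sum>x\<in>Z0. mz x)"
    and finD: "finite {x \<in> iv lo hi. jm.D x \<noteq> 0}"
  proof -
    have Dz: "jm.D x = 0" if "x \<in> iv lo hi" "x \<notin> Z0 \<union> Z1" for x
    proof -
      have "f0 x \<noteq> 0" "f1 x \<noteq> 0" using outside[OF that(1)] that(2) unfolding Z0_def Z1_def by blast+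
      then show ?thesis unfolding jm.D_def by (simp flip: jm.m0_0 jm.m1_0)
    qed
    have "sum_supp jm.D (iv lo hi) = sum jm.D (Z0 \<union> Z1)"
      by (rule sum_supp_eq) (use finZ Dz ivA in \<open>auto simp: Z0_def Z1_def\<close>)
    also have "\<dots> = (\<Sum>x\<in>Z0 \<union> Z1. mz1 x) - (\<Sum>x\<in>Z0 \<union> Z1. mz x)" unfolding jm.D_def by (rule sum_subtractf)
    also have "(\<Sum>x\<in>Z0 \<union> Z1. mz1 x) = (\<Sum>x\<in>Z1. mz1 x)"
      by (rule sum.mono_neutral_right) (use finZ jm.m1_0 in \<open>auto simp: Z0_def Z1_def\<close>)
    also have "(\<Sum>x\<in>Z0 \<union> Z1. mz x) = (\<Sum>x\<in>Z0. mz x)"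
      by (rule sum.mono_neutral_right) (use finZ jm.m0_0 in \<open>auto simp: Z0_def Z1_def\<close>)
    finally show "sum_supp jm.D (iv lo hi) = (\<Sum>x\<in>Z1. mz1 x) - (\<Sum>x\<in>Z0. mz x)" .
    show "finite {x \<in> iv lo hi. jm.D x \<noteq> 0}"
      by (rule finite_subset[of _ "Z0 \<union> Z1"]) (use Dz finZ in auto)
  qed

  have nzA: "f0 A1 \<noteq> 0" "f1 A1 \<noteq> 0" "f0 A2 \<noteq> 0" "f1 A2 \<noteq> 0" using nzl[of A1] nzr[of A2] A1 A2 by auto
  \<comment> \<open>By \<open>ball_of_diameter\<close> the circle lies in |z| \<ge> R, where
    \<open>up\<close> gives the sign of Im g.\<close>
  have "2 * (of_int (\<Sum>z | z \<in> ball (complex_of_real ((A1 + A2) / 2)) ((A2 - A1) / 2) \<and> \<phi>1 z = 0. zorder \<phi>1 z)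
           - of_int (\<Sum>z | z \<in> ball (complex_of_real ((A1 + A2) / 2)) ((A2 - A1) / 2) \<and> \<phi> z = 0. zorder \<phi> z))
      = sgn (Re (lg A1)) - sgn (Re (lg A2))"
  proof (rule sum_zorder_diff_circle[OF holo(1) cnj0 A12])
    fix z assume z: "z \<in> sphere (complex_of_real ((A1 + A2) / 2)) ((A2 - A1) / 2)" "0 < Im z"
    have "norm z \<ge> R" using ball_of_diameter[OF R A1(1) A2(1), of z] z(1) by (auto simp: not_le[symmetric])
    then show "\<phi> z \<noteq> 0 \<and> Im (lg z) < 0" using up z(2) by blast
  qed (use nzA in \<open>simp_all add: zero_iff\<close>)
  moreover have "(\<Sum>z | z \<in> ball (complex_of_real ((A1 + A2) / 2)) ((A2 - A1) / 2) \<and> \<phi> z = 0. zorder \<phi> z) = N0 + (\<Sum>x\<in>Z0. mz x)"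
    using ball0(1) unfolding N0_def Z0_def mz_def zero_iff .
  moreover have "(\<Sum>z | z \<in> ball (complex_of_real ((A1 + A2) / 2)) ((A2 - A1) / 2) \<and> \<phi>1 z = 0. zorder \<phi>1 z) = N1 + (\<Sum>x\<in>Z1. mz1 x)"
    using ball1(1) unfolding N1_def Z1_def mz1_def zero_iff .
  moreover have "Re (lg (of_real x)) = f1 x / f0 x" for x unfolding of_real_f by simp
  ultimately have "2 * real_of_int ((N1 + (\<Sum>x\<in>Z1. mz1 x)) - (N0 + (\<Sum>x\<in>Z0. mz x))) = sgn (f1 A1 / f0 A1) - sgn (f1 A2 / f0 A2)"
    by (simp only: of_int_diff)
  also have "\<dots> = 2 * real_of_int (1 - jm.lft lo - jm.rgt hi)" unfolding sl sr by simp
  finally have "(N1 + (\<Sum>x\<in>Z1. mz1 x)) - (N0 + (\<Sum>x\<in>Z0. mz x)) = 1 - jm.lft lo - jm.rgt hi"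
    by (metis mult_cancel_left of_int_eq_iff zero_neq_numeral)
  \<comment> \<open>The exact balance: its end terms are those of \<open>total_lower\<close> and
    \<open>total_upper\<close>, and they cancel in both inequalities.\<close>
  then have count: "sum_supp jm.D (iv lo hi) = 1 - jm.lft lo - jm.rgt hi + 2 * int m - 2 * int m1"
    unfolding SD num0 m1 by linarith

  have finB: "finite {x \<in> iv lo hi. f1 x = 0 \<and> f0 x \<noteq> 0}"
    by (rule finite_subset[OF _ finZ(2)]) (use outside in \<open>auto simp: Z1_def\<close>)
  \<comment> \<open>Real zeros of Q have modulus below R, so the window misses none of them.\<close>
  have suppQ: "{x. jm.wQ x \<noteq> 0} = {x. x \<in> iv lo hi \<and> jm.wQ x \<noteq> 0}"
  proof -
    have "x \<in> iv lo hi" if "jm.wQ x \<noteq> 0" for x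
    proof -
      have "f0 x \<noteq> 0" "jet.F x = 0" using that jm.wQ_nz by auto
      then have "\<bar>x\<bar> < R" using jm.F_neg[of x] by (cases "\<bar>x\<bar> \<ge> R") auto
      then show ?thesis using A1 A2 by (intro ivA) auto
    qed
    then show ?thesis by auto
  qed
  define NQ where "NQ = sum_supp jm.wQ (iv lo hi)"
  have NQ: "NQ \<ge> 0" unfolding NQ_def by (rule sum_supp_nonneg) (rule jm.wQ_nonneg)
  have numQ: "num_real_zeros (Qf \<phi>) = enat (nat NQ)"
    unfolding NQ_def sum_supp_def suppQ[symmetric]
  proof (rule num_real_zeros_eq)
    show "{z. z \<in> \<real> \<and> zero_at (Qf \<phi>) z} = complex_of_real ` {x. jm.wQ x \<noteq> 0}"
      by (auto simp: jm.wQ_nz zero_at_Qf elim!: Reals_cases)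
    show "finite {x. jm.wQ x \<noteq> 0}" using jm.fin_wQ[of UNIV] by simp
    show "zorder (Qf \<phi>) (of_real x) = jm.wQ x \<and> 0 \<le> jm.wQ x" if "x \<in> {x. jm.wQ x \<noteq> 0}" for x
    proof -
      have x: "f0 x \<noteq> 0" using that jm.wQ_nz by auto
      have "zorder (Qf \<phi>) (of_real x) = zorder G (of_real x)"
        using zero_at_Qf_iff(2)[OF holo(1) w, of "of_real x" wG] x wG
        by (simp add: zero_iff G_def[abs_def])
      then show ?thesis using x jm.wQ_nonneg[of x] unfolding jm.wQ_def mG_def by simp
    qed
  qed
  have "NQ \<ge> 2 * int m - 2 * int m1"
    using jm.total_lower[OF lohi lo hi finB finD] unfolding count NQ_def[symmetric] by linarith
  then have lower: "ereal (2 * real m - 2 * real m1) \<le> ereal_of_enat (num_real_zeros (Qf \<phi>))"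
    unfolding numQ using NQ by simp
  have upper: "ereal_of_enat (num_real_zeros (Qf \<phi>)) \<le>
      ereal (2 * real m - 2 * real m1) + ereal_of_enat (num_real_zeros (Qf \<phi>1))"
  proof (cases "finite {z. z \<in> \<real> \<and> zero_at (Qf \<phi>1) z}")
    case False
    then have "num_real_zeros (Qf \<phi>1) = \<infinity>" unfolding num_zeros_def by auto
    then show ?thesis by simp
  next
    case True
    define X where "X = {x. f1 x \<noteq> 0 \<and> jet.F1 x = 0}"
    have XZ: "{z. z \<in> \<real> \<and> zero_at (Qf \<phi>1) z} = complex_of_real ` X"
      unfolding X_def by (auto simp: zero_at_Qf1 elim!: Reals_cases)
    with True have finX: "finite X" by (auto dest!: finite_imageD simp: inj_on_def)
    \<comment> \<open>If G1 vanished identically, every real point with f1 \<noteq> 0 would be a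
      zero of Q_1, against finiteness; hence \<open>mG1\<close> is a genuine order here.\<close>
    obtain v where v: "G1 v \<noteq> 0"
    proof -
      have "\<exists>v. G1 v \<noteq> 0"
      proof (rule ccontr)
        assume "\<not> (\<exists>v. G1 v \<noteq> 0)"
        then have "jet.F1 x = 0" for x using zero_iff(4)[of x] by simp
        then have "{0<..<1} \<subseteq> X \<union> {x. 0 \<le> x \<and> x \<le> 1 \<and> f1 x = 0}" unfolding X_def by auto
        then have "finite {0<..<1::real}" using finX jm.finf1[of 0 1] finite_subset by blast
        then show False using infinite_Ioo[of 0 "1::real"] by simp
      qed
      then show thesis using that by blast
    qed
    have suppX: "{x. jm.wQ1 x \<noteq> 0} = X" unfolding X_def using jm.wQ1_nz by auto
    have numQ1: "num_real_zeros (Qf \<phi>1) = enat (nat (sum jm.wQ1 X))"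
    proof (rule num_real_zeros_eq[OF XZ finX])
      fix x assume "x \<in> X"
      then have x: "f1 x \<noteq> 0" unfolding X_def by auto
      have "zorder (Qf \<phi>1) (of_real x) = zorder G1 (of_real x)"
        using zero_at_Qf_iff(2)[OF holo(2) w1, of "of_real x" v] x v
        by (simp add: zero_iff G1_def[abs_def])
      then show "zorder (Qf \<phi>1) (of_real x) = jm.wQ1 x \<and> 0 \<le> jm.wQ1 x"
        using x v jm.wQ1_nonneg[of x] unfolding jm.wQ1_def mG1_def by auto
    qed
    have "1 - jm.lft lo - jm.rgt hi \<le> sum_supp jm.wQ1 (iv lo hi) - sum_supp jm.wQ (iv lo hi) + sum_supp jm.D (iv lo hi)"
    proof (rule jm.total_upper[OF _ lohi lo hi finB finD])
      show "finite {x. f1 x \<noteq> 0 \<and> jet.F1 x = 0}" using finX unfolding X_def .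
      show "(\<forall>x\<in>iv a (ereal \<alpha>). jm.wQ x = 0) \<or> (\<forall>x\<in>iv (ereal \<alpha>) b. jm.wQ x = 0)"
        if "a < ereal \<alpha>" "ereal \<alpha> < b" "f0 \<alpha> = 0"
          "a = - \<infinity> \<or> (\<exists>u. a = ereal u \<and> f1 u = 0)" "b = \<infinity> \<or> (\<exists>u. b = ereal u \<and> f1 u = 0)"
          "\<And>x. x \<in> iv a b \<Longrightarrow> x \<noteq> \<alpha> \<Longrightarrow> f1 x \<noteq> 0" for \<alpha> a b
        using property_A_segment[OF pA that] jm.wQ_nz by blast
    qed
    \<comment> \<open>Zeros of Q_1 outside the window can only increase the right-hand side.\<close>
    moreover have "sum_supp jm.wQ1 (iv lo hi) \<le> sum jm.wQ1 X"
      unfolding sum_supp_def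
      by (rule sum_mono2[OF finX]) (use suppX jm.wQ1_nonneg in auto)
    ultimately have "NQ \<le> 2 * int m - 2 * int m1 + sum jm.wQ1 X" unfolding count NQ_def by linarith
    moreover have "sum jm.wQ1 X \<ge> 0" by (rule sum_nonneg) (rule jm.wQ1_nonneg)
    ultimately have "real_of_int NQ \<le> 2 * real m - 2 * real m1 + real_of_int (sum jm.wQ1 X)" by linarith
    then show ?thesis unfolding numQ numQ1 using NQ \<open>sum jm.wQ1 X \<ge> 0\<close> by simp
  qed
  show ?thesis using num1 lower upper by blast
qed

end

theorem theorem3p16:
  fixes \<phi> :: "complex \<Rightarrow> complex" and m :: nat
  assumes "\<phi> \<in> Laguerre_Polya_star"
    and "\<not> (\<exists>C \<beta> :: real. \<forall>z. \<phi> z = of_real C * exp (of_real \<beta> * z))"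
    and "num_nonreal_zeros \<phi> = enat (2 * m)"
    and "property_A \<phi>"
  shows "\<exists>m1::nat. num_nonreal_zeros (deriv \<phi>) = enat (2 * m1) \<and>
    ereal (2 * real m - 2 * real m1) \<le> ereal_of_enat (num_real_zeros (Qf \<phi>)) \<and>
    ereal_of_enat (num_real_zeros (Qf \<phi>)) \<le>
      ereal (2 * real m - 2 * real m1) + ereal_of_enat (num_real_zeros (Qf (deriv \<phi>)))"
proof -
  interpret lp_star \<phi> by standard (use assms in auto)
  show ?thesis by (rule zero_bounds[OF assms(3,4)])
qed

end
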